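(* Let $\Pi$ be the face poset (with a maximum element adjoined) of a $k$-shellably triangulizable $(d-1)$-dimensional simplicial sphere. Let $S_d(k)$ be a stacked $d$-polytope whose stack subdivision contains exactly $k$ $d$-simplices (equivalently, with $kd+1$ facets). Then, coefficientwise, $\Phi_{\Pi}\le\Phi_{S_d(k)}$, where $\Phi_{S_d(k)}$ is the cd-index of the face lattice of $S_d(k)$.
   Context: For an Eulerian poset $P$ of rank $m+1$ (graded, with $\hat0,\hat1$, and every interval $[s,t]$, $s<t$, having equally many elements of even and odd rank), let $\alpha_P(S)$ ($S\subseteq[m]$) be the number of maximal chains among elements with rank in $S$, $\beta_P(S)=\sum_{T\subseteq S}(-1)^{|S\setminus T|}\alpha_P(T)$, $\Psi_P=\sum_S\beta_P(S)u_S$ with $u_S$ the word in noncommuting $a,b$ having $b$ in positions of $S$ and $a$ elsewhere; the cd-index $\Phi_P$ is the unique noncommutative polynomial with $\Phi_P(a+b,ab+ba)=\Psi_P$. The face poset of a simplicial sphere (including the empty face) with a maximum adjoined is Eulerian. A pure $d$-dimensional complex is shellable if it is $0$-dimensional or its facets admit an order $F_1,\dots,F_k$ with $\partial F_1$ shellable and, for $1<j\le k$, $F_j\cap\bigcup_{i<j}F_i$ equal to $G_1\cup\dots\cup G_r$ for some shelling $G_1,\dots,G_s$ of $\partial F_j$ and $1\le r\le s$. A triangulation of a simplicial polytope $P$ is a subdivision of $P$ into simplices whose boundary complex is combinatorially isomorphic to $\partial P$. A simplicial $d$-polytope is stacked if it has a triangulation (its stack subdivision) in which every face of dimension $\le d-2$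 is a face of $P$ (equivalently, it arises from a $d$-simplex by repeatedly gluing a $d$-simplex along a single facet). A $(d-1)$-dimensional simplicial sphere is $k$-shellably triangulizable if it can be triangulated as a shellable simplicial $d$-ball with exactly $k$ $d$-simplices, i.e. it is the boundary complex of such a ball.
   Formalization: The parenthetical "equivalently, with kd+1 facets" is incorrect for k ≥ 2 (a stacked d-polytope with k simplices has k(d−1)+2 facets; e.g. d=k=2 gives a quadrilateral), so S_d(k) is defined only by its stack subdivision having exactly k d-simplices. *)

theory Defs
  imports "HOL-Analysis.Analysis" "HOL-Library.Poly_Mapping" "HOL-Library.Lattice_Constructions"
begin

section \<open>Noncommutative polynomials\<close>

text \<open>
  Words form a monoid under concatenation, written additively because \<^theory>\<open>HOL-Library.Poly_Mapping\<close>
  wants the exponents of a monoid ring to be additive.  With the ring structure defined there,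
  \<open>'x ncpoly\<close> is the free associative ring over \<open>\<int>\<close> on the letters \<open>'x\<close>.
\<close>

datatype 'x fword = Word (letters: "'x list")

instantiation fword :: (type) monoid_add
begin
definition zero_fword :: "'a fword" where "0 = Word []"
definition plus_fword :: "'a fword \<Rightarrow> 'a fword \<Rightarrow> 'a fword"
  where "v + w = Word (letters v @ letters w)"
instance
  by standard (simp_all add: zero_fword_def plus_fword_def)
end

type_synonym 'x ncpoly = "'x fword \<Rightarrow>\<^sub>0 int"

definition nc_monom :: "'x list \<Rightarrow> 'x ncpoly"
  where "nc_monom w = Poly_Mapping.single (Word w) 1"

definition nc_subst :: "('x \<Rightarrow> 'y ncpoly) \<Rightarrow> 'x ncpoly \<Rightarrow> 'y ncpoly"
  where "nc_subst \<sigma> p =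
    (\<Sum>w\<in>Poly_Mapping.keys p. of_int (Poly_Mapping.lookup p w) * prod_list (map \<sigma> (letters w)))"

datatype ab_letter = letter_a | letter_b
datatype cd_letter = letter_c | letter_d

abbreviation poly_a :: "ab_letter ncpoly" where "poly_a \<equiv> nc_monom [letter_a]"
abbreviation poly_b :: "ab_letter ncpoly" where "poly_b \<equiv> nc_monom [letter_b]"

primrec cd_value :: "cd_letter \<Rightarrow> ab_letter ncpoly" where
  "cd_value letter_c = poly_a + poly_b"
| "cd_value letter_d = poly_a * poly_b + poly_b * poly_a"


section \<open>The cd-index of a finite poset\<close>

text \<open>
  A poset is a finite subset \<open>P\<close> of a type of class \<^class>\<open>order\<close>, with the induced order.
  The rank of \<open>x\<close> is the length of a longest chain of \<open>P\<close> ending in \<open>x\<close>, that is the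
  largest number of elements of a chain strictly below \<open>x\<close>.
\<close>

definition rank_in :: "'p::order set \<Rightarrow> 'p \<Rightarrow> nat"
  where "rank_in P x = Max {card C | C. pred_on.chain {y\<in>P. y < x} (<) C}"

definition poset_rank :: "'p::order set \<Rightarrow> nat"
  where "poset_rank P = Max (rank_in P ` P)"

definition flag_f :: "'p::order set \<Rightarrow> nat set \<Rightarrow> nat"
  where "flag_f P S = card {C. pred_on.maxchain {x\<in>P. rank_in P x \<in> S} (<) C}"

definition flag_h :: "'p::order set \<Rightarrow> nat set \<Rightarrow> int"
  where "flag_h P S = (\<Sum>T\<in>Pow S. (- 1) ^ card (S - T) * int (flag_f P T))"

text \<open>A poset of rank \<open>m + 1\<close> gives a polynomial that is homogeneous of degree \<open>m\<close>.\<close>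

definition u_word :: "nat \<Rightarrow> nat set \<Rightarrow> ab_letter list"
  where "u_word m S = map (\<lambda>i. if i \<in> S then letter_b else letter_a) [1..<Suc m]"

definition ab_index :: "'p::order set \<Rightarrow> ab_letter ncpoly"
  where "ab_index P = (let m = poset_rank P - 1 in
    \<Sum>S\<in>Pow {1..m}. of_int (flag_h P S) * nc_monom (u_word m S))"

text \<open>If \<open>P\<close> is Eulerian, exactly one such \<open>\<Phi>\<close> exists; for other posets the value is not meaningful.\<close>

definition cd_index :: "'p::order set \<Rightarrow> cd_letter ncpoly"
  where "cd_index P = (THE \<Phi>. nc_subst cd_value \<Phi> = ab_index P)"

definition poset_iso :: "'p::order set \<Rightarrow> 'q::order set \<Rightarrow> bool"
  where "poset_iso P Q \<longleftrightarrow>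
    (\<exists>f. bij_betw f P Q \<and> (\<forall>x\<in>P. \<forall>y\<in>P. x \<le> y \<longleftrightarrow> f x \<le> f y))"


section \<open>Abstract simplicial complexes\<close>

text \<open>
  A face is its set of vertices, so a face of dimension \<open>n\<close> has \<open>n + 1\<close> elements, and the
  simplex \<open>F\<close> as a complex is \<open>Pow F\<close>.  The empty face always belongs to a complex.
\<close>

definition asc :: "'v set set \<Rightarrow> bool"
  where "asc K \<longleftrightarrow> finite K \<and> K \<noteq> {} \<and> (\<forall>F\<in>K. finite F) \<and> (\<forall>F\<in>K. \<forall>G. G \<subseteq> F \<longrightarrow> G \<in> K)"

definition facets :: "'v set set \<Rightarrow> 'v set set"
  where "facets K = {F\<in>K. \<forall>G\<in>K. F \<subseteq> G \<longrightarrow> G = F}"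

definition pure_asc :: "nat \<Rightarrow> 'v set set \<Rightarrow> bool"
  where "pure_asc n K \<longleftrightarrow> asc K \<and> (\<forall>F\<in>facets K. card F = Suc n)"

text \<open>The face poset (empty face included) with a maximum adjoined.\<close>

definition face_poset :: "'v set set \<Rightarrow> 'v set top set"
  where "face_poset K = insert top.Top (top.Value ` K)"

text \<open>Points of the geometric realization are given by their barycentric coordinates.\<close>

definition realization :: "'v set set \<Rightarrow> ('v \<Rightarrow> real) topology"
  where "realization K = subtopology (powertop_real UNIV)
    {x. (\<forall>v. 0 \<le> x v) \<and> {v. x v \<noteq> 0} \<in> K \<and> (\<Sum>v | x v \<noteq> 0. x v) = 1}"

definition nball :: "nat \<Rightarrow> (nat \<Rightarrow> real) topology"
  where "nball n = subtopology (Euclidean_space n) {x. (\<Sum>i<n. x i ^ 2) \<le> 1}"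

definition simplicial_sphere :: "nat \<Rightarrow> 'v set set \<Rightarrow> bool"
  where "simplicial_sphere n K \<longleftrightarrow> asc K \<and> realization K homeomorphic_space nsphere n"

definition simplicial_ball :: "nat \<Rightarrow> 'v set set \<Rightarrow> bool"
  where "simplicial_ball n K \<longleftrightarrow> asc K \<and> realization K homeomorphic_space nball n"

text \<open>
  The boundary complex of an \<open>n\<close>-ball consists of the faces of those \<open>(n - 1)\<close>-faces that lie in
  exactly one facet.
\<close>

definition ball_boundary :: "nat \<Rightarrow> 'v set set \<Rightarrow> 'v set set"
  where "ball_boundary n K =
    {G. \<exists>R\<in>K. card R = n \<and> G \<subseteq> R \<and> card {F\<in>facets K. R \<subseteq> F} = 1}"

definition simplex_boundary :: "'v set \<Rightarrow> 'v set set"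
  where "simplex_boundary F = Pow F - {F}"

text \<open>
  \<open>shelling n K Fs\<close>: the list \<open>Fs\<close> is a shelling of the pure \<open>n\<close>-dimensional complex \<open>K\<close>.
  Every ordering of the facets of a \<open>0\<close>-dimensional complex is a shelling.  List indices start at \<open>0\<close>.
\<close>

primrec shelling :: "nat \<Rightarrow> 'v set set \<Rightarrow> 'v set list \<Rightarrow> bool" where
  "shelling 0 K Fs \<longleftrightarrow> pure_asc 0 K \<and> distinct Fs \<and> set Fs = facets K"
| "shelling (Suc n) K Fs \<longleftrightarrow>
    pure_asc (Suc n) K \<and> distinct Fs \<and> set Fs = facets K \<and>
    (\<exists>Gs. shelling n (simplex_boundary (Fs ! 0)) Gs) \<and>
    (\<forall>j. 0 < j \<and> j < length Fs \<longrightarrow>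
      (\<exists>Gs r. shelling n (simplex_boundary (Fs ! j)) Gs \<and> 1 \<le> r \<and> r \<le> length Gs \<and>
        Pow (Fs ! j) \<inter> (\<Union>i<j. Pow (Fs ! i)) = (\<Union>i<r. Pow (Gs ! i))))"

definition shellable :: "nat \<Rightarrow> 'v set set \<Rightarrow> bool"
  where "shellable n K \<longleftrightarrow> (\<exists>Fs. shelling n K Fs)"

text \<open>
  \<open>K\<close> is a \<open>(d - 1)\<close>-sphere, with \<open>d \<ge> 1\<close>.  The ball may have vertices that \<open>K\<close> does not have;
  its vertices are labelled by natural numbers, which is no restriction for a finite complex.
\<close>

definition shellably_triangulizable :: "nat \<Rightarrow> nat \<Rightarrow> 'v set set \<Rightarrow> bool"
  where "shellably_triangulizable k d K \<longleftrightarrow>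
    simplicial_sphere (d - 1) K \<and>
    (\<exists>B :: nat set set. simplicial_ball d B \<and> shellable d B \<and>
      card {F\<in>B. card F = Suc d} = k \<and> poset_iso (ball_boundary d B) K)"


section \<open>Stacked polytopes\<close>

definition simplicial_polytope :: "nat \<Rightarrow> 'e::euclidean_space set \<Rightarrow> bool"
  where "simplicial_polytope d P \<longleftrightarrow>
    polytope P \<and> aff_dim P = int d \<and> (\<forall>F. F facet_of P \<longrightarrow> (\<exists>n. n simplex F))"

text \<open>
  A triangulation of a polytope is a geometric simplicial complex with union \<open>P\<close> whose boundary
  complex (the simplices lying in the relative boundary of \<open>P\<close>) is combinatorially isomorphic to
  the boundary complex of \<open>P\<close>.
\<close>

definition polytope_triangulation :: "'e::euclidean_space set \<Rightarrow> 'e set set \<Rightarrow> bool"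
  where "polytope_triangulation P \<T> \<longleftrightarrow>
    simplicial_complex \<T> \<and> \<Union>\<T> = P \<and>
    poset_iso {T\<in>\<T>. T \<subseteq> rel_frontier P} {F. F face_of P \<and> F \<noteq> P}"

definition stack_subdivision :: "'e::euclidean_space set \<Rightarrow> 'e set set \<Rightarrow> bool"
  where "stack_subdivision P \<T> \<longleftrightarrow>
    polytope_triangulation P \<T> \<and> (\<forall>T\<in>\<T>. aff_dim T \<le> aff_dim P - 2 \<longrightarrow> T face_of P)"

text \<open>A stacked \<open>d\<close>-polytope with a stack subdivision that has exactly \<open>k\<close> simplices of dimension \<open>d\<close>.\<close>

definition stacked_polytope :: "nat \<Rightarrow> nat \<Rightarrow> 'e::euclidean_space set \<Rightarrow> bool"
  where "stacked_polytope k d P \<longleftrightarrow>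
    simplicial_polytope d P \<and>
    (\<exists>\<T>. stack_subdivision P \<T> \<and> card {T\<in>\<T>. aff_dim T = int d} = k)"

definition face_lattice :: "'e::euclidean_space set \<Rightarrow> 'e set set"
  where "face_lattice P = {F. F face_of P}"

end

theory Submission
  imports Defs "HOL-Homology.Invariance_of_Domain"
begin

text \<open>
  Sorting chains by their largest face shows that the ab-index of a pure \<open>(d - 1)\<close>-dimensional
  simplicial complex is linear in its face numbers.  When a shelling of a ball adds a simplex along
  \<open>r\<close> of its facets, the boundary undergoes a bistellar flip, and its ab-index changes by a polynomial
  \<open>D\<^sub>r\<close> that depends on \<open>d\<close> and \<open>r\<close> only.  Up to sign, \<open>D\<^sub>r\<close> is a sum of Stanley's shelling components
  with indices \<open>l\<close> in the interval from \<open>r\<close> to \<open>d - r\<close> (or, if \<open>2 r > d\<close>, from \<open>d + 1 - r\<close> to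
  \<open>r - 1\<close> with a minus sign).  The components are nonnegative polynomials in \<open>c\<close> and \<open>d\<close>, because
  they arise from \<open>1\<close> by right multiplication with \<open>c\<close> and by the derivation \<open>a \<mapsto> ba\<close>, \<open>b \<mapsto> ab\<close> of
  Ehrenborg and Readdy.  Hence \<open>D\<^sub>r \<le> D\<^sub>1\<close> for \<open>r \<ge> 1\<close>.  The sphere has the index \<open>D\<^sub>0\<close> plus \<open>k - 1\<close>
  terms \<open>D\<^sub>r\<close> with \<open>r \<ge> 1\<close>, whereas the stacked polytope has exactly \<open>D\<^sub>0 + (k - 1) D\<^sub>1\<close>.
\<close>

subsection \<open>Linear maps on noncommutative polynomials\<close>

text \<open>Two obstacles shape the proof. On the ball side the boundary is not followed flip by
  flip. A face G enters the complex with the facet for which R j \<subseteq> G \<subseteq> F j, and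
  it leaves the boundary with the facet for which F j - R j \<subseteq> G \<subseteq> F j; the
  difference of the two counts is D_r. That the second facet exists exactly for interior faces, and
  is then unique, is a statement about links. It is proved with chains over Z/2 from the fact that a
  ridge lies in at most two facets, and this fact is where the topology of the ball enters. On the
  polytope side no shelling is given, so the face numbers come from cutting the stack subdivision
  along an interior ridge. A component describes the semisuspension of a partially shelled simplex
  boundary, that is, the partial ball with one more cell capping its whole boundary: it is the
  change of the ab-index when the next facet is added. The derivation is what the pyramid operation
  on ab-indices leaves after right multiplication by c is subtracted, so it passes from one
  dimension to the next.\<close>

lemma frag_cmul_eq_of_int_mult:
  fixes p :: "'x ncpoly"
  shows "frag_cmul n p = of_int n * p"
proof -
  have nat: "frag_cmul (int m) q = of_int (int m) * q" for m and q :: "'x ncpoly"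
    by (induction m) (simp_all add: frag_cmul_distrib algebra_simps)
  show ?thesis
  proof (cases "0 \<le> n")
    case True
    then show ?thesis
      using nat[of "nat n"] by simp
  next
    case False
    then have "frag_cmul (- n) p = of_int (- n) * p"
      using nat[of "nat (- n)"] by simp
    then show ?thesis
      by (metis add.inverse_inverse minus_frag_cmul mult_minus_left of_int_minus)
  qed
qed

lemma nc_monom_append: "nc_monom (v @ w) = nc_monom v * nc_monom w"
  by (simp add: nc_monom_def mult_single plus_fword_def)

lemma nc_monom_Cons: "nc_monom (x # w) = nc_monom [x] * nc_monom w"
  using nc_monom_append[of "[x]" w] by simp

lemma nc_monom_Nil [simp]: "nc_monom [] = 1"
  by (metis nc_monom_def single_one zero_fword_def)

lemma lookup_of_int_mult [simp]:
  fixes p :: "'x ncpoly"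
  shows "Poly_Mapping.lookup (of_int n * p) w = n * Poly_Mapping.lookup p w"
  by (simp flip: frag_cmul_eq_of_int_mult)

lemma ncpoly_induct [case_names zero monom diff]:
  fixes p :: "'x ncpoly"
  assumes "P 0" "\<And>w. P (nc_monom w)" "\<And>p q. P p \<Longrightarrow> P q \<Longrightarrow> P (p - q)"
  shows "P p"
proof (rule frag_induction[of p UNIV])
  fix x :: "'x fword"
  show "P (frag_of x)"
    using assms(2)[of "letters x"] by (simp add: nc_monom_def)
qed (use assms in auto)

text \<open>The type is also the free abelian group on words, so additivity and induction can be
  taken over from \<open>frag_extend\<close> and \<open>frag_induction\<close>.\<close>

lemma nc_subst_eq_frag_extend:
  "nc_subst \<sigma> = frag_extend (\<lambda>w. prod_list (map \<sigma> (letters w)))"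
  by (rule ext) (simp add: nc_subst_def frag_extend_def frag_cmul_eq_of_int_mult)

lemma nc_subst_zero [simp]: "nc_subst \<sigma> 0 = 0"
  and nc_subst_add: "nc_subst \<sigma> (p + q) = nc_subst \<sigma> p + nc_subst \<sigma> q"
  and nc_subst_diff: "nc_subst \<sigma> (p - q) = nc_subst \<sigma> p - nc_subst \<sigma> q"
  and nc_subst_monom: "nc_subst \<sigma> (nc_monom w) = prod_list (map \<sigma> w)"
  by (simp_all add: nc_subst_eq_frag_extend frag_extend_add frag_extend_diff nc_monom_def)

lemma nc_subst_one [simp]: "nc_subst \<sigma> 1 = 1"
  using nc_subst_monom[of \<sigma> "[]"] by simp

lemma nc_subst_of_int [simp]: "nc_subst \<sigma> (of_int n) = of_int n"
proof -
  have "nc_subst \<sigma> (frag_cmul n 1) = frag_cmul n (nc_subst \<sigma> 1)"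
    by (simp only: nc_subst_eq_frag_extend frag_extend_cmul)
  then show ?thesis
    by (simp add: frag_cmul_eq_of_int_mult)
qed

lemma nc_subst_letter_mult: "nc_subst \<sigma> (nc_monom [x] * p) = \<sigma> x * nc_subst \<sigma> p"
proof (induction p rule: ncpoly_induct)
  case (monom w)
  then show ?case
    by (simp add: nc_subst_monom flip: nc_monom_Cons)
qed (simp_all add: nc_subst_diff algebra_simps)


subsection \<open>The cd-subexpression is unique\<close>

lemma lookup_letter_mult:
  "Poly_Mapping.lookup (nc_monom [x] * p) (Word w) =
     (case w of [] \<Rightarrow> 0 | y # v \<Rightarrow> if x = y then Poly_Mapping.lookup p (Word v) else 0)"
proof (induction p rule: ncpoly_induct)
  case (monom v)
  show ?case
    unfolding nc_monom_Cons[symmetric]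
    by (auto simp: nc_monom_def lookup_single when_def split: list.splits)
qed (simp_all add: lookup_minus algebra_simps split: list.splits)

definition left_quotient :: "'x \<Rightarrow> 'x ncpoly \<Rightarrow> 'x ncpoly"
  where "left_quotient x p = Poly_Mapping.map_key (\<lambda>w. Word (x # letters w)) p"

lemma lookup_left_quotient:
  "Poly_Mapping.lookup (left_quotient x p) w = Poly_Mapping.lookup p (Word (x # letters w))"
proof -
  have "inj (\<lambda>w. Word (x # letters w))"
    by (auto intro!: injI fword.expand)
  then show ?thesis
    by (simp add: left_quotient_def map_key.rep_eq)
qed

lemma cd_poly_split:
  "p = of_int (Poly_Mapping.lookup p (Word [])) + nc_monom [letter_c] * left_quotient letter_c p
     + nc_monom [letter_d] * left_quotient letter_d p" (is "p = ?q")
proof (rule poly_mapping_eqI)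
  fix w :: "cd_letter fword"
  obtain l where w: "w = Word l"
    by (cases w)
  show "Poly_Mapping.lookup p w = Poly_Mapping.lookup ?q w"
  proof (cases l)
    case Nil
    then show ?thesis
      by (simp add: w lookup_add lookup_letter_mult lookup_of_int zero_fword_def when_def)
  next
    case (Cons x v)
    then show ?thesis
      by (cases x)
        (simp_all add: w lookup_add lookup_letter_mult lookup_of_int zero_fword_def when_def
          lookup_left_quotient)
  qed
qed

text \<open>Peel off the first letter: p0 + c p1 + d p2 becomes p0 + a (P1 + b P2) + b (P1 + a P2),
  so P1 + b P2 = 0 = P1 + a P2. Comparing words that begin with b gives P2 = 0, hence P1 = 0. The
  induction is on a bound for the word lengths.\<close>

lemma nc_subst_cd_value_eq_0:
  assumes "nc_subst cd_value p = 0"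
  shows "p = 0"
proof -
  have "\<forall>p. (\<forall>w\<in>Poly_Mapping.keys p. length (letters w) < n) \<longrightarrow> nc_subst cd_value p = 0 \<longrightarrow> p = 0" for n
  proof (induction n)
    case (Suc n)
    show ?case
    proof (intro allI impI)
      fix p :: "cd_letter ncpoly"
      assume len: "\<forall>w\<in>Poly_Mapping.keys p. length (letters w) < Suc n" and 0: "nc_subst cd_value p = 0"
      define P1 P2 where "P1 = nc_subst cd_value (left_quotient letter_c p)"
        and "P2 = nc_subst cd_value (left_quotient letter_d p)"
      have "nc_subst cd_value p = of_int (Poly_Mapping.lookup p (Word [])) + cd_value letter_c * P1
         + cd_value letter_d * P2"
        by (subst cd_poly_split) (simp only: nc_subst_add nc_subst_letter_mult nc_subst_of_int P1_def P2_def)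
      then have eq: "of_int (Poly_Mapping.lookup p (Word [])) + (poly_a * P1 + poly_b * P1)
         + (poly_a * (poly_b * P2) + poly_b * (poly_a * P2)) = 0"
        using 0 by (simp add: algebra_simps)
      note coeff = arg_cong[OF eq, where f = "\<lambda>p. Poly_Mapping.lookup p (Word w)" for w]
      have p0: "Poly_Mapping.lookup p (Word []) = 0"
        using coeff[of "[]"] by (simp add: lookup_add lookup_letter_mult lookup_of_int zero_fword_def)
      have a: "Poly_Mapping.lookup P1 (Word w) + Poly_Mapping.lookup (poly_b * P2) (Word w) = 0" for w
        using coeff[of "letter_a # w"]
        by (simp add: lookup_add lookup_letter_mult lookup_of_int zero_fword_def when_def)
      have b: "Poly_Mapping.lookup P1 (Word w) + Poly_Mapping.lookup (poly_a * P2) (Word w) = 0" for w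
        using coeff[of "letter_b # w"]
        by (simp add: lookup_add lookup_letter_mult lookup_of_int zero_fword_def when_def)
      have "Poly_Mapping.lookup P2 (Word w) = 0" for w
        using a[of "letter_b # w"] b[of "letter_b # w"] by (simp add: lookup_letter_mult)
      then have P2: "P2 = 0"
        by (metis fword.exhaust lookup_zero poly_mapping_eqI)
      have "Poly_Mapping.lookup P1 (Word w) = 0" for w
        using a[of w] P2 by simp
      then have P1: "P1 = 0"
        by (metis fword.exhaust lookup_zero poly_mapping_eqI)
      have "\<forall>w\<in>Poly_Mapping.keys (left_quotient x p). length (letters w) < n" for x
        using len by (force simp: in_keys_iff lookup_left_quotient)
      then have "left_quotient letter_c p = 0" "left_quotient letter_d p = 0"
        using Suc.IH P1 P2 by (auto simp: P1_def P2_def)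
      then show "p = 0"
        using cd_poly_split[of p] p0 by simp
    qed
  qed (simp add: all_not_in_conv[symmetric] del: all_not_in_conv; metis all_not_in_conv keys_eq_empty)
  moreover have "\<forall>w\<in>Poly_Mapping.keys p. length (letters w) < Suc (\<Sum>w\<in>Poly_Mapping.keys p. length (letters w))"
    by (auto intro!: le_imp_less_Suc member_le_sum)
  ultimately show ?thesis
    using assms by blast
qed

lemma nc_subst_cd_value_inj:
  "nc_subst cd_value p = nc_subst cd_value q \<longleftrightarrow> p = q"
  using nc_subst_cd_value_eq_0[of "p - q"] by (auto simp: nc_subst_diff)


subsection \<open>The derivation of Ehrenborg and Readdy\<close>

primrec deriv_letter :: "ab_letter \<Rightarrow> ab_letter ncpoly" where
  "deriv_letter letter_a = poly_b * poly_a"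
| "deriv_letter letter_b = poly_a * poly_b"

primrec deriv_word :: "ab_letter list \<Rightarrow> ab_letter ncpoly" where
  "deriv_word [] = 0"
| "deriv_word (x # w) = deriv_letter x * nc_monom w + nc_monom [x] * deriv_word w"

definition nc_deriv :: "ab_letter ncpoly \<Rightarrow> ab_letter ncpoly"
  where "nc_deriv = frag_extend (\<lambda>w. deriv_word (letters w))"

lemma nc_deriv_zero [simp]: "nc_deriv 0 = 0"
  and nc_deriv_add: "nc_deriv (p + q) = nc_deriv p + nc_deriv q"
  and nc_deriv_diff: "nc_deriv (p - q) = nc_deriv p - nc_deriv q"
  and nc_deriv_monom: "nc_deriv (nc_monom w) = deriv_word w"
  by (simp_all add: nc_deriv_def frag_extend_add frag_extend_diff nc_monom_def)

lemma nc_deriv_sum: "nc_deriv (\<Sum>i\<in>I. f i) = (\<Sum>i\<in>I. nc_deriv (f i))"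
  by (induction I rule: infinite_finite_induct) (simp_all add: nc_deriv_add)

lemma nc_deriv_one [simp]: "nc_deriv 1 = 0"
  using nc_deriv_monom[of "[]"] by simp

lemma deriv_word_append:
  "deriv_word (v @ w) = deriv_word v * nc_monom w + nc_monom v * deriv_word w"
proof (induction v)
  case (Cons x v)
  then show ?case
    by (simp add: nc_monom_append nc_monom_Cons[of x v] algebra_simps)
qed simp

lemma nc_deriv_mult: "nc_deriv (p * q) = nc_deriv p * q + p * nc_deriv q"
proof (induction p rule: ncpoly_induct)
  case (monom v)
  show ?case
  proof (induction q rule: ncpoly_induct)
    case (monom w)
    then show ?case
      by (simp add: nc_deriv_monom deriv_word_append flip: nc_monom_append)
  qed (simp_all add: nc_deriv_diff algebra_simps)
qed (simp_all add: nc_deriv_diff algebra_simps)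

lemma nc_deriv_of_nat_mult: "nc_deriv (of_nat n * p) = of_nat n * nc_deriv p"
  by (induction n) (simp_all add: nc_deriv_add algebra_simps)

lemma nc_deriv_letter [simp]: "nc_deriv (nc_monom [x]) = deriv_letter x"
  by (simp add: nc_deriv_monom)

abbreviation poly_e :: "ab_letter ncpoly" where "poly_e \<equiv> poly_a - poly_b"
abbreviation poly_c :: "ab_letter ncpoly" where "poly_c \<equiv> poly_a + poly_b"
abbreviation poly_d :: "ab_letter ncpoly" where "poly_d \<equiv> poly_a * poly_b + poly_b * poly_a"

lemma nc_deriv_c: "nc_deriv poly_c = poly_d"
  and nc_deriv_d: "nc_deriv poly_d = poly_c * poly_d"
  by (simp_all add: nc_deriv_add nc_deriv_mult algebra_simps)

text \<open>On powers of a - b the derivation is the commutator with b, because ba - ab = b (a - b)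
  - (a - b) b. These powers are the tails of \<open>face_term\<close>.\<close>

lemma nc_deriv_e_power: "nc_deriv (poly_e ^ m) = poly_b * poly_e ^ m - poly_e ^ m * poly_b"
proof (induction m)
  case (Suc m)
  have "nc_deriv poly_e = poly_b * poly_e - poly_e * poly_b"
    by (simp add: nc_deriv_diff algebra_simps)
  then show ?case
    by (simp only: power_Suc nc_deriv_mult Suc.IH) (simp add: algebra_simps)
qed simp

section \<open>The cone of nonnegative cd-polynomials inside the ab-polynomials\<close>

inductive_set cd_nonneg :: "ab_letter ncpoly set" where
  zero: "0 \<in> cd_nonneg"
| one: "1 \<in> cd_nonneg"
| add: "p \<in> cd_nonneg \<Longrightarrow> q \<in> cd_nonneg \<Longrightarrow> p + q \<in> cd_nonneg"
| c_mult: "p \<in> cd_nonneg \<Longrightarrow> poly_c * p \<in> cd_nonneg"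
| d_mult: "p \<in> cd_nonneg \<Longrightarrow> poly_d * p \<in> cd_nonneg"

text \<open>The cone is generated from the left, to match \<open>nc_subst_letter_mult\<close>,
  whereas \<open>boolean_ab\<close> and the first component are built with a factor c on the
  right.\<close>

lemma cd_nonneg_mult_c: "p \<in> cd_nonneg \<Longrightarrow> p * poly_c \<in> cd_nonneg"
proof (induction rule: cd_nonneg.induct)
  case one
  then show ?case
    using cd_nonneg.c_mult[OF cd_nonneg.one] by simp
next
  case (add p q)
  then show ?case
    using cd_nonneg.add by (simp only: distrib_right)
next
  case (c_mult p)
  then show ?case
    using cd_nonneg.c_mult by (simp only: mult.assoc)
next
  case (d_mult p)
  then show ?case
    using cd_nonneg.d_mult by (simp only: mult.assoc)
qed (simp add: cd_nonneg.zero)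

lemma cd_nonneg_deriv: "p \<in> cd_nonneg \<Longrightarrow> nc_deriv p \<in> cd_nonneg"
proof (induction rule: cd_nonneg.induct)
  case (add p q)
  then show ?case
    by (simp only: nc_deriv_add cd_nonneg.add)
next
  case (c_mult p)
  then show ?case
    by (simp only: nc_deriv_mult nc_deriv_c cd_nonneg.intros)
next
  case (d_mult p)
  then show ?case
    by (simp only: nc_deriv_mult nc_deriv_d mult.assoc cd_nonneg.intros)
qed (simp_all add: cd_nonneg.zero)

lemma cd_nonneg_imp_cd_poly:
  assumes "p \<in> cd_nonneg"
  shows "\<exists>q. nc_subst cd_value q = p \<and> (\<forall>w. 0 \<le> Poly_Mapping.lookup q w)"
  using assms
proof (induction rule: cd_nonneg.induct)
  case zero
  then show ?case
    by (intro exI[of _ 0]) simp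
next
  case one
  then show ?case
    by (intro exI[of _ 1]) (simp add: lookup_one when_def)
next
  case (add p q)
  then show ?case
    by (metis add_nonneg_nonneg lookup_add nc_subst_add)
next
  case (c_mult p)
  then obtain q where q: "nc_subst cd_value q = p" "\<And>w. 0 \<le> Poly_Mapping.lookup q w"
    by blast
  have "0 \<le> Poly_Mapping.lookup (nc_monom [letter_c] * q) w" for w
    by (cases w) (auto simp: lookup_letter_mult q split: list.splits)
  then show ?case
    by (intro exI[of _ "nc_monom [letter_c] * q"]) (auto simp: nc_subst_letter_mult q)
next
  case (d_mult p)
  then obtain q where q: "nc_subst cd_value q = p" "\<And>w. 0 \<le> Poly_Mapping.lookup q w"
    by blast
  have "0 \<le> Poly_Mapping.lookup (nc_monom [letter_d] * q) w" for w
    by (cases w) (auto simp: lookup_letter_mult q split: list.splits)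
  then show ?case
    by (intro exI[of _ "nc_monom [letter_d] * q"]) (auto simp: nc_subst_letter_mult q)
qed


subsection \<open>Shelling components\<close>

text \<open>
  \<open>boolean_ab n\<close> is the ab-index of the Boolean algebra of rank \<open>n\<close> (for \<open>n \<ge> 1\<close>), and
  \<open>face_term d i\<close> is the contribution of one face with \<open>i\<close> vertices, taken as the largest element of
  a chain, to the ab-index of a \<open>(d - 1)\<close>-dimensional simplicial complex.
\<close>

function boolean_ab :: "nat \<Rightarrow> ab_letter ncpoly" where
  "boolean_ab 0 = 1"
| "boolean_ab (Suc n) =
     poly_e ^ n + (\<Sum>i\<in>{1..n}. of_nat (Suc n choose i) * (boolean_ab i * poly_b * poly_e ^ (n - i)))"
  by pat_completeness auto
termination
  by (relation "Wellfounded.measure id") auto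

definition face_term :: "nat \<Rightarrow> nat \<Rightarrow> ab_letter ncpoly"
  where "face_term d i = (if i = 0 then poly_e ^ d else boolean_ab i * poly_b * poly_e ^ (d - i))"

text \<open>Number of i-subsets of an n-set that contain a fixed r-subset. The case split is
  essential: for i < r truncated subtraction would give 1.\<close>

definition above_count :: "nat \<Rightarrow> nat \<Rightarrow> nat \<Rightarrow> nat"
  where "above_count n r i = (if r \<le> i then (n - r) choose (i - r) else 0)"

text \<open>Contribution of the proper faces of a d-simplex that contain a fixed face with r
  vertices. The sum stops at d, so the simplex itself is left out.\<close>

definition upper_ab :: "nat \<Rightarrow> nat \<Rightarrow> ab_letter ncpoly"
  where "upper_ab d r = (\<Sum>i\<le>d. of_nat (above_count (Suc d) r i) * face_term d i)"

text \<open>Here the simplex has only d vertices and its top face is included: these are the faces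
  added by a facet whose restriction face has r vertices.\<close>

definition interval_ab :: "nat \<Rightarrow> nat \<Rightarrow> ab_letter ncpoly"
  where "interval_ab d r = (\<Sum>i\<le>d. of_nat (above_count d r i) * face_term d i)"

text \<open>The change of the ab-index of the boundary when a \<open>d\<close>-simplex is glued along \<open>r\<close> of its facets.\<close>

definition gluing_ab :: "nat \<Rightarrow> nat \<Rightarrow> ab_letter ncpoly"
  where "gluing_ab d r = upper_ab d r - upper_ab d (Suc d - r)"

text \<open>Change of the ab-index of the semisuspension when a facet with restriction size r is
  added in a shelling of the boundary of a d-simplex. The first summand stands for the new faces,
  the second for the new boundary of the capping cell, whose chains end in b.\<close>

definition component_ab :: "nat \<Rightarrow> nat \<Rightarrow> ab_letter ncpoly"
  where "component_ab d r = interval_ab d r + gluing_ab (d - 1) r * poly_b"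

lemma boolean_ab_1: "boolean_ab (Suc 0) = 1"
  by simp

lemma boolean_ab_Suc: "boolean_ab (Suc n) = (\<Sum>i\<le>n. of_nat (Suc n choose i) * face_term n i)"
proof -
  have "{..n} = insert 0 {1..n}"
    by auto
  then show ?thesis
    by (simp add: face_term_def)
qed

declare boolean_ab.simps(2) [simp del]

lemma face_term_Suc: "i \<le> d \<Longrightarrow> face_term (Suc d) i = face_term d i * poly_e"
  by (simp add: face_term_def Suc_diff_le power_Suc2 mult.assoc del: power_Suc)

lemma face_term_self: "0 < d \<Longrightarrow> face_term d d = boolean_ab d * poly_b"
  by (simp add: face_term_def)

lemma above_count_Suc:
  assumes "r \<le> n" "i \<le> n"
  shows "above_count (Suc n) r i = above_count (Suc n) (Suc r) i + above_count n r i"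
proof (cases "r < i")
  case True
  then obtain j where "i = Suc (r + j)"
    using less_imp_Suc_add by blast
  then show ?thesis
    using assms by (simp add: above_count_def Suc_diff_le)
qed (use assms in \<open>auto simp: above_count_def\<close>)

lemma above_count_Suc_Suc: "above_count (Suc n) (Suc r) (Suc i) = above_count n r i"
  by (simp add: above_count_def)

text \<open>Pascal's rule: a face over the fixed r-set either contains one more chosen vertex or
  lies in the facet opposite to that vertex.\<close>

lemma upper_ab_Suc: "r \<le> d \<Longrightarrow> upper_ab d r = upper_ab d (Suc r) + interval_ab d r"
  by (simp add: upper_ab_def interval_ab_def above_count_Suc algebra_simps flip: sum.distrib)

lemma upper_ab_top: "upper_ab d (Suc d) = 0"
  by (simp add: upper_ab_def above_count_def)

lemma upper_ab_0: "upper_ab d 0 = boolean_ab (Suc d)"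
  by (simp add: upper_ab_def above_count_def boolean_ab_Suc)

text \<open>Splits by the largest face of a chain: a proper face gains a factor a - b from the new
  rank, and the top face gives the last summand.\<close>

lemma interval_ab_Suc:
  assumes "r \<le> Suc d"
  shows "interval_ab (Suc d) r = upper_ab d r * poly_e + boolean_ab (Suc d) * poly_b"
  using assms
  by (simp add: upper_ab_def interval_ab_def sum_distrib_right face_term_Suc face_term_self mult.assoc
      above_count_def[of _ _ "Suc d"])

text \<open>The rules for \<open>face_term\<close> and \<open>boolean_ab\<close> depend on each
  other, so the rule for smaller Boolean algebras appears as a hypothesis, to be discharged by
  strong induction.\<close>

lemma nc_deriv_face_term_step:
  assumes "\<And>j. j < i \<Longrightarrow> nc_deriv (boolean_ab (Suc j)) = boolean_ab (Suc (Suc j)) - boolean_ab (Suc j) * poly_c"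
    and "i \<le> d"
  shows "nc_deriv (face_term d i) = face_term (Suc d) (Suc i) - face_term d i * poly_b"
proof (cases i)
  case 0
  then show ?thesis
    by (simp add: face_term_def nc_deriv_e_power boolean_ab_1)
next
  case (Suc j)
  have "nc_deriv (face_term d i) =
    (boolean_ab (Suc (Suc j)) - boolean_ab (Suc j) * poly_c) * poly_b * poly_e ^ (d - i)
    + boolean_ab (Suc j) * (poly_a * poly_b) * poly_e ^ (d - i)
    + boolean_ab (Suc j) * poly_b * (poly_b * poly_e ^ (d - i) - poly_e ^ (d - i) * poly_b)"
    using assms(1)[of j] Suc by (simp add: face_term_def nc_deriv_mult nc_deriv_e_power distrib_right)
  \<comment> \<open>With B = \<open>boolean_ab (Suc j)\<close>, the terms - B c b, B a b and B b b
    in front of the common tail cancel.\<close>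
  also have "\<dots> = face_term (Suc d) (Suc i) - face_term d i * poly_b"
    using Suc by (simp add: face_term_def algebra_simps)
  finally show ?thesis .
qed

text \<open>Up to the correction by b on the right, the derivation adjoins one common vertex to the
  ambient set, to the fixed face and to every counted face.\<close>

lemma nc_deriv_sum_face_term:
  assumes "\<And>i. i \<le> d \<Longrightarrow> nc_deriv (face_term d i) = face_term (Suc d) (Suc i) - face_term d i * poly_b"
  shows "nc_deriv (\<Sum>i\<le>d. of_nat (above_count n r i) * face_term d i) =
    (\<Sum>i\<le>Suc d. of_nat (above_count (Suc n) (Suc r) i) * face_term (Suc d) i)
    - (\<Sum>i\<le>d. of_nat (above_count n r i) * face_term d i) * poly_b"
proof -
  have "nc_deriv (\<Sum>i\<le>d. of_nat (above_count n r i) * face_term d i) =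
    (\<Sum>i\<le>d. of_nat (above_count n r i) * face_term (Suc d) (Suc i))
    - (\<Sum>i\<le>d. of_nat (above_count n r i) * face_term d i) * poly_b"
    using assms by (simp add: nc_deriv_sum nc_deriv_of_nat_mult sum_distrib_right right_diff_distrib
        sum_subtractf mult.assoc)
  also have "(\<Sum>i\<le>d. of_nat (above_count n r i) * face_term (Suc d) (Suc i)) =
    (\<Sum>i\<le>Suc d. of_nat (above_count (Suc n) (Suc r) i) * face_term (Suc d) i)"
    by (subst sum.atMost_Suc_shift) (simp add: above_count_Suc_Suc above_count_def[of _ _ 0])
  finally show ?thesis .
qed

text \<open>This is the pyramid formula for ab-indices: the Boolean algebra of rank n + 2 is the
  pyramid over the one of rank n + 1.\<close>

lemma nc_deriv_boolean_ab:
  "nc_deriv (boolean_ab (Suc n)) = boolean_ab (Suc (Suc n)) - boolean_ab (Suc n) * poly_c"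
proof (induction n rule: less_induct)
  case (less n)
  have "nc_deriv (upper_ab n 0) = upper_ab (Suc n) (Suc 0) - upper_ab n 0 * poly_b"
    unfolding upper_ab_def
    by (rule nc_deriv_sum_face_term, rule nc_deriv_face_term_step, rule less.IH) auto
  \<comment> \<open>With B = \<open>boolean_ab (Suc n)\<close> the interval term is B (a - b) + B b
    = B a; together with the - B b from above it makes - B c.\<close>
  moreover have "upper_ab (Suc n) 0 = upper_ab (Suc n) (Suc 0) + interval_ab (Suc n) 0"
    by (rule upper_ab_Suc) simp
  ultimately show ?case
    by (simp add: upper_ab_0 interval_ab_Suc algebra_simps)
qed

lemma nc_deriv_face_term:
  "i \<le> d \<Longrightarrow> nc_deriv (face_term d i) = face_term (Suc d) (Suc i) - face_term d i * poly_b"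
  by (rule nc_deriv_face_term_step, rule nc_deriv_boolean_ab)

lemma nc_deriv_upper_ab: "nc_deriv (upper_ab d r) = upper_ab (Suc d) (Suc r) - upper_ab d r * poly_b"
  unfolding upper_ab_def by (rule nc_deriv_sum_face_term, rule nc_deriv_face_term)

lemma nc_deriv_interval_ab:
  "nc_deriv (interval_ab d r) = interval_ab (Suc d) (Suc r) - interval_ab d r * poly_b"
  unfolding interval_ab_def by (rule nc_deriv_sum_face_term, rule nc_deriv_face_term)

lemma boolean_ab_cd_nonneg: "boolean_ab (Suc n) \<in> cd_nonneg"
proof (induction n)
  case 0
  then show ?case
    by (simp add: boolean_ab_1 cd_nonneg.one)
next
  case (Suc n)
  have "boolean_ab (Suc (Suc n)) = nc_deriv (boolean_ab (Suc n)) + boolean_ab (Suc n) * poly_c"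
    by (simp add: nc_deriv_boolean_ab)
  then show ?case
    using Suc cd_nonneg.add cd_nonneg_deriv cd_nonneg_mult_c by metis
qed

text \<open>The first facet and its cap are two cells with the same boundary, which is what the
  factor c records.\<close>

lemma component_ab_0: "component_ab (Suc d) 0 = boolean_ab (Suc d) * poly_c"
  by (simp add: component_ab_def gluing_ab_def interval_ab_Suc upper_ab_0 upper_ab_top algebra_simps)

text \<open>What the derivation leaves over is a right multiple of b, and it is exactly one Pascal
  step at the opposite index \<open>?s\<close>.\<close>

lemma component_ab_Suc:
  assumes "r \<le> Suc d"
  shows "component_ab (Suc (Suc d)) (Suc r) = nc_deriv (component_ab (Suc d) r)"
proof -
  let ?s = "Suc d - r"
  have s: "Suc (Suc d) - r = Suc ?s"
    using assms by (simp add: Suc_diff_le)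
  \<comment> \<open>The top faces of the two intervals contribute equally, so only the difference of
    the \<open>upper_ab\<close> terms, with its factor a - b, survives.\<close>
  have *: "interval_ab (Suc d) r = interval_ab (Suc d) ?s + gluing_ab d r * poly_e"
    using assms by (simp add: interval_ab_Suc gluing_ab_def algebra_simps)
  have "nc_deriv (component_ab (Suc d) r) =
     interval_ab (Suc (Suc d)) (Suc r) - interval_ab (Suc d) r * poly_b
     + (upper_ab (Suc d) (Suc r) - upper_ab (Suc d) (Suc ?s) - gluing_ab d r * poly_b) * poly_b
     + gluing_ab d r * (poly_a * poly_b)"
    by (simp add: component_ab_def nc_deriv_add nc_deriv_mult nc_deriv_interval_ab gluing_ab_def
        nc_deriv_diff nc_deriv_upper_ab algebra_simps)
  also have "\<dots> = interval_ab (Suc (Suc d)) (Suc r)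
     + (upper_ab (Suc d) (Suc r) - upper_ab (Suc d) (Suc ?s)
        - interval_ab (Suc d) r + gluing_ab d r * poly_e) * poly_b"
    by (simp add: algebra_simps)
  also have "\<dots> = interval_ab (Suc (Suc d)) (Suc r)
     + (upper_ab (Suc d) (Suc r) - (upper_ab (Suc d) (Suc ?s) + interval_ab (Suc d) ?s)) * poly_b"
    by (simp add: * diff_diff_add)
  also have "\<dots> = component_ab (Suc (Suc d)) (Suc r)"
    using upper_ab_Suc[of ?s "Suc d"] by (simp add: component_ab_def gluing_ab_def)
  finally show ?thesis ..
qed

text \<open>The recursion lowers both indices until r = 0, or until only the last vertex in the
  shelling of the boundary of an edge is left, whose component is 0.\<close>

lemma component_ab_cd_nonneg: "r \<le> Suc d \<Longrightarrow> component_ab (Suc d) r \<in> cd_nonneg"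
proof (induction r arbitrary: d)
  case 0
  then show ?case
    by (simp add: component_ab_0 cd_nonneg_mult_c boolean_ab_cd_nonneg)
next
  case (Suc r)
  show ?case
  proof (cases d)
    case 0
    then have "component_ab (Suc d) (Suc r) = 0"
      using Suc.prems
      by (simp add: component_ab_def interval_ab_Suc gluing_ab_def upper_ab_0 upper_ab_top[of 0, simplified])
    then show ?thesis
      by (simp add: cd_nonneg.zero)
  next
    case (Suc d')
    then show ?thesis
      using Suc.IH Suc.prems by (simp add: component_ab_Suc cd_nonneg_deriv)
  qed
qed

section \<open>Gluing terms as sums of components\<close>

lemma gluing_ab_antisym: "r \<le> Suc d \<Longrightarrow> gluing_ab d (Suc d - r) = - gluing_ab d r"
  by (simp add: gluing_ab_def)

text \<open>
  The boundary terms of the components cancel in pairs, because \<open>gluing_ab\<close> is antisymmetric under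
  \<open>l \<mapsto> d - l\<close>.
\<close>

lemma gluing_ab_eq_sum_component:
  assumes "2 * r \<le> Suc d"
  shows "gluing_ab (Suc d) r = (\<Sum>l\<in>{r..Suc d - r}. component_ab (Suc d) l)"
proof -
  have tele: "upper_ab (Suc d) r - upper_ab (Suc d) (Suc s) = (\<Sum>l\<in>{r..s}. interval_ab (Suc d) l)"
    if "r \<le> s" "s \<le> Suc d" for s
    using that
  proof (induction s rule: dec_induct)
    case base
    then show ?case
      using upper_ab_Suc[of r "Suc d"] by simp
  next
    case (step s)
    then show ?case
      using upper_ab_Suc[of "Suc s" "Suc d"] by (simp add: algebra_simps)
  qed
  have "(\<Sum>l\<in>{r..Suc d - r}. gluing_ab d l) = 0"
  proof -
    have "(\<Sum>l\<in>{r..Suc d - r}. gluing_ab d l) =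
      (\<Sum>l\<in>{r..Suc d - r}. upper_ab d l) - (\<Sum>l\<in>{r..Suc d - r}. upper_ab d (Suc d - l))"
      by (simp add: gluing_ab_def sum_subtractf)
    also have "(\<Sum>l\<in>{r..Suc d - r}. upper_ab d (Suc d - l)) = (\<Sum>l\<in>{r..Suc d - r}. upper_ab d l)"
      by (rule sum.reindex_bij_witness[of _ "\<lambda>l. Suc d - l" "\<lambda>l. Suc d - l"]) (use assms in auto)
    finally show ?thesis
      by simp
  qed
  then have "(\<Sum>l\<in>{r..Suc d - r}. component_ab (Suc d) l) = (\<Sum>l\<in>{r..Suc d - r}. interval_ab (Suc d) l)"
    by (simp add: component_ab_def sum.distrib flip: sum_distrib_right)
  moreover have "Suc (Suc d) - r = Suc (Suc d - r)"
    using assms by linarith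
  ultimately show ?thesis
    using tele[of "Suc d - r"] assms by (simp add: gluing_ab_def)
qed

lemma cd_nonneg_sum: "(\<And>i. i \<in> I \<Longrightarrow> f i \<in> cd_nonneg) \<Longrightarrow> (\<Sum>i\<in>I. f i) \<in> cd_nonneg"
  by (induction I rule: infinite_finite_induct) (auto intro: cd_nonneg.intros)

lemma gluing_ab_cd_nonneg:
  assumes "2 * r \<le> Suc (Suc d)"
  shows "gluing_ab (Suc d) r \<in> cd_nonneg"
proof (cases "2 * r \<le> Suc d")
  case True
  then show ?thesis
    by (auto simp: gluing_ab_eq_sum_component intro!: cd_nonneg_sum component_ab_cd_nonneg)
next
  case False
  \<comment> \<open>The middle case 2 r = d + 2: the flip gains and loses equally many faces of each
    size.\<close>
  then have "Suc (Suc d) - r = r"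
    using assms by linarith
  then show ?thesis
    by (simp add: gluing_ab_def cd_nonneg.zero)
qed

text \<open>For small r the index interval of D_r lies inside that of D_1. For large r, - D_r is the
  gluing term of the opposite, small index, so the difference is a sum of two nonnegative
  terms.\<close>

lemma gluing_ab_le:
  assumes "1 \<le> r" "r \<le> Suc (Suc d)"
  shows "gluing_ab (Suc d) 1 - gluing_ab (Suc d) r \<in> cd_nonneg"
proof (cases "2 * r \<le> Suc d")
  case True
  have "(\<Sum>l\<in>{1..Suc d - 1}. component_ab (Suc d) l) =
    (\<Sum>l\<in>{1..Suc d - 1} - {r..Suc d - r}. component_ab (Suc d) l) + (\<Sum>l\<in>{r..Suc d - r}. component_ab (Suc d) l)"
    using assms by (intro sum.subset_diff) auto
  then have "gluing_ab (Suc d) 1 - gluing_ab (Suc d) r =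
     (\<Sum>l\<in>{1..Suc d - 1} - {r..Suc d - r}. component_ab (Suc d) l)"
    using True assms by (simp only: gluing_ab_eq_sum_component) (simp add: gluing_ab_eq_sum_component)
  then show ?thesis
    by (auto intro!: cd_nonneg_sum component_ab_cd_nonneg)
next
  case False
  have "gluing_ab (Suc d) 1 - gluing_ab (Suc d) r = gluing_ab (Suc d) 1 + gluing_ab (Suc d) (Suc (Suc d) - r)"
    using assms by (simp add: gluing_ab_antisym)
  also have "\<dots> \<in> cd_nonneg"
    using False by (intro cd_nonneg.add gluing_ab_cd_nonneg) auto
  finally show ?thesis .
qed


subsection \<open>Rank functions, chains and isomorphisms\<close>

lemma chain_less_iff:
  fixes A :: "'p::order set"
  shows "pred_on.chain A (<) C \<longleftrightarrow> C \<subseteq> A \<and> (\<forall>x\<in>C. \<forall>y\<in>C. x \<le> y \<or> y \<le> x)"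
  by (auto simp: pred_on.chain_def order.order_iff_strict)

text \<open>Monotonicity makes \<rho> injective on any chain below x, which bounds its length;
  descending by the step property builds a chain that attains the bound.\<close>

lemma rank_in_eqI:
  fixes P :: "'p::order set"
  assumes "finite P"
    and mono: "\<And>x y. x \<in> P \<Longrightarrow> y \<in> P \<Longrightarrow> x < y \<Longrightarrow> \<rho> x < \<rho> y"
    and step: "\<And>x. x \<in> P \<Longrightarrow> 0 < \<rho> x \<Longrightarrow> \<exists>y\<in>P. y < x \<and> Suc (\<rho> y) = \<rho> x"
    and "x \<in> P"
  shows "rank_in P x = \<rho> x"
proof -
  have upper: "card C \<le> \<rho> x" if "pred_on.chain {y\<in>P. y < x} (<) C" for C
  proof -
    have "inj_on \<rho> C"
    proof (rule inj_onI, rule ccontr)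
      fix y z
      assume yz: "y \<in> C" "z \<in> C" "\<rho> y = \<rho> z" "y \<noteq> z"
      then have "y < z \<or> z < y" "y \<in> P" "z \<in> P"
        using that by (auto simp: chain_less_iff order.order_iff_strict)
      then show False
        using mono yz(3) by fastforce
    qed
    moreover have "\<rho> ` C \<subseteq> {..<\<rho> x}"
      using that mono \<open>x \<in> P\<close> by (auto simp: chain_less_iff)
    ultimately show ?thesis
      by (metis card_image card_lessThan card_mono finite_lessThan)
  qed
  have "\<exists>C. pred_on.chain {y\<in>P. y < x} (<) C \<and> card C = \<rho> x"
    using \<open>x \<in> P\<close>
  proof (induction "\<rho> x" arbitrary: x)
    case 0
    then show ?case
      by (intro exI[of _ "{}"]) (simp add: chain_less_iff)
  next
    case (Suc n)
    then obtain y where y: "y \<in> P" "y < x" "Suc (\<rho> y) = \<rho> x"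
      using step[of x] by auto
    then obtain C where C: "pred_on.chain {z\<in>P. z < y} (<) C" "card C = \<rho> y"
      using Suc by (metis nat.inject)
    have "finite C"
      using C \<open>finite P\<close> by (auto simp: chain_less_iff intro: finite_subset)
    moreover have "y \<notin> C"
      using C by (auto simp: chain_less_iff)
    moreover have "pred_on.chain {z\<in>P. z < x} (<) (insert y C)"
    proof -
      have "z \<in> P \<and> z < y \<and> z < x" if "z \<in> C" for z
        using C(1) y(2) that less_trans[of z y x] unfolding chain_less_iff by blast
      then show ?thesis
        using C(1) y(1,2) unfolding chain_less_iff by (blast intro: less_imp_le)
    qed
    ultimately show ?case
      using y C by (intro exI[of _ "insert y C"]) simp
  qed
  then obtain C where C: "\<rho> x = card C" "pred_on.chain {y\<in>P. y < x} (<) C"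
    by metis
  have "finite {card C | C. pred_on.chain {y\<in>P. y < x} (<) C}"
  proof (rule finite_subset)
    show "{card C | C. pred_on.chain {y\<in>P. y < x} (<) C} \<subseteq> {..\<rho> x}"
      using upper by (simp add: subset_iff) metis
  qed simp
  then show ?thesis
    unfolding rank_in_def
  proof (rule Max_eqI)
    show "\<rho> x \<in> {card C | C. pred_on.chain {y\<in>P. y < x} (<) C}"
      using C by blast
  qed (use upper in blast)
qed

section \<open>Invariance of the ab-index under isomorphism\<close>

definition order_iso :: "('p::order \<Rightarrow> 'q::order) \<Rightarrow> 'p set \<Rightarrow> 'q set \<Rightarrow> bool"
  where "order_iso f P Q \<longleftrightarrow> bij_betw f P Q \<and> (\<forall>x\<in>P. \<forall>y\<in>P. x \<le> y \<longleftrightarrow> f x \<le> f y)"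

lemma order_iso_inv_into:
  assumes "order_iso f P Q"
  shows "order_iso (inv_into P f) Q P"
  unfolding order_iso_def
proof (intro conjI ballI)
  show "bij_betw (inv_into P f) Q P"
    using assms by (simp add: order_iso_def bij_betw_inv_into)
next
  fix x y
  assume "x \<in> Q" "y \<in> Q"
  then show "x \<le> y \<longleftrightarrow> inv_into P f x \<le> inv_into P f y"
    using assms unfolding order_iso_def
    by (metis bij_betw_imp_surj_on f_inv_into_f inv_into_into)
qed

lemma order_iso_restrict:
  assumes "order_iso f P Q" "A \<subseteq> P"
  shows "order_iso f A (f ` A)"
  using assms by (auto simp: order_iso_def intro: bij_betw_subset)

lemma order_iso_chain:
  assumes "order_iso f P Q" "pred_on.chain P (<) C"
  shows "pred_on.chain Q (<) (f ` C)" "card (f ` C) = card C"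
proof -
  have sub: "C \<subseteq> P"
    using assms(2) by (simp add: chain_less_iff)
  have bij: "bij_betw f P Q" and le: "\<And>x y. x \<in> P \<Longrightarrow> y \<in> P \<Longrightarrow> x \<le> y \<longleftrightarrow> f x \<le> f y"
    using assms(1) by (auto simp: order_iso_def)
  show "card (f ` C) = card C"
    using bij sub by (meson bij_betw_def card_image inj_on_subset)
  have "f x \<le> f y \<or> f y \<le> f x" if "x \<in> C" "y \<in> C" for x y
    using assms(2) le[of x y] le[of y x] sub that by (auto simp: chain_less_iff)
  moreover have "f ` C \<subseteq> Q"
    using bij sub by (auto simp: bij_betw_def)
  ultimately show "pred_on.chain Q (<) (f ` C)"
    by (simp add: chain_less_iff)
qed

lemma order_iso_less:
  assumes "order_iso f P Q" "x \<in> P" "y \<in> P"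
  shows "x < y \<longleftrightarrow> f x < f y"
  using assms by (auto simp: order_iso_def less_le_not_le)

lemma order_iso_less_than:
  assumes "order_iso f P Q" "x \<in> P"
  shows "order_iso f {y\<in>P. y < x} {y\<in>Q. y < f x}"
proof -
  have "f ` {y\<in>P. y < x} = {y\<in>Q. y < f x}"
    using assms order_iso_less[OF assms(1) _ assms(2)]
    by (fastforce simp: order_iso_def bij_betw_def)
  then show ?thesis
    using order_iso_restrict[OF assms(1), of "{y\<in>P. y < x}"] by simp
qed

lemma order_iso_rank_in:
  assumes "order_iso f P Q" "x \<in> P"
  shows "rank_in Q (f x) = rank_in P x"
proof -
  have "{card C | C. pred_on.chain {y\<in>P. y < x} (<) C} \<subseteq> {card C | C. pred_on.chain {y\<in>Q. y < f x} (<) C}"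
    if "order_iso f P Q" "x \<in> P" for f :: "'c::order \<Rightarrow> 'd::order" and P Q x
  proof clarify
    fix C
    assume "pred_on.chain {y\<in>P. y < x} (<) C"
    then show "\<exists>D. card C = card D \<and> pred_on.chain {y\<in>Q. y < f x} (<) D"
      using order_iso_chain[OF order_iso_less_than[OF that]] by metis
  qed
  note sub = this
  have "f x \<in> Q" "inv_into P f (f x) = x"
    using assms by (auto simp: order_iso_def bij_betw_inv_into_left dest: bij_betwE)
  then have "{card C | C. pred_on.chain {y\<in>P. y < x} (<) C} = {card C | C. pred_on.chain {y\<in>Q. y < f x} (<) C}"
    using sub[OF assms] sub[OF order_iso_inv_into[OF assms(1)], of "f x"] by (simp only: subset_antisym)
  then show ?thesis
    by (simp only: rank_in_def)
qed

lemma order_iso_maxchains: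
  assumes "order_iso f A B"
  shows "card {C. pred_on.maxchain A (<) C} = card {C. pred_on.maxchain B (<) C}"
proof -
  have sub: "(`) f ` {C. pred_on.maxchain A (<) C} \<subseteq> {C. pred_on.maxchain B (<) C}"
    if f: "order_iso f A B" for f :: "'c::order \<Rightarrow> 'd::order" and A B
  proof clarify
    fix C
    assume C: "pred_on.maxchain A (<) C"
    let ?g = "inv_into A f"
    note g = order_iso_inv_into[OF f]
    have bij: "bij_betw f A B" and CA: "C \<subseteq> A"
      using f C by (auto simp: order_iso_def pred_on.maxchain_def chain_less_iff)
    show "pred_on.maxchain B (<) (f ` C)"
      unfolding pred_on.maxchain_def
    proof (intro conjI notI)
      show "pred_on.chain B (<) (f ` C)"
        using order_iso_chain[OF f] C by (simp add: pred_on.maxchain_def)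
      assume "\<exists>S. pred_on.chain B (<) S \<and> f ` C \<subset> S"
      then obtain S where S: "pred_on.chain B (<) S" "f ` C \<subset> S"
        by blast
      have "S \<subseteq> B"
        using S by (simp add: chain_less_iff)
      then have "f ` ?g ` S = S"
        using bij by (simp add: bij_betw_def image_inv_into_cancel)
      moreover have "?g ` f ` C = C"
        using bij CA by (simp add: bij_betw_def)
      ultimately have "C \<subset> ?g ` S"
        using S(2) by (metis image_mono psubset_eq)
      then show False
        using C order_iso_chain(1)[OF g S(1)] by (auto simp: pred_on.maxchain_def)
    qed
  qed
  have bij: "bij_betw f A B"
    using assms by (simp add: order_iso_def)
  have "bij_betw ((`) f) {C. pred_on.maxchain A (<) C} {C. pred_on.maxchain B (<) C}"
  proof (rule bij_betw_byWitness[of _ "(`) (inv_into A f)"])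
    show "\<forall>C\<in>{C. pred_on.maxchain A (<) C}. inv_into A f ` f ` C = C"
      using bij by (auto simp: pred_on.maxchain_def chain_less_iff bij_betw_def inv_into_image_cancel)
    show "\<forall>C\<in>{C. pred_on.maxchain B (<) C}. f ` inv_into A f ` C = C"
      using bij by (auto simp: pred_on.maxchain_def chain_less_iff bij_betw_def image_inv_into_cancel)
  qed (use sub[OF assms] sub[OF order_iso_inv_into[OF assms]] in auto)
  then show ?thesis
    by (rule bij_betw_same_card)
qed

lemma order_iso_ab_index:
  assumes "order_iso f P Q"
  shows "ab_index P = ab_index Q"
proof -
  have bij: "bij_betw f P Q"
    using assms by (simp add: order_iso_def)
  have "rank_in Q ` Q = rank_in P ` P"
    using bij_betw_imp_surj_on[OF bij, symmetric] order_iso_rank_in[OF assms] by (simp add: image_image)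
  then have rank: "poset_rank P = poset_rank Q"
    by (simp add: poset_rank_def)
  have "f ` {x\<in>P. rank_in P x \<in> S} = {x\<in>Q. rank_in Q x \<in> S}" for S
    using bij_betw_imp_surj_on[OF bij, symmetric] order_iso_rank_in[OF assms] by auto
  then have "order_iso f {x\<in>P. rank_in P x \<in> S} {x\<in>Q. rank_in Q x \<in> S}" for S
    using order_iso_restrict[OF assms, of "{x\<in>P. rank_in P x \<in> S}"] by simp
  then have "flag_f P S = flag_f Q S" for S
    unfolding flag_f_def by (rule order_iso_maxchains)
  then show ?thesis
    by (simp add: ab_index_def flag_h_def rank)
qed


subsection \<open>The ab-index of a pure simplicial complex\<close>

text \<open>This is the sum of g T times the word with b at the positions in T and a - b elsewhere,
  organised by its last position, that is, by the largest rank.\<close>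

primrec flag_poly :: "nat \<Rightarrow> (nat set \<Rightarrow> int) \<Rightarrow> ab_letter ncpoly" where
  "flag_poly 0 g = of_int (g {})"
| "flag_poly (Suc d) g = flag_poly d g * poly_e + flag_poly d (\<lambda>T. g (insert (Suc d) T)) * poly_b"

lemma flag_poly_cong: "(\<And>T. T \<subseteq> {1..d} \<Longrightarrow> g T = h T) \<Longrightarrow> flag_poly d g = flag_poly d h"
proof (induction d arbitrary: g h)
  case (Suc d)
  have "flag_poly d g = flag_poly d h"
    by (rule Suc.IH, rule Suc.prems, erule subset_trans) simp
  moreover have "flag_poly d (\<lambda>T. g (insert (Suc d) T)) = flag_poly d (\<lambda>T. h (insert (Suc d) T))"
    by (rule Suc.IH, rule Suc.prems, simp, erule subset_trans) simp
  ultimately show ?case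
    by simp
qed simp

lemma flag_poly_sum: "flag_poly d (\<lambda>T. \<Sum>i\<in>I. g i T) = (\<Sum>i\<in>I. flag_poly d (g i))"
  by (induction d arbitrary: g) (simp_all add: sum_distrib_right sum.distrib)

lemma sum_Pow_insert:
  assumes "finite A" "x \<notin> A"
  shows "(\<Sum>S\<in>Pow (insert x A). F S) = (\<Sum>S\<in>Pow A. F S) + (\<Sum>S\<in>Pow A. F (insert x S))"
proof -
  have "inj_on (insert x) (Pow A)"
    using assms(2) by (auto simp: inj_on_def)
  then show ?thesis
    using assms by (simp add: Pow_insert sum.union_disjoint sum.reindex Int_commute disjoint_iff image_iff)
      (subst sum.union_disjoint; auto simp: sum.reindex)
qed

lemma u_word_Suc:
  "u_word (Suc d) S = u_word d S @ [if Suc d \<in> S then letter_b else letter_a]"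
  by (simp add: u_word_def)

lemma u_word_insert: "u_word d (insert (Suc d) S) = u_word d S"
  by (simp add: u_word_def)

text \<open>Splitting by the last letter, the alternating sum for S with the new rank is the one for
  the shifted g minus the one for S. So S yields \<beta> a + (\<beta>' - \<beta>) b = \<beta> (a -
  b) + \<beta>' b, the recursion of \<open>flag_poly\<close>.\<close>

lemma sum_u_word_eq_flag_poly:
  "(\<Sum>S\<in>Pow {1..d}. of_int (\<Sum>T\<in>Pow S. (- 1) ^ card (S - T) * g T) * nc_monom (u_word d S)) =
    flag_poly d g"
proof (induction d arbitrary: g)
  case 0
  then show ?case
    by (simp add: u_word_def)
next
  case (Suc d)
  have ins: "{1..Suc d} = insert (Suc d) {1..d}"
    by auto
  let ?\<beta> = "\<lambda>g S. \<Sum>T\<in>Pow S. (- 1) ^ card (S - T) * g T :: int"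
  have \<beta>: "?\<beta> g (insert (Suc d) S) = ?\<beta> (\<lambda>T. g (insert (Suc d) T)) S - ?\<beta> g S" if "S \<subseteq> {1..d}" for S
  proof -
    have S: "finite S" "Suc d \<notin> S"
      using that finite_subset by auto
    have 1: "insert (Suc d) S - T = insert (Suc d) (S - T)" "finite (S - T)" "Suc d \<notin> S - T" if "T \<in> Pow S" for T
      using that S by auto
    have 2: "insert (Suc d) S - insert (Suc d) T = S - T" if "T \<in> Pow S" for T
      using that S by auto
    show ?thesis
      using S by (simp add: sum_Pow_insert 1 2 sum_negf)
  qed
  have "(\<Sum>S\<in>Pow {1..Suc d}. of_int (?\<beta> g S) * nc_monom (u_word (Suc d) S)) =
      (\<Sum>S\<in>Pow {1..d}. of_int (?\<beta> g S) * nc_monom (u_word (Suc d) S))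
      + (\<Sum>S\<in>Pow {1..d}. of_int (?\<beta> g (insert (Suc d) S)) * nc_monom (u_word (Suc d) (insert (Suc d) S)))"
    unfolding ins by (rule sum_Pow_insert) auto
  also have "(\<Sum>S\<in>Pow {1..d}. of_int (?\<beta> g S) * nc_monom (u_word (Suc d) S)) =
      (\<Sum>S\<in>Pow {1..d}. of_int (?\<beta> g S) * nc_monom (u_word d S)) * poly_a"
    unfolding sum_distrib_right
    by (rule sum.cong) (auto simp: u_word_Suc nc_monom_append mult.assoc)
  also have "(\<Sum>S\<in>Pow {1..d}. of_int (?\<beta> g (insert (Suc d) S)) * nc_monom (u_word (Suc d) (insert (Suc d) S))) =
      (\<Sum>S\<in>Pow {1..d}. of_int (?\<beta> (\<lambda>T. g (insert (Suc d) T)) S - ?\<beta> g S) * nc_monom (u_word d S)) * poly_b"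
    unfolding sum_distrib_right
    by (rule sum.cong) (auto simp: \<beta> u_word_Suc u_word_insert nc_monom_append mult.assoc simp del: of_int_diff)
  finally show ?case
    unfolding of_int_diff left_diff_distrib sum_subtractf Suc.IH by (simp add: algebra_simps)
qed

text \<open>Chains with exactly one face of each size in S. This replaces maximality by a condition
  that can be split at the largest face.\<close>

definition ranked_chains :: "'v set set \<Rightarrow> nat set \<Rightarrow> 'v set set set"
  where "ranked_chains K S =
    {C. C \<subseteq> K \<and> (\<forall>x\<in>C. \<forall>y\<in>C. x \<subseteq> y \<or> y \<subseteq> x) \<and> inj_on card C \<and> card ` C = S}"

lemma finite_ranked_chains: "finite K \<Longrightarrow> finite (ranked_chains K S)"
  by (rule finite_subset[of _ "Pow K"]) (auto simp: ranked_chains_def)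

text \<open>All other members are smaller than the one of size d + 1, hence contained in it, so this
  member splits off as the top of the chain.\<close>

lemma ranked_chains_insert:
  assumes "asc K" and T: "T \<subseteq> {1..d}"
  shows "ranked_chains K (insert (Suc d) T) =
    (\<Union>G\<in>{G\<in>K. card G = Suc d}. insert G ` ranked_chains (Pow G) T)"
proof (intro equalityI subsetI)
  fix C
  assume "C \<in> ranked_chains K (insert (Suc d) T)"
  then have C: "C \<subseteq> K" "\<And>x y. x \<in> C \<Longrightarrow> y \<in> C \<Longrightarrow> x \<subseteq> y \<or> y \<subseteq> x" "inj_on card C"
    "card ` C = insert (Suc d) T"
    by (auto simp: ranked_chains_def)
  then obtain G where G: "G \<in> C" "card G = Suc d"
    by (metis imageE insertI1)
  have fin: "finite x" if "x \<in> C" for x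
    using C(1) that \<open>asc K\<close> by (auto simp: asc_def)
  have dT: "Suc d \<notin> T"
    using T by auto
  have img: "card ` (C - {G}) = T"
    using C(3,4) G dT by (simp add: inj_on_image_set_diff[of card C])
  have "x \<subseteq> G" if "x \<in> C - {G}" for x
  proof -
    have "card x < card G"
      using img that G(2) T by fastforce
    then show ?thesis
      using C(2)[of x G] that G(1) card_mono[OF fin[of x], of G] by fastforce
  qed
  then have "C - {G} \<in> ranked_chains (Pow G) T"
    using C(2) C(3) img by (auto simp: ranked_chains_def inj_on_diff)
  moreover have "C = insert G (C - {G})"
    using G by auto
  ultimately show "C \<in> (\<Union>G\<in>{G\<in>K. card G = Suc d}. insert G ` ranked_chains (Pow G) T)"
    using G C(1) by blast
next
  fix C
  assume "C \<in> (\<Union>G\<in>{G\<in>K. card G = Suc d}. insert G ` ranked_chains (Pow G) T)"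
  then obtain G C' where *: "G \<in> K" "card G = Suc d" "C = insert G C'" "C' \<subseteq> Pow G"
    "\<forall>x\<in>C'. \<forall>y\<in>C'. x \<subseteq> y \<or> y \<subseteq> x" "inj_on card C'" "card ` C' = T"
    by (auto simp: ranked_chains_def)
  have "Suc d \<notin> T"
    using T by auto
  then have "card G \<notin> card ` (C' - {G})"
    unfolding *(2) *(7)[symmetric] by blast
  then have "inj_on card C"
    using * by simp
  moreover have "C' \<subseteq> K"
    using * \<open>asc K\<close> by (auto simp: asc_def)
  ultimately show "C \<in> ranked_chains K (insert (Suc d) T)"
    using * by (auto simp: ranked_chains_def)
qed

lemma card_ranked_chains_insert:
  assumes "asc K" and T: "T \<subseteq> {1..d}"
  shows "card (ranked_chains K (insert (Suc d) T)) =
    (\<Sum>G\<in>{G\<in>K. card G = Suc d}. card (ranked_chains (Pow G) T))"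
proof -
  have notin: "G \<notin> C" if "card G = Suc d" "C \<in> ranked_chains L T" for G :: "'a set" and C L
  proof
    assume "G \<in> C"
    then have "Suc d \<in> T"
      using that by (force simp: ranked_chains_def)
    then show False
      using T by auto
  qed
  have fin: "finite K" "\<And>G. G \<in> K \<Longrightarrow> finite G"
    using \<open>asc K\<close> by (auto simp: asc_def)
  have "card (insert G ` ranked_chains (Pow G) T) = card (ranked_chains (Pow G) T)"
    if "card G = Suc d" for G :: "'a set"
  proof (rule card_image, rule inj_onI)
    fix C D
    assume "C \<in> ranked_chains (Pow G) T" "D \<in> ranked_chains (Pow G) T" "insert G C = insert G D"
    then show "C = D"
      using notin[OF that] insert_ident by metis
  qed
  moreover have "insert G ` ranked_chains (Pow G) T \<inter> insert H ` ranked_chains (Pow H) T = {}"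
    if "card G = Suc d" "card H = Suc d" "G \<noteq> H" for G H :: "'a set"
  proof (rule ccontr)
    assume "\<not> ?thesis"
    then obtain C D where "insert G C = insert H D" "C \<in> ranked_chains (Pow G) T" "D \<in> ranked_chains (Pow H) T"
      by blast
    then show False
      using notin[of H C "Pow G"] that by blast
  qed
  ultimately show ?thesis
    unfolding ranked_chains_insert[OF assms] using fin
    by (subst card_UN_disjoint) (auto intro!: finite_imageI finite_ranked_chains)
qed

lemma asc_Pow: "finite G \<Longrightarrow> asc (Pow G)"
  by (auto simp: asc_def intro: finite_subset)

text \<open>A chain that uses size d + 1 is a face G of that size with a chain below it, and below G
  every complex looks like the same Boolean algebra. Hence only the number of such G
  matters.\<close>

lemma flag_poly_ranked_chains:
  assumes "asc K"
  shows "flag_poly d (\<lambda>T. int (card (ranked_chains K T))) =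
    (\<Sum>i\<le>d. of_nat (card {G\<in>K. card G = i}) * face_term d i)"
  using assms
proof (induction d arbitrary: K)
  case 0
  have "ranked_chains K {} = {{}}"
    by (auto simp: ranked_chains_def)
  moreover have "{G\<in>K. card G = 0} = {{}}"
    using 0 by (auto simp: asc_def)
  ultimately show ?case
    by (simp add: face_term_def)
next
  case (Suc d)
  have fin: "finite G" if "G \<in> K" for G
    using Suc.prems that by (auto simp: asc_def)
  have "flag_poly d (\<lambda>T. int (card (ranked_chains K (insert (Suc d) T)))) =
      flag_poly d (\<lambda>T. \<Sum>G\<in>{G\<in>K. card G = Suc d}. int (card (ranked_chains (Pow G) T)))"
    by (rule flag_poly_cong) (simp add: card_ranked_chains_insert[OF Suc.prems])
  also have "\<dots> = (\<Sum>G\<in>{G\<in>K. card G = Suc d}. boolean_ab (Suc d))"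
    unfolding flag_poly_sum
  proof (rule sum.cong)
    fix G
    assume G: "G \<in> {G\<in>K. card G = Suc d}"
    then have "card {H \<in> Pow G. card H = i} = Suc d choose i" for i
      using n_subsets[of G i] fin by simp
    then show "flag_poly d (\<lambda>T. int (card (ranked_chains (Pow G) T))) = boolean_ab (Suc d)"
      using G fin by (simp add: Suc.IH asc_Pow boolean_ab_Suc)
  qed simp
  finally have 1: "flag_poly d (\<lambda>T. int (card (ranked_chains K (insert (Suc d) T)))) * poly_b =
      of_nat (card {G\<in>K. card G = Suc d}) * face_term (Suc d) (Suc d)"
    by (simp add: face_term_self mult.assoc)
  have 2: "flag_poly d (\<lambda>T. int (card (ranked_chains K T))) * poly_e =
      (\<Sum>i\<le>d. of_nat (card {G\<in>K. card G = i}) * face_term (Suc d) i)"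
    by (simp add: Suc.IH[OF Suc.prems] sum_distrib_right face_term_Suc mult.assoc)
  show ?case
    unfolding flag_poly.simps 1 2 by simp
qed

lemma pure_asc_subset_facet:
  assumes "pure_asc n K" "G \<in> K"
  obtains F where "F \<in> K" "card F = Suc n" "G \<subseteq> F"
proof -
  have asc: "asc K" "finite K"
    using assms by (auto simp: pure_asc_def asc_def)
  have "\<exists>F\<in>{F\<in>K. G \<subseteq> F}. \<forall>H\<in>{F\<in>K. G \<subseteq> F}. F \<le> H \<longrightarrow> F = H"
    using finite_has_maximal[of "{F\<in>K. G \<subseteq> F}"] asc assms(2) by auto
  then obtain F where "F \<in> K" "G \<subseteq> F" "\<And>H. H \<in> K \<Longrightarrow> F \<subseteq> H \<Longrightarrow> H = F"
    by (smt (verit, del_insts) mem_Collect_eq order_trans)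
  moreover from this have "card F = Suc n"
    using assms(1) by (auto simp: pure_asc_def facets_def)
  ultimately show ?thesis
    using that by blast
qed

lemma pure_asc_card_le:
  assumes "pure_asc n K" "G \<in> K"
  shows "card G \<le> Suc n"
  using pure_asc_subset_facet[OF assms]
  by (metis assms(1) asc_def card_mono pure_asc_def)

lemma rank_in_face_poset:
  assumes "pure_asc n K"
  shows "G \<in> K \<Longrightarrow> rank_in (face_poset K) (top.Value G) = card G"
    and "rank_in (face_poset K) top.Top = Suc (Suc n)"
proof -
  have asc: "asc K"
    using assms by (simp add: pure_asc_def)
  define \<rho> where "\<rho> x = (case x of top.Top \<Rightarrow> Suc (Suc n) | top.Value G \<Rightarrow> card G)" for x :: "'a set top"
  have rank: "rank_in (face_poset K) x = \<rho> x" if "x \<in> face_poset K" for x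
  proof (rule rank_in_eqI[OF _ _ _ that])
    show "finite (face_poset K)"
      using asc by (simp add: face_poset_def asc_def)
  next
    fix x y
    assume "x \<in> face_poset K" "y \<in> face_poset K" "x < y"
    then show "\<rho> x < \<rho> y"
      using asc pure_asc_card_le[OF assms]
      by (auto simp: face_poset_def \<rho>_def asc_def intro!: psubset_card_mono split: top.splits)
        (metis le_imp_less_Suc)
  next
    fix x
    assume x: "x \<in> face_poset K" "0 < \<rho> x"
    show "\<exists>y\<in>face_poset K. y < x \<and> Suc (\<rho> y) = \<rho> x"
    proof (cases x)
      case (Value G)
      then have "G \<in> K" "finite G" "0 < card G"
        using x asc by (auto simp: face_poset_def \<rho>_def asc_def)
      then obtain v where v: "v \<in> G"
        by (metis all_not_in_conv card_gt_0_iff)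
      then have "G - {v} \<in> K" "Suc (card (G - {v})) = card G" "G - {v} < G"
        using \<open>G \<in> K\<close> \<open>finite G\<close> asc by (auto simp: asc_def simp del: card_Diff_insert intro: card_Suc_Diff1)
      then show ?thesis
        using Value by (intro bexI[of _ "top.Value (G - {v})"]) (auto simp: face_poset_def \<rho>_def)
    next
      case Top
      obtain G where "G \<in> K"
        using asc by (auto simp: asc_def)
      then obtain F where "F \<in> K" "card F = Suc n"
        using pure_asc_subset_facet[OF assms] by metis
      then show ?thesis
        using Top by (intro bexI[of _ "top.Value F"]) (auto simp: face_poset_def \<rho>_def)
    qed
  qed
  show "rank_in (face_poset K) (top.Value G) = card G" if "G \<in> K"
    using rank[of "top.Value G"] that by (simp add: face_poset_def \<rho>_def)
  show "rank_in (face_poset K) top.Top = Suc (Suc n)"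
    using rank[of top.Top] by (simp add: face_poset_def \<rho>_def)
qed

lemma poset_rank_face_poset:
  assumes "pure_asc n K"
  shows "poset_rank (face_poset K) = Suc (Suc n)"
  unfolding poset_rank_def
proof (rule Max_eqI)
  show "finite (rank_in (face_poset K) ` face_poset K)"
    using assms by (simp add: face_poset_def pure_asc_def asc_def)
  show "Suc (Suc n) \<in> rank_in (face_poset K) ` face_poset K"
    using rank_in_face_poset(2)[OF assms] by (force simp: face_poset_def)
next
  fix r
  assume "r \<in> rank_in (face_poset K) ` face_poset K"
  then show "r \<le> Suc (Suc n)"
    using rank_in_face_poset[OF assms] pure_asc_card_le[OF assms] by (force simp: face_poset_def)
qed

lemma subset_chain_between:
  assumes "finite H" "G \<subseteq> H" "card G \<le> s" "s \<le> card H"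
  obtains M where "G \<subseteq> M" "M \<subseteq> H" "card M = s"
proof -
  have "s - card G \<le> card (H - G)"
    using assms by (simp add: card_Diff_subset finite_subset)
  then obtain N where "N \<subseteq> H - G" "card N = s - card G" "finite N"
    using assms(1) by (metis finite_Diff obtain_subset_with_card_n)
  moreover from this have "card (G \<union> N) = s"
    using assms by (subst card_Un_disjoint) (auto intro: finite_subset)
  ultimately show ?thesis
    using that[of "G \<union> N"] assms(2) by auto
qed

text \<open>A chain that misses a size s in S can be refined: purity supplies a face of size s
  between its members below and above s, with a facet as upper bound if there is none above. So
  maximal chains meet every size in S.\<close>

lemma flag_f_face_poset:
  assumes pure: "pure_asc n K" and S: "S \<subseteq> {1..Suc n}"
  shows "flag_f (face_poset K) S = card (ranked_chains K S)"
proof -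
  have asc: "asc K" "finite K" and fin: "\<And>G. G \<in> K \<Longrightarrow> finite G"
    using pure by (auto simp: pure_asc_def asc_def)
  define KS where "KS = {G\<in>K. card G \<in> S}"
  have "{x\<in>face_poset K. rank_in (face_poset K) x \<in> S} = top.Value ` KS"
    using S rank_in_face_poset[OF pure] by (auto simp: KS_def face_poset_def)
  moreover have "order_iso top.Value KS (top.Value ` KS)"
    by (auto simp: order_iso_def bij_betw_def inj_on_def)
  ultimately have "flag_f (face_poset K) S = card {C. pred_on.maxchain KS (<) C}"
    unfolding flag_f_def using order_iso_maxchains by metis
  also have "{C. pred_on.maxchain KS (<) C} = ranked_chains K S"
  proof (intro equalityI subsetI)
    fix C
    assume "C \<in> {C. pred_on.maxchain KS (<) C}"
    then have "pred_on.chain KS (<) C" and max: "\<And>D. pred_on.chain KS (<) D \<Longrightarrow> \<not> C \<subset> D"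
      unfolding pred_on.maxchain_def by blast+
    then have C: "C \<subseteq> KS" "\<And>x y. x \<in> C \<Longrightarrow> y \<in> C \<Longrightarrow> x \<subseteq> y \<or> y \<subseteq> x"
      unfolding chain_less_iff by blast+
    have CK: "C \<subseteq> K" "finite C"
      using C(1) asc(2) by (auto simp: KS_def intro: finite_subset)
    have inj: "inj_on card C"
    proof (rule inj_onI)
      fix x y
      assume "x \<in> C" "y \<in> C" "card x = card y"
      then show "x = y"
        using C(2)[of x y] CK fin by (metis card_subset_eq subsetD)
    qed
    have "s \<in> card ` C" if s: "s \<in> S" for s
    proof (rule ccontr)
      assume "s \<notin> card ` C"
      \<comment> \<open>A finite chain contains its union, so G is the largest member below size s,
        or the empty face if there is none; the empty face is small enough because s is at least
        1.\<close>
      define G where "G = \<Union>{x\<in>C. card x < s}"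
      define H' where "H' = {x\<in>C. s < card x}"
      have mono: "x \<subseteq> y" if "x \<in> C" "y \<in> C" "card x < card y" for x y
        using C(2)[OF that(1,2)] that CK fin card_mono[of x y] by fastforce
      have G: "G \<in> K \<and> card G < s"
      proof (cases "{x\<in>C. card x < s} = {}")
        case True
        then have "G = {}"
          unfolding G_def by (simp only: Union_empty)
        then show ?thesis
          using S s asc(1) by (auto simp: asc_def)
      next
        case False
        then have "G \<in> {x\<in>C. card x < s}"
          unfolding G_def using CK C(2)
          by (intro Union_in_chain[of _ UNIV]) (auto simp: subset.chain_def)
        then show ?thesis
          using CK by auto
      qed
      obtain H where H: "H \<in> K" "s \<le> card H" "G \<subseteq> H" "\<And>x. x \<in> C \<Longrightarrow> s < card x \<Longrightarrow> H \<subseteq> x"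
      proof (cases "H' = {}")
        case True
        obtain F where "F \<in> K" "card F = Suc n" "G \<subseteq> F"
          using pure_asc_subset_facet[OF pure] G by blast
        then show ?thesis
          using that[of F] S s True by (auto simp: H'_def)
      next
        case False
        define H where "H = arg_min_on card H'"
        have "H \<in> H'" and least: "\<And>x. x \<in> H' \<Longrightarrow> card H \<le> card x"
          using False CK(2) arg_min_if_finite(1)[of H' card] arg_min_least[of H' _ card]
          by (auto simp: H_def H'_def)
        then have "H \<in> C" "s < card H"
          by (auto simp: H'_def)
        moreover have "G \<subseteq> H"
          unfolding G_def using mono[of _ H] \<open>H \<in> C\<close> \<open>s < card H\<close> by fastforce
        moreover have "H \<subseteq> x" if "x \<in> C" "s < card x" for x
          using least[of x] that mono[of H x] inj \<open>H \<in> C\<close>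
          by (metis (mono_tags, lifting) H'_def inj_onD le_neq_implies_less mem_Collect_eq order_refl)
        ultimately show ?thesis
          using that[of H] CK(1) by auto
      qed
      obtain M where M: "G \<subseteq> M" "M \<subseteq> H" "card M = s"
        using subset_chain_between[of H G s] H G fin by auto
      have "M \<in> KS"
        using M H asc s by (auto simp: KS_def asc_def)
      moreover have "x \<subseteq> M \<or> M \<subseteq> x" if "x \<in> C" for x
      proof -
        have "card x \<noteq> s"
          using \<open>s \<notin> card ` C\<close> that by auto
        then consider "card x < s" | "s < card x"
          by linarith
        then show ?thesis
        proof cases
          case 1
          then show ?thesis
            using M(1) that by (auto simp: G_def)
        next
          case 2
          then show ?thesis
            using M(2) H(4)[OF that] by blast
        qed
      qed
      ultimately have "pred_on.chain KS (<) (insert M C)"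
        using C by (auto simp: chain_less_iff)
      then show False
        using max[of "insert M C"] M(3) \<open>s \<notin> card ` C\<close> by blast
    qed
    then show "C \<in> ranked_chains K S"
      using C CK inj by (auto simp: ranked_chains_def KS_def)
  next
    fix C
    assume "C \<in> ranked_chains K S"
    then have C: "C \<subseteq> K" "\<And>x y. x \<in> C \<Longrightarrow> y \<in> C \<Longrightarrow> x \<subseteq> y \<or> y \<subseteq> x" "card ` C = S"
      by (auto simp: ranked_chains_def)
    have "D = C" if D: "pred_on.chain KS (<) D" "C \<subseteq> D" for D
    proof (intro equalityI subsetI)
      fix x
      assume x: "x \<in> D"
      then have "card x \<in> S" "x \<in> K"
        using D by (auto simp: chain_less_iff KS_def)
      then obtain y where y: "y \<in> C" "card y = card x"
        using C(3) by force
      then have "x \<subseteq> y \<or> y \<subseteq> x"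
        using D x unfolding chain_less_iff by blast
      then have "x = y"
        using y C(1) \<open>x \<in> K\<close> fin by (metis card_subset_eq subsetD)
      then show "x \<in> C"
        using y by simp
    qed (use D in auto)
    moreover have "pred_on.chain KS (<) C"
      using C by (auto simp: chain_less_iff KS_def)
    ultimately show "C \<in> {C. pred_on.maxchain KS (<) C}"
      by (auto simp: pred_on.maxchain_def)
  qed
  finally show ?thesis .
qed

lemma ab_index_face_poset:
  assumes "pure_asc n K"
  shows "ab_index (face_poset K) =
    (\<Sum>i\<le>Suc n. of_nat (card {G\<in>K. card G = i}) * face_term (Suc n) i)"
proof -
  have "ab_index (face_poset K) = flag_poly (Suc n) (\<lambda>T. int (flag_f (face_poset K) T))"
    by (simp add: ab_index_def poset_rank_face_poset[OF assms] flag_h_def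
        sum_u_word_eq_flag_poly[symmetric] del: of_int_sum of_int_mult flag_poly.simps)
  also have "\<dots> = flag_poly (Suc n) (\<lambda>T. int (card (ranked_chains K T)))"
    by (rule flag_poly_cong) (simp add: flag_f_face_poset[OF assms])
  also have "\<dots> = (\<Sum>i\<le>Suc n. of_nat (card {G\<in>K. card G = i}) * face_term (Suc n) i)"
    using assms by (simp add: flag_poly_ranked_chains pure_asc_def del: flag_poly.simps)
  finally show ?thesis .
qed


subsection \<open>Shellings and their boundaries\<close>

lemma odd_card_sym_diff:
  assumes "finite A" "finite B"
  shows "odd (card ((A - B) \<union> (B - A))) \<longleftrightarrow> odd (card A) \<noteq> odd (card B)"
proof -
  have "card A = card (A \<inter> B) + card (A - B)" "card B = card (A \<inter> B) + card (B - A)"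
    using assms card_Int_Diff[of A B] card_Int_Diff[of B A] by (simp_all add: Int_commute)
  moreover have "card ((A - B) \<union> (B - A)) = card (A - B) + card (B - A)"
    using assms by (intro card_Un_disjoint) auto
  ultimately show ?thesis
    by auto
qed

lemma card_between:
  assumes "finite S" "A \<subseteq> S"
  shows "card {G. A \<subseteq> G \<and> G \<subseteq> S \<and> card G = i} = above_count (card S) (card A) i"
proof (cases "card A \<le> i")
  case True
  have finA: "finite A"
    using assms finite_subset by blast
  have "bij_betw (\<lambda>H. A \<union> H) {H. H \<subseteq> S - A \<and> card H = i - card A} {G. A \<subseteq> G \<and> G \<subseteq> S \<and> card G = i}"
  proof (rule bij_betw_byWitness[of _ "\<lambda>G. G - A"])
    show "(\<lambda>H. A \<union> H) ` {H. H \<subseteq> S - A \<and> card H = i - card A} \<subseteq> {G. A \<subseteq> G \<and> G \<subseteq> S \<and> card G = i}"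
    proof clarify
      fix H
      assume H: "H \<subseteq> S - A" "card H = i - card A"
      then have "card (A \<union> H) = card A + card H"
        using assms finA by (intro card_Un_disjoint) (auto intro: finite_subset)
      then show "A \<subseteq> A \<union> H \<and> A \<union> H \<subseteq> S \<and> card (A \<union> H) = i"
        using H assms True by auto
    qed
    show "(\<lambda>G. G - A) ` {G. A \<subseteq> G \<and> G \<subseteq> S \<and> card G = i} \<subseteq> {H. H \<subseteq> S - A \<and> card H = i - card A}"
      using finA by (auto simp: card_Diff_subset)
  qed auto
  then have "card {G. A \<subseteq> G \<and> G \<subseteq> S \<and> card G = i} = card {H. H \<subseteq> S - A \<and> card H = i - card A}"
    by (simp add: bij_betw_same_card)
  also have "\<dots> = (card S - card A) choose (i - card A)"
    using assms finA by (simp add: n_subsets card_Diff_subset)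
  finally show ?thesis
    using True by (simp add: above_count_def)
next
  case False
  have "{G. A \<subseteq> G \<and> G \<subseteq> S \<and> card G = i} = {}"
    using False assms by (auto dest: card_mono[rotated] intro: finite_subset)
  then have "card {G. A \<subseteq> G \<and> G \<subseteq> S \<and> card G = i} = 0"
    by (simp only: card.empty)
  then show ?thesis
    using False by (simp add: above_count_def)
qed

text \<open>
  \<open>R j\<close> is the restriction face of the \<open>j\<close>-th facet: the vertices opposite to those ridges along which
  \<open>F j\<close> meets the earlier facets.
\<close>

locale shelled_pseudomanifold =
  fixes d k :: nat and F R :: "nat \<Rightarrow> 'v set"
  assumes card_F: "j < k \<Longrightarrow> card (F j) = Suc d"
    and R_subset: "j < k \<Longrightarrow> R j \<subseteq> F j"
    and meet_eq: "j < k \<Longrightarrow> Pow (F j) \<inter> (\<Union>i<j. Pow (F i)) = (\<Union>v\<in>R j. Pow (F j - {v}))"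
    and ridge_le_2: "card Q = d \<Longrightarrow> card {j. j < k \<and> Q \<subseteq> F j} \<le> 2"
begin

lemma finite_F: "j < k \<Longrightarrow> finite (F j)"
  using card_F by (metis card.infinite nat.distinct(1))

text \<open>The old part of F m is the union of the ridges opposite to vertices of R m, and G fits
  into one of them as soon as it omits such a vertex.\<close>

lemma in_earlier_iff:
  assumes "m < k" "G \<subseteq> F m"
  shows "(\<exists>i<m. G \<subseteq> F i) \<longleftrightarrow> \<not> R m \<subseteq> G"
proof -
  have "(\<exists>i<m. G \<subseteq> F i) \<longleftrightarrow> G \<in> Pow (F m) \<inter> (\<Union>i<m. Pow (F i))"
    using assms by blast
  also have "\<dots> \<longleftrightarrow> (\<exists>v\<in>R m. G \<subseteq> F m - {v})"
    unfolding meet_eq[OF assms(1)] by blast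
  also have "\<dots> \<longleftrightarrow> \<not> R m \<subseteq> G"
    using assms by blast
  finally show ?thesis .
qed

lemma card_F_minus: "m < k \<Longrightarrow> v \<in> F m \<Longrightarrow> card (F m - {v}) = d"
  using card_F finite_F by simp

lemma ridge_in_three:
  assumes "card Q = d" "i < j" "j < m" "m < k" "Q \<subseteq> F i" "Q \<subseteq> F j" "Q \<subseteq> F m"
  shows False
proof -
  have "card {i, j, m} \<le> card {j. j < k \<and> Q \<subseteq> F j}"
    using assms by (intro card_mono) auto
  then show False
    using ridge_le_2[OF assms(1)] assms by simp
qed

text \<open>
  As long as no facet closes the link of \<open>G\<close> to a sphere, this link is acyclic modulo 2 in codimension
  one.  A set of ridges or facets containing \<open>G\<close> stands for a chain of the link over \<open>\<int>/2\<close>: the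
  hypothesis says that \<open>Z\<close> is a cycle, and the conclusion that it is the boundary of \<open>C\<close>.
\<close>

lemma cycle_bounds:
  assumes "m \<le> k"
    and "\<And>j. j < m \<Longrightarrow> G \<subseteq> F j \<Longrightarrow> \<not> F j - G \<subseteq> R j"
    and "\<And>Q. Q \<in> Z \<Longrightarrow> card Q = d \<and> G \<subseteq> Q \<and> (\<exists>i<m. Q \<subseteq> F i)"
    and "\<And>E. Suc (card E) = d \<Longrightarrow> G \<subseteq> E \<Longrightarrow> even (card {Q\<in>Z. E \<subseteq> Q})"
  shows "\<exists>C\<subseteq>{i. i < m \<and> G \<subseteq> F i}. \<forall>Q. card Q = d \<and> G \<subseteq> Q \<longrightarrow> (Q \<in> Z \<longleftrightarrow> odd (card {i\<in>C. Q \<subseteq> F i}))"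
  using assms
proof (induction m arbitrary: Z)
  case 0
  then have "Z = {}"
    by auto
  then show ?case
    by (intro exI[of _ "{}"]) simp
next
  case (Suc m)
  have mk: "m < k"
    using Suc.prems(1) by simp
  have finZ: "finite Z"
  proof (rule finite_subset)
    show "Z \<subseteq> (\<Union>i<Suc m. Pow (F i))"
      using Suc.prems(3) by (auto simp: Bex_def)
    show "finite (\<Union>i<Suc m. Pow (F i))"
      using finite_F Suc.prems(1) by auto
  qed
  define N where "N = {w \<in> F m. w \<notin> G \<and> w \<notin> R m}"
  show ?case
  proof (cases "\<exists>Q\<in>Z. \<not> (\<exists>i<m. Q \<subseteq> F i)")
    case False
    then have "\<exists>C\<subseteq>{i. i < m \<and> G \<subseteq> F i}. \<forall>Q. card Q = d \<and> G \<subseteq> Q \<longrightarrow> (Q \<in> Z \<longleftrightarrow> odd (card {i\<in>C. Q \<subseteq> F i}))"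
    proof (intro Suc.IH)
      show "card Q = d \<and> G \<subseteq> Q \<and> (\<exists>i<m. Q \<subseteq> F i)" if "Q \<in> Z" for Q
        using Suc.prems(3)[OF that] False that by blast
    qed (use Suc.prems in \<open>simp_all\<close>)
    moreover have "{i. i < m \<and> G \<subseteq> F i} \<subseteq> {i. i < Suc m \<and> G \<subseteq> F i}"
      by auto
    ultimately show ?thesis
      by blast
  next
    case True
    then obtain Q0 where Q0: "Q0 \<in> Z" "\<And>i. i < m \<Longrightarrow> \<not> Q0 \<subseteq> F i"
      by auto
    then have Q0': "card Q0 = d" "G \<subseteq> Q0" "Q0 \<subseteq> F m"
      using Suc.prems(3)[of Q0] by (auto simp: less_Suc_eq)
    have GF: "G \<subseteq> F m"
      using Q0' by simp
    define W where "W = (\<lambda>v. F m - {v}) ` (F m - G)"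
    have inj: "inj_on (\<lambda>v. F m - {v}) (F m)"
      by (auto simp: inj_on_def)
    have ridge: "\<exists>v\<in>F m - G. Q = F m - {v}" if "card Q = d" "G \<subseteq> Q" "Q \<subseteq> F m" for Q
    proof -
      have "card (F m - Q) = 1"
        using that card_F[OF mk] finite_F[OF mk] by (simp add: card_Diff_subset finite_subset)
      then obtain v where "F m - Q = {v}"
        by (auto simp: card_1_singleton_iff)
      then show ?thesis
        using that by (intro bexI[of _ v]) auto
    qed
    obtain w0 where w0: "Q0 = F m - {w0}" "w0 \<in> F m - G"
      using ridge[OF Q0'] by blast
    have "w0 \<notin> R m"
      using in_earlier_iff[OF mk Q0'(3)] Q0(2) w0 by auto
    \<comment> \<open>The face E = F m - {w0, w} contains R m and so lies in no earlier facet. Only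
      two ridges containing E can belong to Z, and one of them does, so evenness forces the
      other.\<close>
    have all: "F m - {w} \<in> Z" if w: "w \<in> F m - G" "w \<notin> R m" for w
    proof (cases "w = w0")
      case True
      then show ?thesis
        using w0 Q0 by simp
    next
      case False
      define E where "E = F m - {w0, w}"
      have "card E = Suc d - 2"
        using False w w0 card_F[OF mk] finite_F[OF mk] by (simp add: E_def card_Diff_subset)
      moreover have "card {w0, w} \<le> card (F m)"
        using w w0 finite_F[OF mk] by (intro card_mono) auto
      ultimately have E: "Suc (card E) = d" "G \<subseteq> E"
        using False w w0 GF card_F[OF mk] by (auto simp: E_def)
      have new: "Q = F m - {w0} \<or> Q = F m - {w}" if Q: "Q \<in> Z" "E \<subseteq> Q" for Q
      proof -
        have "\<not> Q \<subseteq> F i" if "i < m" for i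
        proof
          assume "Q \<subseteq> F i"
          then have "\<not> R m \<subseteq> E"
            using in_earlier_iff[OF mk, of E] Q that E_def by blast
          then show False
            using R_subset[OF mk] w w0 \<open>w0 \<notin> R m\<close> by (auto simp: E_def)
        qed
        then have "Q \<subseteq> F m"
          using Suc.prems(3)[OF Q(1)] by (auto simp: less_Suc_eq)
        then obtain v where "v \<in> F m - G" "Q = F m - {v}"
          using ridge[of Q] Suc.prems(3)[OF Q(1)] by auto
        then show ?thesis
          using Q(2) by (auto simp: E_def)
      qed
      have "F m - {w0} \<noteq> F m - {w}"
        using inj False w w0 by (auto dest: inj_onD)
      show ?thesis
      proof (rule ccontr)
        assume "F m - {w} \<notin> Z"
        then have "{Q\<in>Z. E \<subseteq> Q} = {F m - {w0}}"
          using new Q0(1) w0(1) by (auto simp: E_def)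
        then show False
          using Suc.prems(4)[OF E] by simp
      qed
    qed
    \<comment> \<open>Adding the cycle W of all ridges of F m around G, modulo 2, cancels every
      ridge carried by F m alone. The induction hypothesis then applies to \<open>Z'\<close>, and m
      joins the set that it yields.\<close>
    define Z' where "Z' = (Z - W) \<union> (W - Z)"
    have finW: "finite W"
      using finite_F[OF mk] by (simp add: W_def)
    have W: "Q \<in> W \<longleftrightarrow> Q \<subseteq> F m" if "card Q = d" "G \<subseteq> Q" for Q
      using ridge[OF that] by (auto simp: W_def)
    have Wd: "card Q = d \<and> G \<subseteq> Q" if "Q \<in> W" for Q
      using that GF card_F_minus[OF mk] by (auto simp: W_def)
    have 3: "card Q = d \<and> G \<subseteq> Q \<and> (\<exists>i<m. Q \<subseteq> F i)" if Q: "Q \<in> Z'" for Q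
    proof (cases "Q \<in> W")
      case True
      then obtain v where v: "v \<in> F m - G" "Q = F m - {v}" "Q \<notin> Z"
        using Q by (auto simp: W_def Z'_def)
      then have "v \<in> R m"
        using all by blast
      then have "\<not> R m \<subseteq> Q" "Q \<subseteq> F m"
        using v by auto
      then show ?thesis
        using in_earlier_iff[OF mk, of Q] Wd[OF True] by blast
    next
      case False
      then have "Q \<in> Z"
        using Q by (simp add: Z'_def)
      then show ?thesis
        using Suc.prems(3)[of Q] W[of Q] False by (auto simp: less_Suc_eq)
    qed
    have 4: "even (card {Q\<in>Z'. E \<subseteq> Q})" if E: "Suc (card E) = d" "G \<subseteq> E" for E
    proof -
      have "even (card {Q\<in>W. E \<subseteq> Q})"
      proof (cases "E \<subseteq> F m")
        case True
        have "{Q\<in>W. E \<subseteq> Q} = (\<lambda>v. F m - {v}) ` (F m - E)"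
          using True E by (auto simp: W_def)
        moreover have "inj_on (\<lambda>v. F m - {v}) (F m - E)"
          using inj by (rule inj_on_subset) auto
        ultimately have "card {Q\<in>W. E \<subseteq> Q} = card (F m - E)"
          by (simp add: card_image)
        also have "\<dots> = 2"
          using True E card_F[OF mk] finite_F[OF mk] by (simp add: card_Diff_subset finite_subset)
        finally show ?thesis
          by simp
      next
        case False
        then have "{Q\<in>W. E \<subseteq> Q} = {}"
          by (auto simp: W_def)
        then have "card {Q\<in>W. E \<subseteq> Q} = 0"
          by (simp only: card.empty)
        then show ?thesis
          by simp
      qed
      moreover have "{Q\<in>Z'. E \<subseteq> Q} =
        ({Q\<in>Z. E \<subseteq> Q} - {Q\<in>W. E \<subseteq> Q}) \<union> ({Q\<in>W. E \<subseteq> Q} - {Q\<in>Z. E \<subseteq> Q})"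
        by (auto simp: Z'_def)
      ultimately show ?thesis
        using odd_card_sym_diff[of "{Q\<in>Z. E \<subseteq> Q}" "{Q\<in>W. E \<subseteq> Q}"] finZ finW Suc.prems(4)[OF E]
        by simp
    qed
    have "\<exists>C\<subseteq>{i. i < m \<and> G \<subseteq> F i}. \<forall>Q. card Q = d \<and> G \<subseteq> Q \<longrightarrow> (Q \<in> Z' \<longleftrightarrow> odd (card {i\<in>C. Q \<subseteq> F i}))"
      by (intro Suc.IH 3 4) (use Suc.prems in simp_all)
    then obtain C where C: "C \<subseteq> {i. i < m \<and> G \<subseteq> F i}"
      "\<And>Q. card Q = d \<Longrightarrow> G \<subseteq> Q \<Longrightarrow> Q \<in> Z' \<longleftrightarrow> odd (card {i\<in>C. Q \<subseteq> F i})"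
      by auto
    have finC: "finite C" and mC: "m \<notin> C"
      using C(1) by (auto intro: finite_subset)
    have "Q \<in> Z \<longleftrightarrow> odd (card {i\<in>insert m C. Q \<subseteq> F i})" if Q: "card Q = d" "G \<subseteq> Q" for Q
    proof (cases "Q \<subseteq> F m")
      case True
      then have "{i\<in>insert m C. Q \<subseteq> F i} = insert m {i\<in>C. Q \<subseteq> F i}"
        by auto
      then have "odd (card {i\<in>insert m C. Q \<subseteq> F i}) \<longleftrightarrow> \<not> odd (card {i\<in>C. Q \<subseteq> F i})"
        using finC mC by simp
      then show ?thesis
        using W[OF Q] True C(2)[OF Q] by (auto simp: Z'_def)
    next
      case False
      then have "{i\<in>insert m C. Q \<subseteq> F i} = {i\<in>C. Q \<subseteq> F i}"
        by auto
      then show ?thesis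
        using W[OF Q] False C(2)[OF Q] by (auto simp: Z'_def)
    qed
    then show ?thesis
      using C(1) GF by (intro exI[of _ "insert m C"]) auto
  qed
qed

text \<open>Each facet containing \<open>G\<close>, except the first, is glued to an earlier one along a ridge containing \<open>G\<close>.\<close>

lemma star_connected:
  assumes "m \<le> k" "C \<subseteq> {i. i < m \<and> G \<subseteq> F i}" "C \<noteq> {}" "C \<noteq> {i. i < m \<and> G \<subseteq> F i}"
  shows "\<exists>i\<in>C. \<exists>j\<in>{i. i < m \<and> G \<subseteq> F i} - C. \<exists>Q. card Q = d \<and> G \<subseteq> Q \<and> Q \<subseteq> F i \<and> Q \<subseteq> F j"
proof -
  \<comment> \<open>The least i in A is not the first facet around G, so R i has a vertex v outside
    G. The ridge opposite to v leads to an earlier facet, which is not in A by minimality.\<close>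
  have *: "\<exists>i\<in>A. \<exists>j\<in>{i. i < m \<and> G \<subseteq> F i} - A. \<exists>Q. card Q = d \<and> G \<subseteq> Q \<and> Q \<subseteq> F i \<and> Q \<subseteq> F j"
    if A: "A \<subseteq> {i. i < m \<and> G \<subseteq> F i}" "j0 \<in> {i. i < m \<and> G \<subseteq> F i} - A" "i0 \<in> A" "j0 < i0"
      "\<And>i. i \<in> A \<Longrightarrow> j0 \<le> i" for A i0 j0
  proof -
    define i where "i = (LEAST i. i \<in> A)"
    have i: "i \<in> A" "\<And>j. j < i \<Longrightarrow> j \<notin> A"
      unfolding i_def
      by (rule LeastI[of "\<lambda>i. i \<in> A", OF \<open>i0 \<in> A\<close>], erule not_less_Least)
    have "j0 < i"
      using A(2) A(5)[OF i(1)] i(1) by (cases "j0 = i") auto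
    have ik: "i < k" "G \<subseteq> F i"
      using i A assms(1) by auto
    then have "\<not> R i \<subseteq> G"
      using in_earlier_iff[OF ik] \<open>j0 < i\<close> A(2) by blast
    then obtain v where v: "v \<in> R i" "v \<notin> G"
      by blast
    then have "\<not> R i \<subseteq> F i - {v}"
      by blast
    then obtain j where j: "j < i" "F i - {v} \<subseteq> F j"
      using in_earlier_iff[OF ik(1), of "F i - {v}"] by blast
    have "card (F i - {v}) = d" "G \<subseteq> F i - {v}"
      using v ik R_subset[OF ik(1)] card_F_minus[OF ik(1), of v] by auto
    then show ?thesis
      using i j A(1) by (intro bexI[of _ i] bexI[of _ j] exI[of _ "F i - {v}"]) auto
  qed
  define j0 where "j0 = (LEAST i. i < m \<and> G \<subseteq> F i)"
  obtain i1 where "i1 < m" "G \<subseteq> F i1"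
    using assms by auto
  then have j0: "j0 < m \<and> G \<subseteq> F j0" "\<And>i. i < m \<Longrightarrow> G \<subseteq> F i \<Longrightarrow> j0 \<le> i"
    unfolding j0_def using LeastI[of "\<lambda>i. i < m \<and> G \<subseteq> F i" i1] by (blast, simp add: Least_le)
  show ?thesis
  proof (cases "j0 \<in> C")
    case False
    obtain i0 where "i0 \<in> C"
      using assms by blast
    then have "j0 < i0"
      using False j0(2)[of i0] assms(2) by (metis le_neq_implies_less mem_Collect_eq subsetD)
    then show ?thesis
      using *[OF assms(2) _ \<open>i0 \<in> C\<close>, of j0] j0 False assms(2) by blast
  next
    case True
    \<comment> \<open>If C contains the first facet, the argument is applied to the complement of C,
      since sharing a ridge is symmetric.\<close>
    let ?A = "{i. i < m \<and> G \<subseteq> F i} - C"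
    obtain i0 where i0: "i0 \<in> ?A"
      using assms by blast
    then have "j0 < i0"
      using True j0(2)[of i0] by (metis DiffD1 DiffD2 le_neq_implies_less mem_Collect_eq)
    then show ?thesis
      using *[of ?A j0 i0] j0 True i0 assms(2) by blast
  qed
qed

section \<open>Boundary and interior faces of the first m facets\<close>

definition boundary_face :: "nat \<Rightarrow> 'v set \<Rightarrow> bool"
  where "boundary_face m G \<longleftrightarrow> (\<exists>Q. card Q = d \<and> G \<subseteq> Q \<and> card {i. i < m \<and> Q \<subseteq> F i} = 1)"

text \<open>The facets whose addition closes the link of \<open>G\<close> to a sphere.\<close>

definition closing :: "nat \<Rightarrow> 'v set \<Rightarrow> nat set"
  where "closing m G = {j. j < m \<and> G \<subseteq> F j \<and> F j - G \<subseteq> R j}"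

text \<open>
  The ridges of \<open>F m\<close> around \<open>G\<close> form a cycle, so they bound a set \<open>C\<close> of facets.  Connectedness of
  the star forces \<open>C\<close> to consist of all facets around \<open>G\<close>, since a ridge lies in at most two facets.
\<close>

lemma closing_imp_interior:
  assumes mk: "m < k" and GF: "G \<subseteq> F m" and nsub: "\<not> R m \<subseteq> G" and cl: "F m - G \<subseteq> R m"
    and none: "closing m G = {}"
  shows "\<not> boundary_face (Suc m) G"
proof
  assume "boundary_face (Suc m) G"
  then obtain Q where Q: "card Q = d" "G \<subseteq> Q" "card {i. i < Suc m \<and> Q \<subseteq> F i} = 1"
    by (auto simp: boundary_face_def)
  define Z where "Z = (\<lambda>v. F m - {v}) ` (F m - G)"
  have Z1: "card Q = d \<and> G \<subseteq> Q \<and> Q \<subseteq> F m \<and> (\<exists>i<m. Q \<subseteq> F i)" if "Q \<in> Z" for Q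
  proof -
    obtain v where v: "v \<in> F m - G" "Q = F m - {v}"
      using \<open>Q \<in> Z\<close> by (auto simp: Z_def)
    then have "\<exists>i<m. Q \<subseteq> F i"
      using in_earlier_iff[OF mk, of Q] cl by blast
    then show ?thesis
      using v GF card_F_minus[OF mk] by auto
  qed
  have Z2: "Q \<in> Z" if Q: "card Q = d" "G \<subseteq> Q" "Q \<subseteq> F m" for Q
  proof -
    have "card (F m - Q) = 1"
      using that card_F[OF mk] finite_F[OF mk] by (simp add: card_Diff_subset finite_subset)
    then obtain v where "F m - Q = {v}"
      by (auto simp: card_1_singleton_iff)
    then show ?thesis
      unfolding Z_def using that by (intro image_eqI[of _ _ v]) auto
  qed
  have even: "even (card {Q\<in>Z. E \<subseteq> Q})" if E: "Suc (card E) = d" "G \<subseteq> E" for E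
  proof (cases "E \<subseteq> F m")
    case True
    have "{Q\<in>Z. E \<subseteq> Q} = (\<lambda>v. F m - {v}) ` (F m - E)"
      using True E by (auto simp: Z_def)
    moreover have "inj_on (\<lambda>v. F m - {v}) (F m - E)"
      by (auto simp: inj_on_def)
    ultimately have "card {Q\<in>Z. E \<subseteq> Q} = card (F m - E)"
      by (simp add: card_image)
    also have "\<dots> = 2"
      using True E card_F[OF mk] finite_F[OF mk] by (simp add: card_Diff_subset finite_subset)
    finally show ?thesis
      by simp
  next
    case False
    then have "{Q\<in>Z. E \<subseteq> Q} = {}"
      by (auto simp: Z_def)
    then have "card {Q\<in>Z. E \<subseteq> Q} = 0"
      by (simp only: card.empty)
    then show ?thesis
      by simp
  qed
  have "\<exists>C\<subseteq>{i. i < m \<and> G \<subseteq> F i}. \<forall>Q. card Q = d \<and> G \<subseteq> Q \<longrightarrow> (Q \<in> Z \<longleftrightarrow> odd (card {i\<in>C. Q \<subseteq> F i}))"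
  proof (rule cycle_bounds)
    show "\<not> F j - G \<subseteq> R j" if "j < m" "G \<subseteq> F j" for j
      using none that by (auto simp: closing_def)
    show "card Q = d \<and> G \<subseteq> Q \<and> (\<exists>i<m. Q \<subseteq> F i)" if "Q \<in> Z" for Q
      using Z1[OF that] by blast
  qed (use mk even in simp_all)
  then obtain C where C: "C \<subseteq> {i. i < m \<and> G \<subseteq> F i}"
    "\<And>Q. card Q = d \<Longrightarrow> G \<subseteq> Q \<Longrightarrow> Q \<in> Z \<longleftrightarrow> odd (card {i\<in>C. Q \<subseteq> F i})"
    by auto
  obtain v where v: "v \<in> R m" "v \<notin> G"
    using nsub by blast
  then have "F m - {v} \<in> Z"
    using R_subset[OF mk] by (auto simp: Z_def)
  then have "odd (card {i\<in>C. F m - {v} \<subseteq> F i})"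
    using C(2)[of "F m - {v}"] Z1 by blast
  then have "C \<noteq> {}"
    by auto
  have "C = {i. i < m \<and> G \<subseteq> F i}"
  proof (rule ccontr)
    assume "C \<noteq> {i. i < m \<and> G \<subseteq> F i}"
    then obtain i j Q where ij: "i \<in> C" "j < m" "j \<notin> C" "card Q = d" "G \<subseteq> Q" "Q \<subseteq> F i" "Q \<subseteq> F j"
      using star_connected[OF _ C(1) \<open>C \<noteq> {}\<close>] mk by auto
    have "i < m" "i \<noteq> j"
      using C(1) ij by auto
    \<comment> \<open>A ridge joining C to its complement lies in just one facet of C, so it belongs
      to Z and thus also to F m, which would be its third facet.\<close>
    have "{l\<in>C. Q \<subseteq> F l} = {i}"
    proof (intro equalityI subsetI)
      fix l
      assume l: "l \<in> {l\<in>C. Q \<subseteq> F l}"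
      show "l \<in> {i}"
      proof (rule ccontr)
        assume "l \<notin> {i}"
        moreover have "j \<noteq> l" "l < m"
          using l ij C(1) by auto
        ultimately have "card {i, j, l} = 3" "{i, j, l} \<subseteq> {l. l < k \<and> Q \<subseteq> F l}"
          using l ij \<open>i < m\<close> \<open>i \<noteq> j\<close> mk by auto
        then have "3 \<le> card {l. l < k \<and> Q \<subseteq> F l}"
          using card_mono[of "{l. l < k \<and> Q \<subseteq> F l}" "{i, j, l}"] by simp
        then show False
          using ridge_le_2[OF \<open>card Q = d\<close>] by simp
      qed
    qed (use ij in auto)
    then have "Q \<in> Z"
      using C(2)[of Q] ij by simp
    then have "Q \<subseteq> F m"
      using Z1 by blast
    then show False
      using ridge_in_three[OF \<open>card Q = d\<close>, of i j m] ridge_in_three[OF \<open>card Q = d\<close>, of j i m]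
        ij \<open>i < m\<close> \<open>i \<noteq> j\<close> mk by linarith
  qed
  then have par: "Q \<in> Z \<longleftrightarrow> odd (card {i. i < m \<and> Q \<subseteq> F i})" if "card Q = d" "G \<subseteq> Q" for Q
  proof -
    have "{i\<in>C. Q \<subseteq> F i} = {i. i < m \<and> Q \<subseteq> F i}"
      using that \<open>C = _\<close> by auto
    then show ?thesis
      using C(2)[OF that] by simp
  qed
  \<comment> \<open>A ridge of F m around G lies in an earlier facet as well, and a ridge outside F
    m is not in Z, so it lies in evenly many facets. Neither has the count 1 of a boundary
    ridge.\<close>
  show False
  proof (cases "Q \<subseteq> F m")
    case True
    then obtain i where "i < m" "Q \<subseteq> F i"
      using Z1[OF Z2[OF Q(1,2) True]] by blast
    then have "card {i, m} \<le> card {i. i < Suc m \<and> Q \<subseteq> F i}"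
      using True by (intro card_mono) auto
    then show False
      using Q(3) \<open>i < m\<close> by simp
  next
    case False
    then have "{i. i < Suc m \<and> Q \<subseteq> F i} = {i. i < m \<and> Q \<subseteq> F i}" "Q \<notin> Z"
      using Z1[of Q] by (auto simp: less_Suc_eq)
    then show False
      using par[OF Q(1,2)] Q(3) by simp
  qed
qed

text \<open>When F m is added, a face outside it keeps its status. A new face is on the boundary,
  unless it is F m itself. An old face of F m was on the boundary, hence not yet closed, and it is
  closed now exactly if all ridges of F m around it are old.\<close>

lemma card_closing:
  assumes "m \<le> k" "i < m" "G \<subseteq> F i"
  shows "card (closing m G) = (if boundary_face m G then 0 else 1)"
  using assms
proof (induction m arbitrary: i)
  case (Suc m)
  then have mk: "m < k"
    by simp
  have fin: "finite (closing m G)"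
    by (simp add: closing_def)
  have closing_Suc: "closing (Suc m) G =
      (if G \<subseteq> F m \<and> F m - G \<subseteq> R m then insert m (closing m G) else closing m G)"
    by (auto simp: closing_def less_Suc_eq)
  have m_notin: "m \<notin> closing m G"
    by (simp add: closing_def)
  have new_ridge: "boundary_face (Suc m) G" if "w \<in> F m" "w \<notin> G" "G \<subseteq> F m" "w \<notin> R m" for w
    unfolding boundary_face_def
  proof (intro exI conjI)
    show "card (F m - {w}) = d" "G \<subseteq> F m - {w}"
      using that card_F_minus[OF mk] by auto
    have "\<not> (\<exists>i<m. F m - {w} \<subseteq> F i)"
      using in_earlier_iff[OF mk, of "F m - {w}"] R_subset[OF mk] that by auto
    then have "{i. i < Suc m \<and> F m - {w} \<subseteq> F i} = {m}"
      by (auto simp: less_Suc_eq)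
    then show "card {i. i < Suc m \<and> F m - {w} \<subseteq> F i} = 1"
      by simp
  qed
  consider "\<not> G \<subseteq> F m" | "G \<subseteq> F m" "R m \<subseteq> G" | "G \<subseteq> F m" "\<not> R m \<subseteq> G"
    by blast
  then show ?case
  proof cases
    case 1
    then have "i < m"
      using Suc.prems by (auto simp: less_Suc_eq)
    have "{i. i < Suc m \<and> Q \<subseteq> F i} = {i. i < m \<and> Q \<subseteq> F i}" if "G \<subseteq> Q" for Q
      using that 1 by (auto simp: less_Suc_eq)
    then have "boundary_face (Suc m) G \<longleftrightarrow> boundary_face m G"
      by (simp add: boundary_face_def cong: conj_cong)
    then show ?thesis
      using Suc.IH[OF _ \<open>i < m\<close>] Suc.prems 1 closing_Suc by simp
  next
    case 2
    then have none: "closing m G = {}"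
      using in_earlier_iff[OF mk, of G] unfolding closing_def by blast
    show ?thesis
    proof (cases "G = F m")
      \<comment> \<open>A facet is closed by itself: F m - G is empty, and no ridge contains
        G.\<close>
      case True
      have "\<not> boundary_face (Suc m) G"
      proof
        assume "boundary_face (Suc m) G"
        then obtain Q where Q: "card Q = d" "F m \<subseteq> Q" "card {i. i < Suc m \<and> Q \<subseteq> F i} = 1"
          using True by (auto simp: boundary_face_def)
        then have "{i. i < Suc m \<and> Q \<subseteq> F i} \<noteq> {}"
          by (metis card.empty zero_neq_one)
        then obtain i where "i < Suc m" "Q \<subseteq> F i"
          by blast
        then have "i < k" "Q \<subseteq> F i"
          using mk by auto
        then have "finite Q"
          using finite_F finite_subset by blast
        then show False
          using card_mono[OF _ Q(2)] Q(1) card_F[OF mk] by simp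
      qed
      then show ?thesis
        using True none closing_Suc by simp
    next
      case False
      then obtain w where w: "w \<in> F m" "w \<notin> G"
        using 2 by blast
      then have "boundary_face (Suc m) G"
        using new_ridge 2 by blast
      moreover have "\<not> F m - G \<subseteq> R m"
        using w 2 by blast
      ultimately show ?thesis
        using none closing_Suc by simp
    qed
  next
    case 3
    then obtain v where v: "v \<in> R m" "v \<notin> G"
      by blast
    define Q where "Q = F m - {v}"
    have Q: "card Q = d" "G \<subseteq> Q" "Q \<subseteq> F m"
      using 3 v card_F_minus[OF mk] R_subset[OF mk] by (auto simp: Q_def)
    have "\<not> R m \<subseteq> Q"
      using v by (auto simp: Q_def)
    then obtain j where j: "j < m" "Q \<subseteq> F j"
      using in_earlier_iff[OF mk Q(3)] by blast
    have "l = j" if "l < m" "Q \<subseteq> F l" for l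
    proof (rule ccontr)
      assume "l \<noteq> j"
      then show False
        using ridge_in_three[OF Q(1), of l j m] ridge_in_three[OF Q(1), of j l m] that j Q(3) mk
        by (cases "l < j") simp_all
    qed
    then have "{i. i < m \<and> Q \<subseteq> F i} = {j}"
      using j by blast
    then have "boundary_face m G"
      unfolding boundary_face_def using Q by (intro exI[of _ Q]) simp
    moreover have "G \<subseteq> F j"
      using j Q by blast
    ultimately have none: "closing m G = {}"
      using Suc.IH[OF _ j(1)] Suc.prems fin by simp
    show ?thesis
    proof (cases "F m - G \<subseteq> R m")
      case True
      then show ?thesis
        using closing_imp_interior[OF mk 3 True none] none closing_Suc 3 by simp
    next
      case False
      then have "boundary_face (Suc m) G"
        using new_ridge 3 by blast
      then show ?thesis
        using none closing_Suc False by simp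
    qed
  qed
qed simp

lemma finite_faces: "finite {G. \<exists>j<k. G \<subseteq> F j}"
proof -
  have "{G. \<exists>j<k. G \<subseteq> F j} = (\<Union>j<k. Pow (F j))"
    by auto
  then show ?thesis
    using finite_F by simp
qed

text \<open>Each face lies in the interval [R j, F j] of the first facet containing it, and these
  intervals are disjoint.\<close>

lemma card_faces:
  "card {G. (\<exists>j<k. G \<subseteq> F j) \<and> card G = i} = (\<Sum>j<k. above_count (Suc d) (card (R j)) i)"
proof -
  let ?I = "\<lambda>j. {G. R j \<subseteq> G \<and> G \<subseteq> F j \<and> card G = i}"
  have "{G. (\<exists>j<k. G \<subseteq> F j) \<and> card G = i} = (\<Union>j<k. ?I j)"
  proof (intro equalityI subsetI)
    fix G
    assume G: "G \<in> {G. (\<exists>j<k. G \<subseteq> F j) \<and> card G = i}"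
    define j where "j = (LEAST j. j < k \<and> G \<subseteq> F j)"
    have j: "j < k \<and> G \<subseteq> F j"
      using G LeastI_ex[of "\<lambda>j. j < k \<and> G \<subseteq> F j"] unfolding j_def by blast
    have "\<not> (\<exists>l<j. G \<subseteq> F l)"
      using j not_less_Least[of _ "\<lambda>j. j < k \<and> G \<subseteq> F j"] unfolding j_def[symmetric]
      by (metis less_trans)
    then have "R j \<subseteq> G"
      using in_earlier_iff j by blast
    then show "G \<in> (\<Union>j<k. ?I j)"
      using j G by blast
  qed auto
  moreover have "card (\<Union>j<k. ?I j) = (\<Sum>j<k. card (?I j))"
  proof (rule card_UN_disjoint)
    show "\<forall>j\<in>{..<k}. finite (?I j)"
    proof
      fix j
      assume "j \<in> {..<k}"
      then show "finite (?I j)"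
        using finite_F[of j] by (auto intro: finite_subset[of _ "Pow (F j)"])
    qed
    have "?I j \<inter> ?I l = {}" if "j < l" "l < k" for j l
      using in_earlier_iff[OF that(2)] that by auto
    note disj = this
    show "\<forall>j\<in>{..<k}. \<forall>l\<in>{..<k}. j \<noteq> l \<longrightarrow> ?I j \<inter> ?I l = {}"
    proof (intro ballI impI)
      fix j l
      assume "j \<in> {..<k}" "l \<in> {..<k}" "j \<noteq> l"
      then show "?I j \<inter> ?I l = {}"
        using disj[of j l] disj[of l j] by (cases "j < l") (simp_all add: Int_commute)
    qed
  qed simp
  moreover have "card (?I j) = above_count (Suc d) (card (R j)) i" if "j < k" for j
    using card_between[OF finite_F[OF that] R_subset[OF that]] card_F[OF that] by simp
  ultimately show ?thesis
    by simp
qed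

text \<open>Double counting of faces and their closing facets: F j closes G exactly if G lies
  between F j - R j and F j. This is the origin of the subtracted half of
  \<open>gluing_ab\<close>.\<close>

lemma sum_closing:
  "(\<Sum>G | (\<exists>j<k. G \<subseteq> F j) \<and> card G = i. card (closing k G)) =
    (\<Sum>j<k. above_count (Suc d) (Suc d - card (R j)) i)"
proof -
  let ?S = "{G. (\<exists>j<k. G \<subseteq> F j) \<and> card G = i}"
  have fin: "finite ?S"
    by (rule finite_subset[OF _ finite_faces]) auto
  have "(\<Sum>G\<in>?S. card (closing k G)) = (\<Sum>G\<in>?S. card {j\<in>{..<k}. G \<subseteq> F j \<and> F j - G \<subseteq> R j})"
    by (simp add: closing_def)
  also have "\<dots> = (\<Sum>j<k. card {G\<in>?S. G \<subseteq> F j \<and> F j - G \<subseteq> R j})"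
    using fin by (rule sum_multicount_gen[where k = "\<lambda>j. card {G\<in>?S. G \<subseteq> F j \<and> F j - G \<subseteq> R j}"]) simp_all
  also have "\<dots> = (\<Sum>j<k. above_count (Suc d) (Suc d - card (R j)) i)"
  proof (rule sum.cong)
    fix j
    assume "j \<in> {..<k}"
    then have j: "j < k"
      by simp
    then have "{G\<in>?S. G \<subseteq> F j \<and> F j - G \<subseteq> R j} = {G. F j - R j \<subseteq> G \<and> G \<subseteq> F j \<and> card G = i}"
      by auto
    moreover have "card (F j - R j) = Suc d - card (R j)"
      using card_F[OF j] R_subset[OF j] finite_F[OF j] by (simp add: card_Diff_subset finite_subset)
    ultimately show "card {G\<in>?S. G \<subseteq> F j \<and> F j - G \<subseteq> R j} = above_count (Suc d) (Suc d - card (R j)) i"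
      using card_between[OF finite_F[OF j], of "F j - R j" i] card_F[OF j] by simp
  qed simp
  finally show ?thesis .
qed

lemma boundary_face_imp_face: "boundary_face k G \<Longrightarrow> \<exists>j<k. G \<subseteq> F j"
  unfolding boundary_face_def by (metis (mono_tags, lifting) Collect_empty_eq card.empty order_trans zero_neq_one)

text \<open>Each interior face has one closing facet and each boundary face none, so subtracting
  closings from faces leaves the boundary. The count is in the integers because single summands may
  be negative.\<close>

lemma card_boundary_faces:
  "int (card {G. boundary_face k G \<and> card G = i}) =
    (\<Sum>j<k. int (above_count (Suc d) (card (R j)) i) - int (above_count (Suc d) (Suc d - card (R j)) i))"
proof -
  let ?S = "{G. (\<exists>j<k. G \<subseteq> F j) \<and> card G = i}"
  have fin: "finite ?S"
    by (rule finite_subset[OF _ finite_faces]) auto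
  have sub: "{G. boundary_face k G \<and> card G = i} = {G\<in>?S. boundary_face k G}"
    using boundary_face_imp_face by auto
  have "(\<Sum>G\<in>?S. card (closing k G)) = (\<Sum>G\<in>?S. if boundary_face k G then 0 else 1)"
    using card_closing[of k] by (intro sum.cong) auto
  also have "\<dots> = card {G\<in>?S. \<not> boundary_face k G}"
    using fin by (simp add: sum.If_cases Int_def)
  finally have "card {G\<in>?S. \<not> boundary_face k G} = (\<Sum>j<k. above_count (Suc d) (Suc d - card (R j)) i)"
    by (simp only: sum_closing)
  moreover have "card ?S = card {G\<in>?S. boundary_face k G} + card {G\<in>?S. \<not> boundary_face k G}"
  proof (subst card_Un_disjoint[symmetric])
    show "finite {G\<in>?S. boundary_face k G}" "finite {G\<in>?S. \<not> boundary_face k G}"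
      by (rule finite_subset[OF _ fin], blast)+
  qed (auto intro: arg_cong[of _ _ card])
  ultimately show ?thesis
    by (simp add: sub card_faces sum_subtractf flip: of_nat_sum)
qed

lemma sum_boundary_face_terms:
  "(\<Sum>i\<le>d. of_nat (card {G. boundary_face k G \<and> card G = i}) * face_term d i) =
    (\<Sum>j<k. gluing_ab d (card (R j)))"
proof -
  have "(\<Sum>i\<le>d. of_nat (card {G. boundary_face k G \<and> card G = i}) * face_term d i) =
     (\<Sum>i\<le>d. of_int (int (card {G. boundary_face k G \<and> card G = i})) * face_term d i)"
    by simp
  also have "\<dots> = (\<Sum>i\<le>d. \<Sum>j<k. of_nat (above_count (Suc d) (card (R j)) i) * face_term d i
      - of_nat (above_count (Suc d) (Suc d - card (R j)) i) * face_term d i)"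
    unfolding card_boundary_faces by (simp add: sum_distrib_right left_diff_distrib)
  also have "\<dots> = (\<Sum>j<k. \<Sum>i\<le>d. of_nat (above_count (Suc d) (card (R j)) i) * face_term d i
      - of_nat (above_count (Suc d) (Suc d - card (R j)) i) * face_term d i)"
    by (rule sum.swap)
  also have "\<dots> = (\<Sum>j<k. gluing_ab d (card (R j)))"
    by (simp add: gluing_ab_def upper_ab_def sum_subtractf)
  finally show ?thesis .
qed

end

section \<open>Restriction faces of a shelling\<close>

lemma shelling_imp_facets: "shelling n K Fs \<Longrightarrow> set Fs = facets K"
  by (cases n) auto

lemma facets_simplex_boundary:
  assumes "X \<in> facets (simplex_boundary F)"
  shows "\<exists>v\<in>F. X = F - {v}"
proof -
  have X: "X \<subseteq> F" "X \<noteq> F" "\<And>Y. Y \<subseteq> F \<Longrightarrow> Y \<noteq> F \<Longrightarrow> X \<subseteq> Y \<Longrightarrow> Y = X"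
    using assms by (auto simp: facets_def simplex_boundary_def)
  then obtain v where "v \<in> F" "v \<notin> X"
    by blast
  then show ?thesis
    using X(1) X(3)[of "F - {v}"] by (intro bexI[of _ v]) auto
qed

lemma card_nth_eq:
  assumes "distinct xs"
  shows "card {i. i < length xs \<and> P (xs ! i)} = card {x\<in>set xs. P x}"
  using assms distinct_card[of "filter P xs"] by (simp add: length_filter_conv_card)

text \<open>The pieces of the intersection are facets of a simplex boundary, so each omits a single
  vertex, and that vertex lies in R j. Collecting all vertices with an old opposite ridge makes R
  independent of the chosen shellings of the simplex boundaries.\<close>

lemma shelling_imp_pseudomanifold:
  assumes shelling: "shelling (Suc n) B Fs"
    and two: "\<And>Q. card Q = Suc n \<Longrightarrow> card {F\<in>facets B. Q \<subseteq> F} \<le> 2"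
  obtains R where "shelled_pseudomanifold (Suc n) (length Fs) (\<lambda>i. Fs ! i) R" "R 0 = {}"
    "\<And>j. 0 < j \<Longrightarrow> j < length Fs \<Longrightarrow> R j \<noteq> {}"
proof -
  define R where "R j = {v\<in>Fs ! j. \<exists>i<j. Fs ! j - {v} \<subseteq> Fs ! i}" for j
  have B: "pure_asc (Suc n) B" "distinct Fs" "set Fs = facets B"
    using shelling by auto
  have meet: "\<exists>V\<subseteq>R j. V \<noteq> {} \<and> Pow (Fs ! j) \<inter> (\<Union>i<j. Pow (Fs ! i)) = (\<Union>v\<in>V. Pow (Fs ! j - {v}))"
    if j: "0 < j" "j < length Fs" for j
  proof -
    obtain Gs r where Gs: "shelling n (simplex_boundary (Fs ! j)) Gs" "1 \<le> r" "r \<le> length Gs"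
      "Pow (Fs ! j) \<inter> (\<Union>i<j. Pow (Fs ! i)) = (\<Union>i<r. Pow (Gs ! i))"
      using shelling j by auto
    have "\<exists>v\<in>Fs ! j. Gs ! l = Fs ! j - {v}" if "l < r" for l
      using facets_simplex_boundary[of "Gs ! l" "Fs ! j"] shelling_imp_facets[OF Gs(1)] Gs(3) that
      by (metis less_le_trans nth_mem)
    then obtain v where v: "\<And>l. l < r \<Longrightarrow> v l \<in> Fs ! j \<and> Gs ! l = Fs ! j - {v l}"
      by metis
    have eq: "(\<Union>i<r. Pow (Gs ! i)) = (\<Union>w\<in>v ` {..<r}. Pow (Fs ! j - {w}))"
      using v by auto
    have "v ` {..<r} \<subseteq> R j"
    proof clarify
      fix l
      assume "l < r"
      then have "Fs ! j - {v l} \<in> (\<Union>i<r. Pow (Gs ! i))"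
        using v[OF \<open>l < r\<close>] by auto
      then have "\<exists>i<j. Fs ! j - {v l} \<subseteq> Fs ! i"
        unfolding Gs(4)[symmetric] by blast
      then show "v l \<in> R j"
        using v[OF \<open>l < r\<close>] by (simp add: R_def)
    qed
    moreover have "v ` {..<r} \<noteq> {}"
      using Gs(2) by (auto simp: lessThan_empty_iff)
    ultimately show ?thesis
      using Gs(4) eq by metis
  qed
  have "shelled_pseudomanifold (Suc n) (length Fs) (\<lambda>i. Fs ! i) R"
  proof
    show "card (Fs ! j) = Suc (Suc n)" if "j < length Fs" for j
      using B that nth_mem by (auto simp: pure_asc_def)
    show "R j \<subseteq> Fs ! j" for j
      by (auto simp: R_def)
    show "Pow (Fs ! j) \<inter> (\<Union>i<j. Pow (Fs ! i)) = (\<Union>v\<in>R j. Pow (Fs ! j - {v}))"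
      if jk: "j < length Fs" for j
    proof (cases "j = 0")
      case False
      then obtain V where V: "V \<subseteq> R j"
        and eq: "Pow (Fs ! j) \<inter> (\<Union>i<j. Pow (Fs ! i)) = (\<Union>v\<in>V. Pow (Fs ! j - {v}))"
        using meet[OF _ jk] False by (metis neq0_conv)
      have "(\<Union>v\<in>R j. Pow (Fs ! j - {v})) \<subseteq> Pow (Fs ! j) \<inter> (\<Union>i<j. Pow (Fs ! i))"
      proof
        fix G
        assume "G \<in> (\<Union>v\<in>R j. Pow (Fs ! j - {v}))"
        then obtain v i where "v \<in> Fs ! j" "i < j" "Fs ! j - {v} \<subseteq> Fs ! i" "G \<subseteq> Fs ! j - {v}"
          by (auto simp: R_def)
        then show "G \<in> Pow (Fs ! j) \<inter> (\<Union>i<j. Pow (Fs ! i))"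
          by blast
      qed
      moreover have "(\<Union>v\<in>V. Pow (Fs ! j - {v})) \<subseteq> (\<Union>v\<in>R j. Pow (Fs ! j - {v}))"
        using V by (rule UN_mono) simp
      ultimately show ?thesis
        using eq by (simp only: subset_antisym)
    qed (simp add: R_def)
    show "card {j. j < length Fs \<and> Q \<subseteq> Fs ! j} \<le> 2" if "card Q = Suc n" for Q
      using two[OF that] card_nth_eq[OF B(2), of "\<lambda>F. Q \<subseteq> F"] B(3) by simp
  qed
  moreover have "R 0 = {}"
    by (simp add: R_def)
  moreover have "R j \<noteq> {}" if "0 < j" "j < length Fs" for j
    using meet[OF that] by auto
  ultimately show ?thesis
    using that by blast
qed

lemma finite_asc_faces: "asc K \<Longrightarrow> F \<in> K \<Longrightarrow> finite F"
  by (simp add: asc_def)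

lemma facets_pure_asc:
  assumes "pure_asc n K"
  shows "facets K = {F\<in>K. card F = Suc n}"
proof (intro equalityI subsetI)
  fix F
  assume F: "F \<in> {F\<in>K. card F = Suc n}"
  show "F \<in> facets K"
    unfolding facets_def
  proof (intro CollectI conjI ballI impI)
    fix G
    assume G: "G \<in> K" "F \<subseteq> G"
    then have "finite G" "card G \<le> card F"
      using F assms pure_asc_card_le[OF assms G(1)] by (auto simp: pure_asc_def finite_asc_faces)
    then show "G = F"
      using G(2) card_seteq by metis
  qed (use F in auto)
qed (use assms in \<open>auto simp: pure_asc_def facets_def\<close>)

lemma ab_index_ball_boundary:
  assumes shelling: "shelling (Suc n) B Fs"
    and two: "\<And>Q. card Q = Suc n \<Longrightarrow> card {F\<in>facets B. Q \<subseteq> F} \<le> 2"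
    and nonempty: "ball_boundary (Suc n) B \<noteq> {}"
  obtains \<rho> where "\<rho> 0 = 0" "\<And>j. 0 < j \<Longrightarrow> j < card {F\<in>B. card F = Suc (Suc n)} \<Longrightarrow> 1 \<le> \<rho> j \<and> \<rho> j \<le> Suc (Suc n)"
    "ab_index (face_poset (ball_boundary (Suc n) B)) =
      (\<Sum>j<card {F\<in>B. card F = Suc (Suc n)}. gluing_ab (Suc n) (\<rho> j))"
proof -
  obtain R where R: "shelled_pseudomanifold (Suc n) (length Fs) (\<lambda>i. Fs ! i) R" "R 0 = {}"
    "\<And>j. 0 < j \<Longrightarrow> j < length Fs \<Longrightarrow> R j \<noteq> {}"
    using shelling_imp_pseudomanifold[OF shelling two] by blast
  interpret shelled_pseudomanifold "Suc n" "length Fs" "\<lambda>i. Fs ! i" R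
    by (rule R)
  have B: "pure_asc (Suc n) B" "asc B" "distinct Fs" "set Fs = facets B"
    using shelling by (auto simp: pure_asc_def)
  have k: "card {F\<in>B. card F = Suc (Suc n)} = length Fs"
    using B facets_pure_asc[OF B(1)] distinct_card by metis
  have count: "card {i. i < length Fs \<and> Q \<subseteq> Fs ! i} = card {F\<in>facets B. Q \<subseteq> F}" for Q
    using card_nth_eq[OF B(3), of "\<lambda>F. Q \<subseteq> F"] B(4) by simp
  have "Q \<in> B" if "card {F\<in>facets B. Q \<subseteq> F} = 1" for Q
  proof -
    have "{F\<in>facets B. Q \<subseteq> F} \<noteq> {}"
      using that by (metis card.empty zero_neq_one)
    then show ?thesis
      using B(2) by (auto simp: asc_def facets_def)
  qed
  then have bd: "ball_boundary (Suc n) B = {G. boundary_face (length Fs) G}"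
    unfolding ball_boundary_def boundary_face_def count by blast
  have "finite (ball_boundary (Suc n) B)"
    unfolding bd using boundary_face_imp_face by (intro finite_subset[OF _ finite_faces]) auto
  moreover have "finite G" if "G \<in> ball_boundary (Suc n) B" for G
    using that B(2) by (auto simp: ball_boundary_def asc_def)
  moreover have "H \<in> ball_boundary (Suc n) B" if "G \<in> ball_boundary (Suc n) B" "H \<subseteq> G" for G H
    using that unfolding ball_boundary_def by blast
  moreover have "card G = Suc n" if "G \<in> facets (ball_boundary (Suc n) B)" for G
  proof -
    obtain Q where Q: "Q \<in> B" "card Q = Suc n" "G \<subseteq> Q" "card {F\<in>facets B. Q \<subseteq> F} = 1"
    proof -
      have "G \<in> ball_boundary (Suc n) B"
        using \<open>G \<in> facets (ball_boundary (Suc n) B)\<close> by (simp add: facets_def)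
      then show ?thesis
        using that unfolding ball_boundary_def by blast
    qed
    then have "Q \<in> ball_boundary (Suc n) B"
      by (auto simp: ball_boundary_def)
    then show ?thesis
      using that Q by (auto simp: facets_def)
  qed
  ultimately have pure: "pure_asc n (ball_boundary (Suc n) B)"
    using nonempty unfolding pure_asc_def asc_def by blast
  have eq: "ab_index (face_poset (ball_boundary (Suc n) B)) = (\<Sum>j<length Fs. gluing_ab (Suc n) (card (R j)))"
    unfolding ab_index_face_poset[OF pure] sum_boundary_face_terms[symmetric] by (simp add: bd)
  \<comment> \<open>Gluing along all n + 2 ridges is not excluded here; \<open>gluing_ab_le\<close>
    covers that value too.\<close>
  have "1 \<le> card (R j) \<and> card (R j) \<le> Suc (Suc n)" if "0 < j" "j < length Fs" for j
  proof
    show "card (R j) \<le> Suc (Suc n)"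
      using card_mono[OF finite_F[OF that(2)] R_subset[OF that(2)]] card_F[OF that(2)] by simp
    show "1 \<le> card (R j)"
      using R(3)[OF that] finite_subset[OF R_subset finite_F] that(2)
      by (simp add: Suc_le_eq card_gt_0_iff)
  qed
  then show ?thesis
    using that[of "\<lambda>j. card (R j)"] R(2) eq unfolding k by simp
qed


subsection \<open>Ridges of a simplicial ball\<close>

lemma realization_eq_top_of_set:
  "realization K = top_of_set {x. (\<forall>v. 0 \<le> x v) \<and> {v. x v \<noteq> 0} \<in> K \<and> (\<Sum>v | x v \<noteq> 0. x v) = 1}"
  by (simp add: realization_def euclidean_product_topology)

lemma Euclidean_space_eq_top_of_set: "Euclidean_space n = top_of_set {x. \<forall>i\<ge>n. x i = 0}"
  by (simp add: Euclidean_space_def euclidean_product_topology)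

text \<open>
  If three facets shared the ridge \<open>Q\<close>, then two of them would contain a copy of an open subset of
  \<open>\<real>\<^sup>d\<close> around an interior point of \<open>Q\<close>.  By invariance of domain this copy is open in the ball,
  although the third facet accumulates at that point.
\<close>

lemma simplicial_ball_no_three_facets:
  fixes B :: "'v set set"
  assumes ball: "simplicial_ball d B" and d: "1 \<le> d" and Q: "card Q = d"
    and xyz: "insert x Q \<in> B" "insert y Q \<in> B" "insert z Q \<in> B" "x \<notin> Q" "y \<notin> Q" "z \<notin> Q"
    and neq: "x \<noteq> y" "x \<noteq> z" "y \<noteq> z"
  shows False
proof -
  define S where "S = {p :: 'v \<Rightarrow> real. (\<forall>v. 0 \<le> p v) \<and> {v. p v \<noteq> 0} \<in> B \<and> (\<Sum>v | p v \<noteq> 0. p v) = 1}"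
  define V where "V = {t :: nat \<Rightarrow> real. \<forall>i\<ge>d. t i = 0}"
  have asc: "\<And>G H. G \<in> B \<Longrightarrow> H \<subseteq> G \<Longrightarrow> H \<in> B"
    using ball by (auto simp: simplicial_ball_def asc_def)
  have finQ: "finite Q"
    using Q d by (metis card.infinite not_one_le_zero)
  have in_S: "p \<in> S" if "\<And>v. 0 \<le> p v" "\<And>v. v \<notin> G \<Longrightarrow> p v = 0" "G \<in> B" "finite G" "sum p G = 1" for p G
  proof -
    have "{v. p v \<noteq> 0} \<subseteq> G"
      using that(2) by blast
    moreover from this have "(\<Sum>v | p v \<noteq> 0. p v) = sum p G"
      using that(4) by (intro sum.mono_neutral_left) auto
    ultimately show ?thesis
      using that asc by (simp add: S_def)
  qed
  obtain h where h: "continuous_on S h" "h \<in> S \<rightarrow> V" "inj_on h S"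
  proof -
    obtain h h' where "homeomorphic_maps (realization B) (nball d) h h'"
      using ball by (auto simp: simplicial_ball_def homeomorphic_space_def)
    moreover have "realization B = top_of_set S"
      by (simp add: realization_eq_top_of_set S_def)
    moreover have "nball d = top_of_set (V \<inter> {x. (\<Sum>i<d. x i ^ 2) \<le> 1})"
      by (simp add: nball_def Euclidean_space_eq_top_of_set V_def subtopology_subtopology)
    ultimately have "continuous_map (top_of_set S) (top_of_set (V \<inter> {x. (\<Sum>i<d. x i ^ 2) \<le> 1})) h"
      "\<forall>p\<in>S. h' (h p) = p"
      by (auto simp: homeomorphic_maps_def)
    then show ?thesis
      by (intro that[of h]) (auto simp: continuous_map_in_subtopology intro: inj_on_inverseI)
  qed
  obtain \<beta> where \<beta>: "bij_betw \<beta> {0..<d} Q"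
    using ex_bij_betw_nat_finite[OF finQ] Q by auto
  define \<iota> where "\<iota> = inv_into {0..<d} \<beta>"
  have \<iota>: "\<iota> (\<beta> i) = i" if "i < d" for i
    using \<beta> that by (simp add: \<iota>_def bij_betw_inv_into_left)
  have \<beta>Q: "\<beta> i \<in> Q" if "i < d" for i
    using \<beta> that bij_betwE by fastforce
  \<comment> \<open>A chart around the interior of Q: the signed coordinate \<open>t 0\<close> is
    the weight of x or, if negative, of y. The other coordinates are weights of vertices of Q, and
    \<beta> 0 takes the remainder.\<close>
  define g where "g t v = (if v = x then max (t 0) 0 else if v = y then max (- t 0) 0
      else if v = \<beta> 0 then 1 - \<bar>t 0\<bar> - (\<Sum>i\<in>{1..<d}. t i) else if v \<in> Q then t (\<iota> v) else 0)"
    for t :: "nat \<Rightarrow> real" and v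
  have g_x: "g t x = max (t 0) 0" and g_y: "g t y = max (- t 0) 0" for t
    using neq by (auto simp: g_def)
  have g_0: "g t (\<beta> 0) = 1 - \<bar>t 0\<bar> - (\<Sum>i\<in>{1..<d}. t i)" for t
    using \<beta>Q[of 0] d xyz by (auto simp: g_def)
  have g_i: "g t (\<beta> i) = t i" if "i \<in> {1..<d}" for t i
  proof -
    have "\<beta> i \<noteq> \<beta> 0"
      using \<iota>[of i] \<iota>[of 0] that d by force
    then show ?thesis
      using \<beta>Q[of i] \<iota>[of i] that xyz by (auto simp: g_def)
  qed
  have g_out: "g t v = 0" if "v \<notin> insert x (insert y Q)" for t v
    using that \<beta>Q[of 0] d by (auto simp: g_def)
  have sum_Q: "sum (g t) Q = 1 - \<bar>t 0\<bar>" for t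
  proof -
    have "sum (g t) Q = (\<Sum>i\<in>{0..<d}. g t (\<beta> i))"
      by (rule sum.reindex_bij_betw[OF \<beta>, symmetric])
    also have "\<dots> = g t (\<beta> 0) + (\<Sum>i\<in>{1..<d}. g t (\<beta> i))"
      using d by (simp add: sum.atLeast_Suc_lessThan)
    also have "(\<Sum>i\<in>{1..<d}. g t (\<beta> i)) = (\<Sum>i\<in>{1..<d}. t i)"
      by (rule sum.cong[OF refl g_i])
    finally show ?thesis
      by (simp add: g_0)
  qed
  define U where "U = V \<inter> ((\<Inter>i\<in>{1..<d}. {t. 0 < t i}) \<inter> {t. \<bar>t 0\<bar> + (\<Sum>i\<in>{1..<d}. t i) < 1})"
  have cont_coord: "continuous_on A (\<lambda>t :: nat \<Rightarrow> real. t i)" for A i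
    by (rule continuous_on_subset[OF continuous_on_product_coordinates]) simp
  have "openin (top_of_set V) U"
    unfolding U_def
    by (intro openin_open_Int open_Int open_INT open_Collect_less ballI finite_atLeastLessThan
        continuous_on_const continuous_on_add continuous_on_rabs continuous_on_sum cont_coord)
  then have U: "openin (Euclidean_space d) U"
    by (simp add: Euclidean_space_eq_top_of_set V_def)
  have g_S: "g t \<in> S" if t: "t \<in> U" for t
  proof -
    have pos: "0 \<le> g t v" for v
    proof (cases "v \<in> Q")
      case True
      then obtain i where "i < d" "v = \<beta> i"
        using \<beta> by (metis atLeastLessThan_iff bij_betw_imp_surj_on imageE)
      then show ?thesis
        using t g_0[of t] g_i[of i t] by (cases "i = 0") (auto simp: U_def less_imp_le)
    next
      case False
      then show ?thesis
        using g_out[of v t] g_x[of t] g_y[of t] by (cases "v = x"; cases "v = y") auto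
    qed
    show ?thesis
    proof (cases "0 \<le> t 0")
      case True
      have "g t v = 0" if "v \<notin> insert x Q" for v
        using that g_out[of v t] g_y[of t] True by (cases "v = y") auto
      then show ?thesis
        using True finQ xyz pos sum_Q[of t] g_x[of t] by (intro in_S[of _ "insert x Q"]) auto
    next
      case False
      have "g t v = 0" if "v \<notin> insert y Q" for v
        using that g_out[of v t] g_x[of t] False by (cases "v = x") auto
      then show ?thesis
        using False finQ xyz pos sum_Q[of t] g_y[of t] by (intro in_S[of _ "insert y Q"]) auto
    qed
  qed
  have g_inj: "inj_on g U"
  proof (rule inj_onI, rule ext)
    fix s t i
    assume st: "s \<in> U" "t \<in> U" "g s = g t"
    have "s 0 = t 0"
      using g_x[of s] g_x[of t] g_y[of s] g_y[of t] st(3) by (auto simp: max_def split: if_splits)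
    moreover have "s i = t i" if "i \<in> {1..<d}"
      using g_i[OF that] st(3) by metis
    moreover have "s i = t i" if "d \<le> i"
      using st that by (simp add: U_def V_def)
    ultimately show "s i = t i"
      by (cases "i = 0"; cases "i < d") auto
  qed
  have g_cont: "continuous_on U g"
  proof (rule continuous_on_coordinatewise_then_product)
    fix v
    show "continuous_on U (\<lambda>t. g t v)"
      unfolding g_def
      by (cases "v = x"; cases "v = y"; cases "v = \<beta> 0"; cases "v \<in> Q")
        (simp_all, (intro continuous_on_const continuous_on_diff continuous_on_minus continuous_on_max
          continuous_on_rabs continuous_on_sum cont_coord)+)
  qed
  have "openin (Euclidean_space d) ((h \<circ> g) ` U)"
  proof (rule invariance_of_domain_Euclidean_space[OF U])
    have UV: "U \<subseteq> V"
      by (auto simp: U_def)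
    have "continuous_on U (h \<circ> g)"
      using g_cont h(1) g_S by (intro continuous_on_compose) (auto intro: continuous_on_subset)
    then show "continuous_map (subtopology (Euclidean_space d) U) (Euclidean_space d) (h \<circ> g)"
      using UV g_S h(2)
      by (auto simp: Euclidean_space_eq_top_of_set V_def[symmetric] subtopology_subtopology
          continuous_map_in_subtopology Int_absorb1)
    show "inj_on (h \<circ> g) U"
      using g_inj h(3) g_S by (intro comp_inj_on) (auto intro: inj_on_subset)
  qed
  then have W: "openin (top_of_set V) ((h \<circ> g) ` U)"
    by (simp add: Euclidean_space_eq_top_of_set V_def)
  \<comment> \<open>The segment from the barycentre of Q, at s = 0, to the vertex z, at s =
    1.\<close>
  define c where "c s v = (if v = z then s else if v \<in> Q then (1 - s) / d else 0)" for s :: real and v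
  have c_S: "c s \<in> S" if "s \<in> {0..1}" for s
  proof (rule in_S[of _ "insert z Q"])
    show "0 \<le> c s v" for v
      using that by (simp add: c_def)
    have "sum (c s) Q = (\<Sum>v\<in>Q. (1 - s) / d)"
      using xyz by (intro sum.cong) (auto simp: c_def)
    then show "sum (c s) (insert z Q) = 1"
      using xyz finQ Q d by (simp add: c_def)
  qed (use xyz finQ in \<open>auto simp: c_def\<close>)
  have "continuous_on {0..1} c"
  proof (rule continuous_on_coordinatewise_then_product)
    fix v
    show "continuous_on {0..1} (\<lambda>s. c s v)"
      unfolding c_def using d by (cases "v = z"; cases "v \<in> Q") (auto intro!: continuous_intros)
  qed
  then have "continuous_on {0..1} (h \<circ> c)"
    using c_S h(1) by (intro continuous_on_compose) (auto intro: continuous_on_subset)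
  then have "openin (top_of_set {0..1}) ({0..1} \<inter> (h \<circ> c) -` ((h \<circ> g) ` U))"
    using W c_S h(2) by (intro continuous_openin_preimage[of _ _ V]) auto
  then obtain A where A: "open A" "{0..1} \<inter> (h \<circ> c) -` ((h \<circ> g) ` U) = {0..1} \<inter> A"
    by (auto simp: openin_open)
  have "0 \<in> A"
  proof -
    \<comment> \<open>Chart coordinates of the barycentre of Q; the remainder left for \<beta> 0 is
      again 1/d.\<close>
    define t where "t i = (if i \<in> {1..<d} then 1 / d else 0 :: real)" for i
    have "(\<Sum>i\<in>{1..<d}. t i) = real (d - 1) / d"
      by (simp add: t_def)
    moreover have "real (d - 1) / d < 1"
      using d by simp
    ultimately have "t \<in> U"
      by (auto simp: U_def V_def t_def)
    moreover have "g t = c 0"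
    proof
      fix v
      show "g t v = c 0 v"
      proof (cases "v \<in> Q")
        case True
        then obtain i where i: "i < d" "v = \<beta> i"
          using \<beta> by (metis atLeastLessThan_iff bij_betw_imp_surj_on imageE)
        have "g t (\<beta> 0) = 1 / d"
          using d by (simp add: g_0) (simp add: t_def field_simps of_nat_diff)
        moreover have "g t (\<beta> i) = 1 / d" if "i \<noteq> 0"
          using g_i[of i t] i that by (simp add: t_def)
        ultimately show ?thesis
          using i True xyz by (cases "i = 0") (auto simp: c_def)
      next
        case False
        then show ?thesis
          using g_out[of v t] g_x[of t] g_y[of t] neq
          by (cases "v = x"; cases "v = y") (auto simp: c_def t_def)
      qed
    qed
    ultimately have "0 \<in> {0..1} \<inter> (h \<circ> c) -` ((h \<circ> g) ` U)"
      by force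
    then show ?thesis
      using A by blast
  qed
  then obtain e where e: "0 < e" "ball 0 e \<subseteq> A"
    using A(1) open_contains_ball by blast
  \<comment> \<open>Positive, so that z has weight in \<open>c s\<close>, yet small enough that
    \<open>c s\<close> lies in the image of the chart, where z has weight 0.\<close>
  define s where "s = min 1 (e / 2)"
  have s: "0 < s" "s \<le> 1" "s < e"
    using e by (auto simp: s_def)
  then have "s \<in> {0..1} \<inter> A"
    using e by (auto simp: dist_norm)
  then have "s \<in> {0..1} \<inter> (h \<circ> c) -` ((h \<circ> g) ` U)"
    using A(2) by simp
  then obtain t where t: "t \<in> U" "h (c s) = h (g t)"
    by auto
  then have "c s = g t"
    using h(3) c_S[of s] g_S[of t] s by (auto dest: inj_onD)
  moreover have "g t z = 0"
    using g_out[of z t] xyz neq by auto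
  ultimately have "c s z = 0"
    by simp
  then show False
    using s by (simp add: c_def)
qed

lemma simplicial_ball_ridge_le_2:
  assumes ball: "simplicial_ball d B" and d: "1 \<le> d" and pure: "pure_asc d B" and Q: "card Q = d"
  shows "card {F\<in>facets B. Q \<subseteq> F} \<le> 2"
proof (rule ccontr)
  assume "\<not> ?thesis"
  then have "3 \<le> card {F\<in>facets B. Q \<subseteq> F}"
    by simp
  then obtain T where T: "T \<subseteq> {F\<in>facets B. Q \<subseteq> F}" "card T = 3"
    by (metis obtain_subset_with_card_n)
  then obtain F1 F2 F3 where F: "T = {F1, F2, F3}" "F1 \<noteq> F2" "F1 \<noteq> F3" "F2 \<noteq> F3"
    by (auto simp: card_3_iff)
  have finQ: "finite Q"
    using Q d by (metis card.infinite not_one_le_zero)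
  have *: "\<exists>v. v \<notin> Q \<and> insert v Q = F" if "F \<in> T" for F
  proof -
    have "card F = Suc d" "Q \<subseteq> F"
      using T that pure by (auto simp: pure_asc_def)
    then have "card (F - Q) = 1"
      using Q finQ by (simp add: card_Diff_subset)
    then obtain v where "F - Q = {v}"
      by (auto simp: card_1_singleton_iff)
    then show ?thesis
      using \<open>Q \<subseteq> F\<close> by blast
  qed
  obtain x y z where "x \<notin> Q" "insert x Q = F1" "y \<notin> Q" "insert y Q = F2" "z \<notin> Q" "insert z Q = F3"
    using *[of F1] *[of F2] *[of F3] F(1) by auto
  moreover have "F1 \<in> B" "F2 \<in> B" "F3 \<in> B"
    using T F(1) by (auto simp: facets_def)
  ultimately show False
    using simplicial_ball_no_three_facets[OF ball d Q, of x y z] F by auto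
qed


subsection \<open>Simplicial complexes covering a convex set\<close>

text \<open>If p in C lies in A only and q in C lies outside A, the segment from p to q without p
  avoids A. By induction it lies in one of the other sets, and the line through it brings p back
  into that set.\<close>

lemma convex_subset_Union_affine:
  assumes "finite \<A>" "\<And>A. A \<in> \<A> \<Longrightarrow> affine A" "convex C" "C \<noteq> {}" "C \<subseteq> \<Union>\<A>"
  shows "\<exists>A\<in>\<A>. C \<subseteq> A"
  using assms
proof (induction \<A> arbitrary: C rule: finite_induct)
  case (insert A \<A>)
  show ?case
  proof (rule ccontr)
    assume not: "\<not> (\<exists>A\<in>insert A \<A>. C \<subseteq> A)"
    then have "\<not> C \<subseteq> \<Union>\<A>"
      using insert.IH[OF _ insert.prems(2,3)] insert.prems(1) by auto
    then obtain p where p: "p \<in> C" "p \<notin> \<Union>\<A>"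
      by blast
    then have "p \<in> A"
      using insert.prems(4) by blast
    obtain q where q: "q \<in> C" "q \<notin> A"
      using not by blast
    define D where "D = (\<lambda>t. p + t *\<^sub>R (q - p)) ` {0<..1}"
    have line: "p + t *\<^sub>R (q - p) = (1 - t) *\<^sub>R p + t *\<^sub>R q" for t
      by (simp add: algebra_simps)
    have "D \<subseteq> C"
      unfolding D_def line using insert.prems(2) p q by (auto simp: convex_alt)
    moreover have "D \<inter> A = {}"
    proof (rule ccontr)
      assume "D \<inter> A \<noteq> {}"
      then obtain t where t: "0 < t" "p + t *\<^sub>R (q - p) \<in> A"
        by (auto simp: D_def)
      have "(1 - 1 / t) *\<^sub>R p + (1 / t) *\<^sub>R (p + t *\<^sub>R (q - p)) \<in> A"
        using insert.prems(1)[of A] t \<open>p \<in> A\<close> unfolding affine_alt by blast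
      moreover have "(1 - 1 / t) *\<^sub>R p + (1 / t) *\<^sub>R (p + t *\<^sub>R (q - p)) = q"
        using t by (simp add: algebra_simps)
      ultimately show False
        using q by simp
    qed
    ultimately have "D \<subseteq> \<Union>\<A>"
      using insert.prems(4) by blast
    moreover have "convex D"
    proof -
      have "D = (+) p ` (\<lambda>t. t *\<^sub>R (q - p)) ` {0<..1}"
        by (simp add: D_def image_image)
      moreover have "linear (\<lambda>t. t *\<^sub>R (q - p))"
        by (rule linearI) (simp_all add: scaleR_add_left)
      ultimately show ?thesis
        by (simp add: convex_translation convex_linear_image)
    qed
    moreover have "D \<noteq> {}"
      by (auto simp: D_def)
    ultimately obtain A' where A': "A' \<in> \<A>" "D \<subseteq> A'"
      using insert.IH insert.prems(1) by blast
    have "p + 1 *\<^sub>R (q - p) \<in> D" "p + (1 / 2) *\<^sub>R (q - p) \<in> D"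
      unfolding D_def by (rule imageI, simp)+
    then have "q \<in> D" "p + (1 / 2) *\<^sub>R (q - p) \<in> D"
      by simp_all
    then have "(1 - 2) *\<^sub>R q + 2 *\<^sub>R (p + (1 / 2) *\<^sub>R (q - p)) \<in> A'"
      using A' insert.prems(1)[of A'] unfolding affine_alt by blast
    moreover have "(1 - 2) *\<^sub>R q + 2 *\<^sub>R (p + (1 / 2) *\<^sub>R (q - p)) = p"
      by (simp add: algebra_simps scaleR_2)
    ultimately show False
      using p A' by auto
  qed
qed auto

text \<open>Otherwise the part of the segment inside S would be both open and closed in the segment,
  against connectedness.\<close>

lemma segment_meets_rel_boundary:
  fixes S :: "'e::euclidean_space set"
  assumes "closed S" "y \<in> rel_interior S" "z \<in> affine hull S" "z \<notin> S"
  obtains w where "w \<in> open_segment y z" "w \<in> S" "w \<notin> rel_interior S"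
proof (rule ccontr)
  let ?T = "closed_segment y z"
  note found = that
  assume "\<not> thesis"
  then have none: "w \<in> rel_interior S" if "w \<in> open_segment y z" "w \<in> S" for w
    using found that by blast
  have eq: "?T \<inter> S = ?T \<inter> rel_interior S"
    using none assms rel_interior_subset by (auto simp: open_segment_def)
  have "y \<in> affine hull S"
    using subsetD[OF rel_interior_subset assms(2)] by (rule hull_inc)
  then have "?T \<subseteq> affine hull S"
    using assms(3) by (meson affine_affine_hull affine_imp_convex closed_segment_subset)
  then have "openin (top_of_set ?T) (?T \<inter> rel_interior S)"
  proof -
    obtain U where "open U" "rel_interior S = affine hull S \<inter> U"
      using openin_rel_interior[of S] by (auto simp: openin_open)
    then show ?thesis
      using \<open>?T \<subseteq> affine hull S\<close> by (auto simp: openin_open)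
  qed
  moreover have "closedin (top_of_set ?T) (?T \<inter> S)"
    using assms(1) by (simp add: closedin_closed_Int)
  ultimately have "?T \<inter> S = {} \<or> ?T \<inter> S = ?T"
    using eq connected_clopen[of ?T] connected_segment(1) by metis
  moreover have "y \<in> ?T \<inter> S" "z \<in> ?T"
    using assms(2) rel_interior_subset by auto
  ultimately show False
    using assms(4) by blast
qed

lemma affine_hull_eqI:
  fixes S T :: "'e::euclidean_space set"
  assumes "S \<subseteq> T" "aff_dim S = aff_dim T" "S \<noteq> {}"
  shows "affine hull S = affine hull T"
  using assms by (intro affine_dim_equal) (auto simp: hull_mono)

text \<open>Near a point missed by the full-dimensional simplices, P would be covered by finitely
  many smaller affine hulls, hence lie in one of them. A relative interior point of T then puts T
  into some full-dimensional S, as T \<inter> S is a face of T.\<close>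

lemma simplicial_complex_pure:
  fixes P :: "'e::euclidean_space set"
  assumes T: "simplicial_complex \<T>" "\<Union>\<T> = P" and P: "convex P" "P \<noteq> {}" and "T \<in> \<T>"
  shows "\<exists>S\<in>\<T>. aff_dim S = aff_dim P \<and> T \<subseteq> S"
proof -
  have fin: "finite \<T>"
    using T by (simp add: simplicial_complex_def)
  have closed: "closed S" if "S \<in> \<T>" for S
    using T(1) that closed_simplex unfolding simplicial_complex_def by blast
  define D where "D = \<Union>{S\<in>\<T>. aff_dim S = aff_dim P}"
  have le: "aff_dim S \<le> aff_dim P" if "S \<in> \<T>" for S
    using T that by (intro aff_dim_subset) auto
  have "P \<subseteq> D"
  proof (rule ccontr)
    assume "\<not> P \<subseteq> D"
    then obtain p where p: "p \<in> P" "p \<notin> D"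
      by blast
    have "open (- D)"
      using fin closed by (auto simp: D_def intro!: closed_Union)
    then obtain e where e: "0 < e" "ball p e \<subseteq> - D"
      using p(2) open_contains_ball by blast
    have dim: "aff_dim (P \<inter> ball p e) = aff_dim P"
      using p P(1) e(1) by (intro aff_dim_convex_Int_open) auto
    let ?\<A> = "(\<lambda>S. affine hull S) ` {S\<in>\<T>. aff_dim S < aff_dim P}"
    have "P \<inter> ball p e \<subseteq> \<Union>?\<A>"
    proof
      fix x
      assume x: "x \<in> P \<inter> ball p e"
      then obtain S where S: "S \<in> \<T>" "x \<in> S"
        using T(2) by blast
      have "aff_dim S \<noteq> aff_dim P"
        using x e S by (auto simp: D_def)
      then show "x \<in> \<Union>?\<A>"
        using S le[OF S(1)] by (auto intro!: bexI[of _ S] hull_inc)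
    qed
    moreover have "convex (P \<inter> ball p e)" "P \<inter> ball p e \<noteq> {}"
      using P(1) p e(1) by (auto intro: convex_Int)
    ultimately have "\<exists>A\<in>?\<A>. P \<inter> ball p e \<subseteq> A"
      using fin by (intro convex_subset_Union_affine) auto
    then obtain S where "aff_dim S < aff_dim P" "P \<inter> ball p e \<subseteq> affine hull S"
      by auto
    then have "aff_dim (P \<inter> ball p e) \<le> aff_dim S"
      by (metis aff_dim_affine_hull aff_dim_subset)
    then show False
      using dim \<open>aff_dim S < aff_dim P\<close> by simp
  qed
  show ?thesis
  proof (cases "T = {}")
    case True
    then show ?thesis
      using \<open>P \<subseteq> D\<close> P(2) by (auto simp: D_def)
  next
    case False
    have "convex T"
      using T(1) \<open>T \<in> \<T>\<close> convex_simplex unfolding simplicial_complex_def by blast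
    then obtain x where x: "x \<in> rel_interior T"
      using False rel_interior_eq_empty by blast
    then have "x \<in> P"
      using T(2) \<open>T \<in> \<T>\<close> rel_interior_subset by blast
    then obtain S where S: "S \<in> \<T>" "aff_dim S = aff_dim P" "x \<in> S"
      using \<open>P \<subseteq> D\<close> by (auto simp: D_def)
    have "T \<inter> S face_of T"
      using T(1) \<open>T \<in> \<T>\<close> S(1) face_of_subset[of "T \<inter> S" T T] by (auto simp: simplicial_complex_def)
    moreover have "x \<in> (T \<inter> S) \<inter> rel_interior T"
      using x S(3) subsetD[OF rel_interior_subset x] by simp
    ultimately have "T \<subseteq> T \<inter> S"
      using subset_of_face_of[of "T \<inter> S" T T] by blast
    then show ?thesis
      using S by blast
  qed
qed

text \<open>Indexed by the number of vertices, as in \<open>face_term\<close>.\<close>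

definition dim_faces :: "'e::euclidean_space set set \<Rightarrow> nat \<Rightarrow> 'e set set"
  where "dim_faces \<T> i = {T\<in>\<T>. aff_dim T = int i - 1}"

lemma card_simplex_dim_faces:
  assumes "(int n - 1) simplex S"
  shows "card (dim_faces {T. T face_of S} i) = n choose i"
proof -
  obtain C where C: "\<not> affine_dependent C" "card C = n" "S = convex hull C"
    using assms by (auto simp: simplex_def)
  have sub: "\<not> affine_dependent c" if "c \<subseteq> C" for c
    using C(1) that affine_dependent_subset by blast
  have ext: "{v. v extreme_point_of convex hull c} = c" if "c \<subseteq> C" for c
    using extreme_point_of_convex_hull_affine_independent[OF sub[OF that]] by auto
  have inj: "inj_on (\<lambda>c. convex hull c) {c. c \<subseteq> C \<and> card c = i}"
    by (rule inj_on_inverseI[of _ "\<lambda>F. {v. v extreme_point_of F}"]) (simp add: ext)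
  have dim: "aff_dim (convex hull c) = int i - 1 \<longleftrightarrow> card c = i" if "c \<subseteq> C" for c
    using aff_dim_affine_independent[OF sub[OF that]] by (auto simp: aff_dim_convex_hull)
  have img: "(\<lambda>c. convex hull c) ` {c. c \<subseteq> C \<and> card c = i} = dim_faces {T. T face_of S} i"
  proof (intro equalityI subsetI)
    fix T
    assume "T \<in> dim_faces {T. T face_of S} i"
    then have "T face_of S" "aff_dim T = int i - 1"
      by (auto simp: dim_faces_def)
    moreover from this obtain c where "c \<subseteq> C" "T = convex hull c"
      using face_of_convex_hull_affine_independent[OF C(1)] C(3) by blast
    ultimately show "T \<in> (\<lambda>c. convex hull c) ` {c. c \<subseteq> C \<and> card c = i}"
      using dim[of c] by blast
  next
    fix T
    assume "T \<in> (\<lambda>c. convex hull c) ` {c. c \<subseteq> C \<and> card c = i}"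
    then obtain c where "c \<subseteq> C" "card c = i" "T = convex hull c"
      by blast
    then show "T \<in> dim_faces {T. T face_of S} i"
      using face_of_convex_hull_affine_independent[OF C(1)] C(3) dim[of c] unfolding dim_faces_def by blast
  qed
  have "card (dim_faces {T. T face_of S} i) = card {c. c \<subseteq> C \<and> card c = i}"
    using card_image[OF inj] unfolding img .
  then show ?thesis
    using C aff_independent_finite n_subsets by metis
qed


subsection \<open>Stack subdivisions\<close>

text \<open>
  The induction over the number of simplices cuts along an interior ridge, so it runs over convex sets
  with a subdivision whose faces of codimension at least two are faces of the set.
\<close>

definition stacked_complex :: "nat \<Rightarrow> 'e::euclidean_space set \<Rightarrow> 'e set set \<Rightarrow> bool"
  where "stacked_complex d P \<T> \<longleftrightarrow> simplicial_complex \<T> \<and> \<Union>\<T> = P \<and> convex P \<and> aff_dim P = int d \<and>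
    (\<forall>T\<in>\<T>. aff_dim T \<le> int d - 2 \<longrightarrow> T face_of P)"

lemma stacked_complexD:
  assumes "stacked_complex d P \<T>"
  shows "simplicial_complex \<T>" "\<Union>\<T> = P" "convex P" "aff_dim P = int d" "P \<noteq> {}" "closed P" "finite \<T>"
    "\<And>T. T \<in> \<T> \<Longrightarrow> aff_dim T \<le> int d - 2 \<Longrightarrow> T face_of P"
    "\<And>T. T \<in> \<T> \<Longrightarrow> T \<subseteq> P"
    "\<And>T. T \<in> \<T> \<Longrightarrow> convex T"
    "\<And>T. T \<in> \<T> \<Longrightarrow> closed T"
    "\<And>T. T \<in> \<T> \<Longrightarrow> aff_dim T simplex T"
    "\<And>T S. T \<in> \<T> \<Longrightarrow> S face_of T \<Longrightarrow> S \<in> \<T>"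
    "\<And>T S. T \<in> \<T> \<Longrightarrow> S \<in> \<T> \<Longrightarrow> T \<inter> S face_of T"
proof -
  show *: "simplicial_complex \<T>" "\<Union>\<T> = P" "convex P" "aff_dim P = int d" "finite \<T>"
    "\<And>T. T \<in> \<T> \<Longrightarrow> aff_dim T \<le> int d - 2 \<Longrightarrow> T face_of P"
    using assms by (auto simp: stacked_complex_def simplicial_complex_def)
  show "P \<noteq> {}"
    using *(4) aff_dim_empty[of P] by auto
  show simplex: "aff_dim T simplex T" if "T \<in> \<T>" for T
    using *(1) that aff_dim_simplex unfolding simplicial_complex_def by metis
  show "T \<subseteq> P" if "T \<in> \<T>" for T
    using *(2) that by blast
  show "convex T" if "T \<in> \<T>" for T
    using simplex[OF that] convex_simplex by blast
  show closed: "closed T" if "T \<in> \<T>" for T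
    using simplex[OF that] closed_simplex by blast
  show "closed P"
    using *(2,5) closed by (auto intro: closed_Union)
  show "S \<in> \<T>" if "T \<in> \<T>" "S face_of T" for S T
    using *(1) that by (auto simp: simplicial_complex_def)
  show "T \<inter> S face_of T" if "T \<in> \<T>" "S \<in> \<T>" for S T
    using *(1) that by (auto simp: simplicial_complex_def)
qed

lemma in_rel_frontier_iff:
  assumes "closed P" "T \<subseteq> P"
  shows "T \<subseteq> rel_frontier P \<longleftrightarrow> T \<inter> rel_interior P = {}"
  using assms by (auto simp: rel_frontier_def)

text \<open>If a ridge other than Q meets the relative interior of P, moving inside it into the open
  half-space reaches the relative interior of P1. So cutting changes the status of Q alone. The
  point p makes the half full-dimensional.\<close>

lemma stacked_complex_halfspace:
  assumes st: "stacked_complex d P \<T>" and Q: "Q \<in> \<T>" "aff_dim Q = int d - 1"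
    and hyp: "P \<inter> {x. a \<bullet> x = b} = Q"
    and side: "\<And>T. T \<in> \<T> \<Longrightarrow> T \<subseteq> {x. a \<bullet> x \<le> b} \<or> T \<subseteq> {x. b \<le> a \<bullet> x}"
    and p: "p \<in> P" "a \<bullet> p < b"
  defines "P1 \<equiv> P \<inter> {x. a \<bullet> x \<le> b}" and "\<T>1 \<equiv> {T\<in>\<T>. T \<subseteq> {x. a \<bullet> x \<le> b}}"
  shows "stacked_complex d P1 \<T>1"
    and "\<And>T. T \<in> \<T>1 \<Longrightarrow> aff_dim T = int d - 1 \<Longrightarrow> T \<noteq> Q \<Longrightarrow> T \<subseteq> rel_frontier P1 \<longleftrightarrow> T \<subseteq> rel_frontier P"
    and "Q \<subseteq> rel_frontier P1"
proof -
  note st' = stacked_complexD[OF st]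
  have QH: "Q \<subseteq> {x. a \<bullet> x = b}" "Q \<subseteq> P1"
    using hyp by (auto simp: P1_def)
  have dimP1: "aff_dim P1 = int d"
  proof (rule antisym)
    show "aff_dim P1 \<le> int d"
      using aff_dim_subset[of P1 P] st'(4) by (simp add: P1_def)
    have "affine hull Q \<subseteq> {x. a \<bullet> x = b}"
      using QH(1) by (intro hull_minimal affine_hyperplane)
    then have "p \<notin> affine hull Q"
      using p(2) by auto
    then have "aff_dim (insert p Q) = int d"
      using Q(2) by (simp add: aff_dim_insert)
    moreover have "insert p Q \<subseteq> P1"
      using p QH(2) by (auto simp: P1_def)
    ultimately show "int d \<le> aff_dim P1"
      using aff_dim_subset by metis
  qed
  have sub: "P1 \<subseteq> P" "closed P1" "convex P1"
    using st' by (auto simp: P1_def closed_halfspace_le closed_Int convex_Int convex_halfspace_le)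
  have "P1 \<noteq> {}"
    using p by (auto simp: P1_def)
  then have aff: "affine hull P1 = affine hull P"
    using sub dimP1 st'(4) by (intro affine_hull_eqI) auto
  have "\<Union>\<T>1 = P1"
  proof (intro equalityI subsetI)
    fix x
    assume x: "x \<in> P1"
    then obtain T where T: "T \<in> \<T>" "x \<in> T"
      using st'(2) by (auto simp: P1_def)
    show "x \<in> \<Union>\<T>1"
    proof (cases "T \<subseteq> {x. a \<bullet> x \<le> b}")
      case False
      then have "a \<bullet> x = b"
        using side[OF T(1)] T(2) x by (auto simp: P1_def)
      then have "x \<in> Q"
        using hyp x by (auto simp: P1_def)
      then show ?thesis
        using Q(1) QH(1) by (auto simp: \<T>1_def)
    qed (use T in \<open>auto simp: \<T>1_def\<close>)
  qed (use st'(2) in \<open>auto simp: \<T>1_def P1_def\<close>)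
  moreover have "simplicial_complex \<T>1"
    unfolding simplicial_complex_def
  proof (intro conjI ballI allI impI)
    show "finite \<T>1"
      using st'(7) by (simp add: \<T>1_def)
    show "\<exists>n. n simplex S" if "S \<in> \<T>1" for S
      using st'(12) that by (auto simp: \<T>1_def)
    show "F \<in> \<T>1" if "S \<in> \<T>1 \<and> F face_of S" for F S
      using st'(13)[of S F] face_of_imp_subset[of F S] that by (auto simp: \<T>1_def)
    show "S \<inter> S' face_of S" if "S \<in> \<T>1 \<and> S' \<in> \<T>1" for S S'
      using st'(14)[of S S'] that by (auto simp: \<T>1_def)
  qed
  moreover have "T face_of P1" if "T \<in> \<T>1" "aff_dim T \<le> int d - 2" for T
    using that st'(8)[of T] sub(1) st'(2) \<open>\<Union>\<T>1 = P1\<close>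
    by (intro face_of_subset[of T P P1]) (auto simp: \<T>1_def)
  ultimately show "stacked_complex d P1 \<T>1"
    using sub dimP1 by (auto simp: stacked_complex_def)
  show "T \<subseteq> rel_frontier P1 \<longleftrightarrow> T \<subseteq> rel_frontier P"
    if T: "T \<in> \<T>1" "aff_dim T = int d - 1" "T \<noteq> Q" for T
  proof -
    have TT: "T \<in> \<T>" "T \<subseteq> P1" "T \<subseteq> P"
      using T(1) \<open>\<Union>\<T>1 = P1\<close> st'(9) by (auto simp: \<T>1_def)
    have "T \<inter> rel_interior P1 \<noteq> {}" if meets: "T \<inter> rel_interior P \<noteq> {}"
    proof -
      obtain y where y: "y \<in> T" "y \<in> rel_interior P"
        using meets by blast
      have "\<not> T \<subseteq> {x. a \<bullet> x = b}"
      proof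
        assume "T \<subseteq> {x. a \<bullet> x = b}"
        then have "T \<subseteq> Q"
          using hyp TT by blast
        then have "T face_of Q"
          using st'(14)[OF Q(1) TT(1)] by (simp add: Int_absorb1)
        then show False
          using face_of_aff_dim_lt[of Q T] st'(10)[OF Q(1)] T Q(2) by auto
      qed
      then obtain q where q: "q \<in> T" "a \<bullet> q < b"
        using TT(2) by (fastforce simp: P1_def)
      obtain w where w: "w \<in> T" "w \<in> rel_interior P" "a \<bullet> w < b"
      proof (cases "a \<bullet> y < b")
        case True
        then show ?thesis
          using that y by blast
      next
        case False
        define w where "w = midpoint y q"
        have "y \<noteq> q"
          using False q by auto
        then have "w \<in> open_segment y q"
          by (simp add: w_def)
        then have "w \<in> rel_interior P"
          using rel_interior_closure_convex_segment[OF st'(3) y(2), of q] q TT(3) closure_subset by blast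
        moreover have "w \<in> T"
          using \<open>w \<in> open_segment y q\<close> st'(10)[OF TT(1)] y(1) q(1)
          by (meson closed_segment_subset open_closed_segment subsetD)
        moreover have "a \<bullet> y \<le> b"
          using y(1) TT(2) by (auto simp: P1_def)
        then have "a \<bullet> w < b"
          using q(2) by (simp add: w_def midpoint_def inner_add_right)
        ultimately show ?thesis
          using that by blast
      qed
      obtain e where e: "0 < e" "ball w e \<inter> affine hull P \<subseteq> P"
        using w(2) by (auto simp: mem_rel_interior_ball)
      have "open {x. a \<bullet> x < b}"
        by (rule open_halfspace_lt)
      then obtain e' where e': "0 < e'" "ball w e' \<subseteq> {x. a \<bullet> x < b}"
        using w(3) unfolding open_contains_ball by blast
      have "ball w (min e e') \<inter> affine hull P1 \<subseteq> P1"
      proof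
        fix x
        assume "x \<in> ball w (min e e') \<inter> affine hull P1"
        then have "x \<in> ball w e \<inter> affine hull P" "x \<in> ball w e'"
          by (auto simp: aff)
        then show "x \<in> P1"
          using e(2) e'(2) unfolding P1_def by fastforce
      qed
      then have "w \<in> rel_interior P1"
        using e(1) e'(1) w(1) TT(2) unfolding mem_rel_interior_ball
        by (intro conjI exI[of _ "min e e'"]) auto
      then show ?thesis
        using w(1) by blast
    qed
    moreover have "rel_interior P1 \<subseteq> rel_interior P"
      using sub(1) aff by (rule subset_rel_interior)
    ultimately show ?thesis
      using in_rel_frontier_iff[OF sub(2) TT(2)] in_rel_frontier_iff[OF st'(6) TT(3)] by blast
  qed
  have "P1 \<inter> {x. a \<bullet> x = b} face_of P1"
    using sub(3) by (rule face_of_Int_supporting_hyperplane_le) (simp add: P1_def)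
  moreover have "P1 \<inter> {x. a \<bullet> x = b} = Q"
    using hyp by (auto simp: P1_def)
  moreover have "Q \<noteq> P1"
    using Q(2) dimP1 by auto
  ultimately show "Q \<subseteq> rel_frontier P1"
    by (simp add: face_of_subset_rel_frontier)
qed

text \<open>A segment from the interior of a simplex F to an interior point of P outside F leaves F
  through a facet Q. The relative boundary of Q lies in that of P, so the cut of P by the hyperplane
  of Q cannot extend beyond Q.\<close>

lemma stacked_complex_interior_ridge:
  assumes st: "stacked_complex d P \<T>" and two: "card (dim_faces \<T> (Suc d)) \<noteq> 1"
  obtains Q a b where "Q \<in> \<T>" "aff_dim Q = int d - 1" "P \<inter> {x. a \<bullet> x = b} = Q" "\<not> Q \<subseteq> rel_frontier P"
    "\<And>T. T \<in> \<T> \<Longrightarrow> T \<subseteq> {x. a \<bullet> x \<le> b} \<or> T \<subseteq> {x. b \<le> a \<bullet> x}"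
    "\<exists>p\<in>P. a \<bullet> p < b" "\<exists>p\<in>P. b < a \<bullet> p"
proof -
  note st' = stacked_complexD[OF st]
  obtain T0 where "T0 \<in> \<T>"
    using st'(2,5) by blast
  then obtain F where F: "F \<in> \<T>" "aff_dim F = int d"
    using simplicial_complex_pure[OF st'(1,2,3,5)] st'(4) by metis
  then have "F \<in> dim_faces \<T> (Suc d)"
    by (simp add: dim_faces_def)
  moreover have "dim_faces \<T> (Suc d) \<noteq> {F}"
    using two by auto
  ultimately obtain F' where F': "F' \<in> \<T>" "aff_dim F' = int d" "F' \<noteq> F"
    by (auto simp: dim_faces_def)
  have "\<not> F' \<subseteq> F"
  proof
    assume "F' \<subseteq> F"
    then have "F' face_of F"
      using st'(14)[OF F(1) F'(1)] by (simp add: Int_absorb1)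
    then show False
      using face_of_aff_dim_lt[of F F'] st'(10)[OF F(1)] F F' by auto
  qed
  then have "\<not> P \<subseteq> F"
    using st'(9)[OF F'(1)] by blast
  have "F \<noteq> {}"
    using F(2) aff_dim_empty[of F] by auto
  then have aff: "affine hull F = affine hull P"
    using F st'(4,9) by (intro affine_hull_eqI) auto
  have riF: "rel_interior F \<subseteq> rel_interior P"
    using st'(9)[OF F(1)] aff by (rule subset_rel_interior)
  obtain x where x: "x \<in> rel_interior F"
    using \<open>F \<noteq> {}\<close> st'(10)[OF F(1)] rel_interior_eq_empty by blast
  have "\<not> rel_interior P \<subseteq> F"
  proof
    assume "rel_interior P \<subseteq> F"
    then have "closure (rel_interior P) \<subseteq> F"
      using st'(11)[OF F(1)] by (simp add: closure_minimal)
    then show False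
      using convex_closure_rel_interior[OF st'(3)] st'(6) \<open>\<not> P \<subseteq> F\<close> by simp
  qed
  then obtain p where p: "p \<in> rel_interior P" "p \<notin> F"
    by blast
  have "p \<in> affine hull F"
    using p(1) rel_interior_subset hull_subset[of P affine] aff by fastforce
  then obtain y where y: "y \<in> open_segment x p" "y \<in> F" "y \<notin> rel_interior F"
    using segment_meets_rel_boundary[OF st'(11)[OF F(1)] x _ p(2)] by blast
  have yP: "y \<in> rel_interior P"
    using rel_interior_closure_convex_segment[OF st'(3), of x p] x riF p(1) y(1) rel_interior_subset
      closure_subset by blast
  have polyF: "polyhedron F"
    using st'(12)[OF F(1)] simplex_imp_polyhedron by blast
  have "y \<in> rel_frontier F"
    using y closure_subset by (auto simp: rel_frontier_def)
  then obtain Q where Q: "Q facet_of F" "y \<in> Q"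
    using rel_frontier_of_polyhedron[OF polyF] by blast
  then have QT: "Q \<in> \<T>" "aff_dim Q = int d - 1"
    using st'(13)[OF F(1)] F(2) by (auto simp: facet_of_def)
  obtain a b where ab: "F \<subseteq> {x. a \<bullet> x \<le> b}" "Q = F \<inter> {x. a \<bullet> x = b}"
    using facet_of_polyhedron[OF polyF Q(1)] by metis
  have notP: "\<not> F \<subseteq> {x. a \<bullet> x = b}"
    using ab(2) F(2) QT(2) by (metis Int_absorb2 diff_eq_eq add_cancel_right_right zero_neq_one)
  \<comment> \<open>The stacked condition enters here: the facets of Q have dimension d - 2, so they
    are faces of P and miss its relative interior.\<close>
  have low: "w \<notin> rel_interior P" if "w \<in> Q" "w \<notin> rel_interior Q" for w
  proof -
    have polyQ: "polyhedron Q"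
      using st'(12)[OF QT(1)] simplex_imp_polyhedron by blast
    have "w \<in> rel_frontier Q"
      using that closure_subset by (auto simp: rel_frontier_def)
    then obtain G where G: "G facet_of Q" "w \<in> G"
      using rel_frontier_of_polyhedron[OF polyQ] by blast
    then have "G face_of P" "aff_dim G = int d - 2"
      using st'(8)[of G] st'(13)[OF QT(1)] QT(2) by (auto simp: facet_of_def)
    then have "G \<inter> rel_interior P = {}"
      using face_of_disjoint_rel_interior[of G P] st'(4) by (cases "G = P") auto
    then show ?thesis
      using G(2) by blast
  qed
  have yQ: "y \<in> rel_interior Q"
    using low[OF Q(2)] yP by blast
  have "Q \<noteq> {}"
    using Q(2) by auto
  have affQ: "affine hull Q = affine hull P \<inter> {x. a \<bullet> x = b}"
  proof (rule affine_dim_equal)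
    show "affine hull Q \<subseteq> affine hull P \<inter> {x. a \<bullet> x = b}"
      using ab(2) st'(9)[OF QT(1)] by (intro hull_minimal) (auto intro: affine_Int affine_hyperplane hull_inc)
    have "\<not> affine hull P \<subseteq> {x. a \<bullet> x = b}"
      using notP hull_subset[of F affine] unfolding aff by blast
    moreover have "affine hull P \<inter> {x. a \<bullet> x = b} \<noteq> {}"
      using ab(2) Q(2) aff hull_inc[of y F affine] by auto
    ultimately have "aff_dim (affine hull P \<inter> {x. a \<bullet> x = b}) = int d - 1"
      by (simp add: aff_dim_affine_Int_hyperplane st'(4))
    then show "aff_dim (affine hull Q) = aff_dim (affine hull P \<inter> {x. a \<bullet> x = b})"
      using QT(2) by simp
  qed (use \<open>Q \<noteq> {}\<close> in \<open>auto intro: affine_Int affine_hyperplane\<close>)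
  have hyp: "P \<inter> {x. a \<bullet> x = b} = Q"
  proof (intro equalityI subsetI)
    fix z
    assume z: "z \<in> P \<inter> {x. a \<bullet> x = b}"
    then have zQ: "z \<in> affine hull Q"
      by (simp add: affQ hull_inc)
    show "z \<in> Q"
    proof (rule ccontr)
      assume "z \<notin> Q"
      then obtain w where w: "w \<in> open_segment y z" "w \<in> Q" "w \<notin> rel_interior Q"
        using segment_meets_rel_boundary[OF st'(11)[OF QT(1)] yQ zQ] by blast
      have "w \<in> rel_interior P"
        using rel_interior_closure_convex_segment[OF st'(3) yP, of z] w(1) z closure_subset by blast
      then show False
        using low w by blast
    qed
  qed (use ab(2) st'(9)[OF F(1)] in auto)
  \<comment> \<open>A simplex crossing the hyperplane would have a point of Q strictly inside one of
    its segments, and the face T \<inter> Q would then contain an endpoint off the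
    hyperplane.\<close>
  have side: "T \<subseteq> {x. a \<bullet> x \<le> b} \<or> T \<subseteq> {x. b \<le> a \<bullet> x}" if T: "T \<in> \<T>" for T
  proof (rule ccontr)
    assume "\<not> ?thesis"
    then obtain u v where uv: "u \<in> T" "b < a \<bullet> u" "v \<in> T" "a \<bullet> v < b"
      by fastforce
    define t where "t = (b - a \<bullet> v) / (a \<bullet> u - a \<bullet> v)"
    have t: "0 < t" "t < 1"
      using uv by (auto simp: t_def field_simps)
    define r where "r = (1 - t) *\<^sub>R v + t *\<^sub>R u"
    have "a \<bullet> r = a \<bullet> v + t * (a \<bullet> u - a \<bullet> v)"
      by (simp add: r_def inner_add_right algebra_simps)
    also have "\<dots> = b"
      using uv by (simp add: t_def)
    finally have "a \<bullet> r = b" .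
    have seg: "r \<in> open_segment v u"
      using t uv by (auto simp: in_segment r_def)
    then have "r \<in> T"
      using uv st'(10)[OF T] by (meson closed_segment_subset open_closed_segment subsetD)
    then have "r \<in> T \<inter> Q"
      using \<open>a \<bullet> r = b\<close> hyp st'(9)[OF T] by blast
    then have "v \<in> T \<inter> Q"
      using face_ofD[OF st'(14)[OF T QT(1)] seg] uv by blast
    then show False
      using uv(4) hyp by blast
  qed
  obtain p0 where p0: "p0 \<in> F" "a \<bullet> p0 < b"
    using notP ab(1) by fastforce
  then have p0P: "p0 \<in> P"
    using st'(9)[OF F(1)] by blast
  \<comment> \<open>As y is a relative interior point, the line from p0 through y continues in P to
    the other side.\<close>
  then obtain e where e: "1 < e" "(1 - e) *\<^sub>R p0 + e *\<^sub>R y \<in> P"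
    using yP convex_rel_interior_iff[OF st'(3,5)] by blast
  have "a \<bullet> y = b"
    using ab(2) Q(2) by blast
  then have "a \<bullet> ((1 - e) *\<^sub>R p0 + e *\<^sub>R y) = b + (e - 1) * (b - a \<bullet> p0)"
    by (simp add: inner_add_right algebra_simps)
  also have "\<dots> > b"
    using e p0 by simp
  finally have "\<exists>p\<in>P. b < a \<bullet> p"
    using e by blast
  moreover have "\<not> Q \<subseteq> rel_frontier P"
    using Q(2) yP by (auto simp: rel_frontier_def)
  ultimately show ?thesis
    using that[OF QT hyp _ side] p0P p0 by blast
qed

text \<open>Cut along an interior ridge Q: the halves share exactly the faces of Q, so their face
  numbers add up to those of the whole plus d choose i. The interior ridges are those of the halves
  and Q itself.\<close>

lemma stacked_complex_counts:
  assumes "stacked_complex d P \<T>" "1 \<le> d"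
  defines "k \<equiv> card (dim_faces \<T> (Suc d))"
  shows "1 \<le> k"
    and "card (dim_faces \<T> i) = (Suc d choose i) + (k - 1) * above_count (Suc d) 1 i"
    and "card {T \<in> dim_faces \<T> d. \<not> T \<subseteq> rel_frontier P} = k - 1"
proof -
  have "1 \<le> card (dim_faces \<T> (Suc d)) \<and>
     (\<forall>i. card (dim_faces \<T> i) = (Suc d choose i) + (card (dim_faces \<T> (Suc d)) - 1) * above_count (Suc d) 1 i) \<and>
     card {T \<in> dim_faces \<T> d. \<not> T \<subseteq> rel_frontier P} = card (dim_faces \<T> (Suc d)) - 1"
    using assms(1)
  proof (induction "card (dim_faces \<T> (Suc d))" arbitrary: P \<T> rule: less_induct)
    case less
    note st = less.prems
    note st' = stacked_complexD[OF st]
    have fin: "finite (dim_faces \<T> i)" for i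
      using st'(7) by (simp add: dim_faces_def)
    have pos: "1 \<le> card (dim_faces \<T>' (Suc d))" if "stacked_complex d P' \<T>'" for P' :: "'a set" and \<T>'
    proof -
      note st'' = stacked_complexD[OF that]
      obtain T0 where "T0 \<in> \<T>'"
        using st''(2,5) by blast
      then obtain F where "F \<in> \<T>'" "aff_dim F = int d"
        using simplicial_complex_pure[OF st''(1,2,3,5)] st''(4) by metis
      then have "F \<in> dim_faces \<T>' (Suc d)"
        by (simp add: dim_faces_def)
      then show ?thesis
        using st''(7) by (auto simp: Suc_le_eq card_gt_0_iff dim_faces_def)
    qed
    show ?case
    proof (cases "card (dim_faces \<T> (Suc d)) = 1")
      case True
      then obtain F where F: "dim_faces \<T> (Suc d) = {F}"
        by (auto simp: card_1_singleton_iff)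
      then have FT: "F \<in> \<T>" "aff_dim F = int d"
        by (auto simp: dim_faces_def)
      have subF: "T \<subseteq> F" if T: "T \<in> \<T>" for T
      proof -
        obtain S where "S \<in> \<T>" "aff_dim S = int d" "T \<subseteq> S"
          using simplicial_complex_pure[OF st'(1,2,3,5) T] st'(4) by metis
        then show ?thesis
          using F by (auto simp: dim_faces_def)
      qed
      have PF: "P = F"
        using subF st'(2) FT(1) by blast
      have faces: "\<T> = {T. T face_of F}"
        using st'(13)[OF FT(1)] st'(14)[OF FT(1)] subF by (auto simp: Int_absorb1)
      have "(int (Suc d) - 1) simplex F"
        using st'(12)[OF FT(1)] FT(2) by simp
      then have "card (dim_faces \<T> i) = Suc d choose i" for i
        unfolding faces by (rule card_simplex_dim_faces)
      moreover have "{T \<in> dim_faces \<T> d. \<not> T \<subseteq> rel_frontier P} = {}"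
        using FT(2) face_of_subset_rel_frontier[of _ F] by (fastforce simp: dim_faces_def faces PF)
      ultimately show ?thesis
        using True by (simp only: card.empty) simp
    next
      case False
      obtain Q a b where Q: "Q \<in> \<T>" "aff_dim Q = int d - 1" "P \<inter> {x. a \<bullet> x = b} = Q"
        "\<not> Q \<subseteq> rel_frontier P"
        and side: "\<And>T. T \<in> \<T> \<Longrightarrow> T \<subseteq> {x. a \<bullet> x \<le> b} \<or> T \<subseteq> {x. b \<le> a \<bullet> x}"
        and "\<exists>p\<in>P. a \<bullet> p < b" "\<exists>p\<in>P. b < a \<bullet> p"
        using stacked_complex_interior_ridge[OF st False] by blast
      then obtain p1 p2 where p: "p1 \<in> P" "a \<bullet> p1 < b" "p2 \<in> P" "b < a \<bullet> p2"
        by blast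
      \<comment> \<open>The upper half is written with - a and - b, so that the same half-space
        lemma serves both sides.\<close>
      define P1 P2 where "P1 = P \<inter> {x. a \<bullet> x \<le> b}" and "P2 = P \<inter> {x. - a \<bullet> x \<le> - b}"
      define \<T>1 \<T>2 where "\<T>1 = {T\<in>\<T>. T \<subseteq> {x. a \<bullet> x \<le> b}}" and "\<T>2 = {T\<in>\<T>. T \<subseteq> {x. - a \<bullet> x \<le> - b}}"
      note half1 = stacked_complex_halfspace[OF st Q(1-3) side p(1,2), folded P1_def \<T>1_def]
      have hyp2: "P \<inter> {x. - a \<bullet> x = - b} = Q"
        using Q(3) by simp
      have side2: "T \<subseteq> {x. - a \<bullet> x \<le> - b} \<or> T \<subseteq> {x. - b \<le> - a \<bullet> x}" if "T \<in> \<T>" for T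
        using side[OF that] by auto
      have p2: "- a \<bullet> p2 < - b"
        using p by simp
      note half2 = stacked_complex_halfspace[OF st Q(1,2) hyp2 side2 p(3) p2, folded P2_def \<T>2_def]
      have un: "\<T> = \<T>1 \<union> \<T>2"
        using side by (auto simp: \<T>1_def \<T>2_def)
      have int: "\<T>1 \<inter> \<T>2 = {T. T face_of Q}"
      proof (intro equalityI subsetI)
        fix T
        assume "T \<in> \<T>1 \<inter> \<T>2"
        then have T: "T \<in> \<T>" "T \<subseteq> {x. a \<bullet> x = b}"
          by (auto simp: \<T>1_def \<T>2_def intro: antisym)
        then have "T \<subseteq> Q"
          using Q(3) st'(9) by blast
        then show "T \<in> {T. T face_of Q}"
          using st'(14)[OF Q(1) T(1)] by (simp add: Int_absorb1)
      next
        fix T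
        assume T: "T \<in> {T. T face_of Q}"
        then have "T \<subseteq> {x. a \<bullet> x = b}"
          using Q(3) face_of_imp_subset by blast
        then show "T \<in> \<T>1 \<inter> \<T>2"
          using T st'(13)[OF Q(1)] by (auto simp: \<T>1_def \<T>2_def)
      qed
      have fin12: "finite (dim_faces \<T>1 i)" "finite (dim_faces \<T>2 i)" for i
        using st'(7) by (simp_all add: dim_faces_def \<T>1_def \<T>2_def)
      have "(int d - 1) simplex Q"
        using st'(12)[OF Q(1)] Q(2) by simp
      then have cQ: "card (dim_faces {T. T face_of Q} i) = d choose i" for i
        by (rule card_simplex_dim_faces)
      have "dim_faces \<T> i = dim_faces \<T>1 i \<union> dim_faces \<T>2 i"
        "dim_faces {T. T face_of Q} i = dim_faces \<T>1 i \<inter> dim_faces \<T>2 i" for i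
        unfolding un int[symmetric] by (auto simp: dim_faces_def)
      then have sum: "card (dim_faces \<T>1 i) + card (dim_faces \<T>2 i) = card (dim_faces \<T> i) + (d choose i)" for i
        using card_Un_Int[OF fin12] cQ by metis
      define k1 k2 where "k1 = card (dim_faces \<T>1 (Suc d))" and "k2 = card (dim_faces \<T>2 (Suc d))"
      have k: "card (dim_faces \<T> (Suc d)) = k1 + k2" "1 \<le> k1" "1 \<le> k2"
        using sum[of "Suc d"] pos[OF half1(1)] pos[OF half2(1)] by (simp_all add: k1_def k2_def)
      have lt: "card (dim_faces \<T>1 (Suc d)) < card (dim_faces \<T> (Suc d))"
        "card (dim_faces \<T>2 (Suc d)) < card (dim_faces \<T> (Suc d))"
        using k unfolding k1_def[symmetric] k2_def[symmetric] by linarith+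
      have IH1: "\<And>i. card (dim_faces \<T>1 i) = (Suc d choose i) + (k1 - 1) * above_count (Suc d) 1 i"
        "card {T \<in> dim_faces \<T>1 d. \<not> T \<subseteq> rel_frontier P1} = k1 - 1"
        using less.hyps[OF lt(1) half1(1)] unfolding k1_def[symmetric] by blast+
      have IH2: "\<And>i. card (dim_faces \<T>2 i) = (Suc d choose i) + (k2 - 1) * above_count (Suc d) 1 i"
        "card {T \<in> dim_faces \<T>2 d. \<not> T \<subseteq> rel_frontier P2} = k2 - 1"
        using less.hyps[OF lt(2) half2(1)] unfolding k2_def[symmetric] by blast+
      have split: "Suc d choose i = (d choose i) + above_count (Suc d) 1 i" for i
        by (cases i) (simp_all add: above_count_def)
      obtain l1 l2 where l: "k1 = Suc l1" "k2 = Suc l2"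
        using k(2,3) by (metis Suc_le_D One_nat_def)
      have "card (dim_faces \<T> i) = (Suc d choose i) + (k1 + k2 - 1) * above_count (Suc d) 1 i" for i
        using sum[of i] unfolding IH1(1) IH2(1) l split by (simp add: algebra_simps)
      moreover have "card {T \<in> dim_faces \<T> d. \<not> T \<subseteq> rel_frontier P} = k1 + k2 - 1"
      proof -
        let ?I1 = "{T \<in> dim_faces \<T>1 d. \<not> T \<subseteq> rel_frontier P1}"
        let ?I2 = "{T \<in> dim_faces \<T>2 d. \<not> T \<subseteq> rel_frontier P2}"
        have Qnot: "Q \<notin> ?I1" "Q \<notin> ?I2"
          using half1(3) half2(3) by auto
        have "T = Q" if "T \<in> dim_faces \<T>1 d" "T \<in> dim_faces \<T>2 d" for T
        proof (rule ccontr)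
          assume "T \<noteq> Q"
          have "T face_of Q" "aff_dim T = int d - 1"
            using that int by (auto simp: dim_faces_def)
          then show False
            using face_of_aff_dim_lt[OF st'(10)[OF Q(1)] _ \<open>T \<noteq> Q\<close>] Q(2) by simp
        qed
        then have "?I1 \<inter> ?I2 = {}"
          using Qnot by blast
        moreover have "{T \<in> dim_faces \<T> d. \<not> T \<subseteq> rel_frontier P} = insert Q (?I1 \<union> ?I2)"
        proof (intro equalityI subsetI)
          fix T
          assume T: "T \<in> {T \<in> dim_faces \<T> d. \<not> T \<subseteq> rel_frontier P}"
          then have "T \<in> \<T>1 \<or> T \<in> \<T>2" "aff_dim T = int d - 1"
            using un by (auto simp: dim_faces_def)
          then show "T \<in> insert Q (?I1 \<union> ?I2)"
            using half1(2)[of T] half2(2)[of T] T by (auto simp: dim_faces_def)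
        next
          fix T
          assume T: "T \<in> insert Q (?I1 \<union> ?I2)"
          show "T \<in> {T \<in> dim_faces \<T> d. \<not> T \<subseteq> rel_frontier P}"
          proof (cases "T = Q")
            case True
            then show ?thesis
              using Q by (simp add: dim_faces_def)
          next
            case False
            then have "(T \<in> \<T>1 \<and> \<not> T \<subseteq> rel_frontier P1 \<or> T \<in> \<T>2 \<and> \<not> T \<subseteq> rel_frontier P2) \<and> aff_dim T = int d - 1"
              using T by (auto simp: dim_faces_def)
            then show ?thesis
              using half1(2)[of T] half2(2)[of T] False un by (auto simp: dim_faces_def)
          qed
        qed
        ultimately show ?thesis
          using Qnot fin12 IH1(2) IH2(2) l by (simp add: card_Un_disjoint)
      qed
      moreover have "1 \<le> k1 + k2"
        using k by linarith
      ultimately show ?thesis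
        unfolding k(1) by blast
    qed
  qed
  then show "1 \<le> k"
    "card (dim_faces \<T> i) = (Suc d choose i) + (k - 1) * above_count (Suc d) 1 i"
    "card {T \<in> dim_faces \<T> d. \<not> T \<subseteq> rel_frontier P} = k - 1"
    unfolding k_def by blast+
qed

section \<open>Face numbers of stacked polytopes\<close>

lemma stack_subdivision_imp_stacked_complex:
  assumes "simplicial_polytope d P" "stack_subdivision P \<T>"
  shows "stacked_complex d P \<T>"
  using assms polytope_imp_convex
  unfolding simplicial_polytope_def stack_subdivision_def polytope_triangulation_def stacked_complex_def
  by auto

text \<open>A relative interior point of F lies in some simplex T. Then F \<inter> T is a
  low-dimensional simplex of the complex, hence a face of P, and a face of P meeting the relative
  interior of F contains F.\<close>

lemma stacked_complex_low_faces:
  assumes st: "stacked_complex d P \<T>" and dim: "aff_dim F \<le> int d - 2"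
  shows "F face_of P \<longleftrightarrow> F \<in> \<T>"
proof
  note st' = stacked_complexD[OF st]
  assume F: "F face_of P"
  show "F \<in> \<T>"
  proof (cases "F = {}")
    case True
    obtain T where "T \<in> \<T>"
      using st'(2,5) by blast
    then show ?thesis
      using st'(13) True by blast
  next
    case False
    have "convex F"
      using F face_of_imp_convex by blast
    then obtain x where x: "x \<in> rel_interior F"
      using False rel_interior_eq_empty by blast
    then have "x \<in> F"
      using rel_interior_subset by blast
    then obtain T where T: "T \<in> \<T>" "x \<in> T"
      using F st'(2) face_of_imp_subset by blast
    have "F \<inter> T face_of T"
      using face_of_slice[OF F st'(10)[OF T(1)]] st'(9)[OF T(1)] by (simp add: Int_absorb1)
    then have G: "F \<inter> T \<in> \<T>"
      using st'(13)[OF T(1)] by blast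
    moreover have "aff_dim (F \<inter> T) \<le> int d - 2"
      using dim aff_dim_subset[of "F \<inter> T" F] by simp
    ultimately have "F \<inter> T face_of P"
      using st'(8) by blast
    moreover have "x \<in> (F \<inter> T) \<inter> rel_interior F"
      using x \<open>x \<in> F\<close> T(2) by simp
    ultimately have "F \<subseteq> F \<inter> T"
      using subset_of_face_of[of "F \<inter> T" P F] face_of_imp_subset[OF F] by blast
    then show ?thesis
      using G by (simp add: Int_absorb2)
  qed
qed (use stacked_complexD(8)[OF st] dim in blast)

text \<open>The simplices inside a facet cover it, so one of them has dimension d - 1. Its vertices
  are faces of P, hence vertices of the facet, and both are simplices with d vertices.\<close>

lemma stacked_complex_facets:
  assumes poly: "simplicial_polytope d P" and st: "stacked_complex d P \<T>" and d: "1 \<le> d"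
  shows "F facet_of P \<longleftrightarrow> F \<in> \<T> \<and> aff_dim F = int d - 1 \<and> F \<subseteq> rel_frontier P"
proof -
  note st' = stacked_complexD[OF st]
  have polyP: "polyhedron P"
    using poly polytope_imp_polyhedron by (auto simp: simplicial_polytope_def)
  have eq: "T = F" if F: "F facet_of P" and T: "T \<in> \<T>" "T \<subseteq> F" "aff_dim T = int d - 1" for T F
  proof (cases "d = 1")
    \<comment> \<open>For d = 1 the stacked condition does not reach the vertices, but then both
      sets are single points.\<close>
    case True
    then obtain u v where "T = {u}" "F = {v}"
      using F T(3) st'(4) aff_dim_eq_0[of T] aff_dim_eq_0[of F] by (auto simp: facet_of_def)
    then show ?thesis
      using T(2) by simp
  next
    case False
    obtain n where "n simplex F"
      using poly F by (auto simp: simplicial_polytope_def)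
    moreover from this have "n = int d - 1"
      using F st'(4) aff_dim_simplex[of n F] by (simp add: facet_of_def)
    ultimately obtain C where C: "finite C" "\<not> affine_dependent C" "card C = d" "F = convex hull C"
      by (auto simp: simplex)
    obtain C' where C': "\<not> affine_dependent C'" "card C' = d" "T = convex hull C'"
      using st'(12)[OF T(1)] T(3) by (auto simp: simplex_def)
    have "C' \<subseteq> C"
    proof
      fix c
      assume c: "c \<in> C'"
      then have "c extreme_point_of T"
        by (simp add: C'(3) extreme_point_of_convex_hull_affine_independent[OF C'(1)])
      then have "{c} face_of T"
        by (simp add: face_of_singleton)
      then have "{c} face_of P"
        using st'(8)[of "{c}"] st'(13)[OF T(1)] False d by simp
      moreover have "c \<in> F"
        using T(2) \<open>{c} face_of T\<close> face_of_imp_subset by blast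
      ultimately have "{c} face_of F"
        using facet_of_imp_subset[OF F] by (intro face_of_subset[of "{c}" P F]) auto
      then show "c \<in> C"
        using extreme_point_of_convex_hull by (auto simp: face_of_singleton C(4))
    qed
    then have "C' = C"
      using C(1,3) C'(2) by (simp add: card_subset_eq)
    then show ?thesis
      using C(4) C'(3) by simp
  qed
  have facet_in: "F \<in> \<T>" if F: "F facet_of P" for F
  proof -
    have face: "F face_of P" "convex F" "F \<noteq> {}"
      using F by (auto simp: facet_of_def face_of_imp_convex)
    define \<T>F where "\<T>F = {T\<in>\<T>. T \<subseteq> F}"
    have cpx: "simplicial_complex \<T>F"
      unfolding simplicial_complex_def
    proof (intro conjI ballI allI impI)
      show "finite \<T>F"
        using st'(7) by (simp add: \<T>F_def)
      show "\<exists>n. n simplex S" if "S \<in> \<T>F" for S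
        using st'(12) that by (auto simp: \<T>F_def)
      show "G \<in> \<T>F" if "S \<in> \<T>F \<and> G face_of S" for G S
        using st'(13)[of S G] face_of_imp_subset[of G S] that by (auto simp: \<T>F_def)
      show "S \<inter> S' face_of S" if "S \<in> \<T>F \<and> S' \<in> \<T>F" for S S'
        using st'(14)[of S S'] that by (auto simp: \<T>F_def)
    qed
    have cover: "\<Union>\<T>F = F"
    proof (intro equalityI subsetI)
      fix x
      assume "x \<in> F"
      then obtain T where T: "T \<in> \<T>" "x \<in> T"
        using face_of_imp_subset[OF face(1)] st'(2) by blast
      have "F \<inter> T face_of T"
        using face_of_slice[OF face(1) st'(10)[OF T(1)]] st'(9)[OF T(1)] by (simp add: Int_absorb1)
      then have "F \<inter> T \<in> \<T>F"
        using st'(13)[OF T(1)] by (simp add: \<T>F_def)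
      then show "x \<in> \<Union>\<T>F"
        using T(2) \<open>x \<in> F\<close> by blast
    qed (auto simp: \<T>F_def)
    obtain T0 where "T0 \<in> \<T>F"
      using cover face(3) by blast
    then obtain S where "S \<in> \<T>F" "aff_dim S = aff_dim F"
      using simplicial_complex_pure[OF cpx cover face(2,3)] by blast
    then have "S = F"
      using F st'(4) by (intro eq) (auto simp: \<T>F_def facet_of_def)
    then show ?thesis
      using \<open>S \<in> \<T>F\<close> by (simp add: \<T>F_def)
  qed
  show ?thesis
  proof
    assume F: "F facet_of P"
    then have "F \<noteq> P"
      by auto
    then show "F \<in> \<T> \<and> aff_dim F = int d - 1 \<and> F \<subseteq> rel_frontier P"
      using facet_in[OF F] F st'(4) face_of_subset_rel_frontier[of F P] by (auto simp: facet_of_def)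
  next
    assume F: "F \<in> \<T> \<and> aff_dim F = int d - 1 \<and> F \<subseteq> rel_frontier P"
    then have "F \<noteq> {}"
      using d by auto
    then obtain x where x: "x \<in> rel_interior F"
      using F st'(10) rel_interior_eq_empty by blast
    then have "x \<in> rel_frontier P"
      using F rel_interior_subset by blast
    then obtain G where G: "G facet_of P" "x \<in> G"
      using rel_frontier_of_polyhedron[OF polyP] by blast
    then have "F \<subseteq> G"
      using x F st'(9)[of F] subset_of_face_of[OF facet_of_imp_face_of[OF G(1)], of F] by blast
    then show "F facet_of P"
      using eq[OF G(1), of F] F G(1) by simp
  qed
qed

text \<open>For i \<le> d the count \<open>above_count (Suc d) d i\<close> is 1 at i = d and 0
  otherwise: it removes the k - 1 interior ridges. It stands on the left to avoid truncated
  subtraction.\<close>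

lemma stacked_polytope_face_counts:
  assumes poly: "simplicial_polytope d P" and st: "stacked_complex d P \<T>" and d: "1 \<le> d" and i: "i \<le> d"
  defines "k \<equiv> card {T\<in>\<T>. aff_dim T = int d}"
  shows "1 \<le> k"
    and "card {F. F face_of P \<and> F \<noteq> P \<and> aff_dim F = int i - 1} + (k - 1) * above_count (Suc d) d i =
      (Suc d choose i) + (k - 1) * above_count (Suc d) 1 i"
proof -
  note st' = stacked_complexD[OF st]
  have k: "k = card (dim_faces \<T> (Suc d))"
    by (simp add: k_def dim_faces_def)
  note counts = stacked_complex_counts[OF st d, folded k]
  show "1 \<le> k"
    by (rule counts(1))
  show "card {F. F face_of P \<and> F \<noteq> P \<and> aff_dim F = int i - 1} + (k - 1) * above_count (Suc d) d i =
      (Suc d choose i) + (k - 1) * above_count (Suc d) 1 i"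
  proof (cases "i = d")
    case False
    then have "F face_of P \<and> F \<noteq> P \<longleftrightarrow> F \<in> \<T>" if "aff_dim F = int i - 1" for F
      using stacked_complex_low_faces[OF st, of F] that i st'(4) by auto
    then have "{F. F face_of P \<and> F \<noteq> P \<and> aff_dim F = int i - 1} = dim_faces \<T> i"
      by (auto simp: dim_faces_def)
    moreover have "above_count (Suc d) d i = 0"
      using False i by (simp add: above_count_def)
    ultimately show ?thesis
      using counts(2)[of i] by simp
  next
    case True
    have "{F. F face_of P \<and> F \<noteq> P \<and> aff_dim F = int i - 1} = {F. F facet_of P}"
      using d st'(4) by (auto simp: facet_of_def True)
    also have "\<dots> = {T\<in>dim_faces \<T> d. T \<subseteq> rel_frontier P}"
      using stacked_complex_facets[OF poly st d] by (auto simp: dim_faces_def)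
    finally have eq: "{F. F face_of P \<and> F \<noteq> P \<and> aff_dim F = int i - 1} = {T\<in>dim_faces \<T> d. T \<subseteq> rel_frontier P}" .
    have fin: "finite (dim_faces \<T> d)"
      using st'(7) by (simp add: dim_faces_def)
    have "card {T\<in>dim_faces \<T> d. T \<subseteq> rel_frontier P} + card {T\<in>dim_faces \<T> d. \<not> T \<subseteq> rel_frontier P} =
      card ({T\<in>dim_faces \<T> d. T \<subseteq> rel_frontier P} \<union> {T\<in>dim_faces \<T> d. \<not> T \<subseteq> rel_frontier P})"
      using fin by (intro card_Un_disjoint[symmetric]) auto
    also have "{T\<in>dim_faces \<T> d. T \<subseteq> rel_frontier P} \<union> {T\<in>dim_faces \<T> d. \<not> T \<subseteq> rel_frontier P} = dim_faces \<T> d"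
      by blast
    finally have "card {T\<in>dim_faces \<T> d. T \<subseteq> rel_frontier P} + card {T\<in>dim_faces \<T> d. \<not> T \<subseteq> rel_frontier P} =
      card (dim_faces \<T> d)" .
    then show ?thesis
      using counts(2)[of d] counts(3) unfolding eq[unfolded True] True by (simp add: above_count_def)
  qed
qed

lemma ab_sum_stacked_polytope:
  fixes P :: "'e::euclidean_space set"
  assumes poly: "simplicial_polytope d P" and st: "stacked_complex d P \<T>" and d: "1 \<le> d"
  defines "k \<equiv> card {T\<in>\<T>. aff_dim T = int d}"
  shows "(\<Sum>i\<le>d. of_nat (card {F. F face_of P \<and> F \<noteq> P \<and> aff_dim F = int i - 1}) * face_term d i) =
    gluing_ab d 0 + of_nat (k - 1) * gluing_ab d 1"
proof -
  let ?N = "\<lambda>i. card {F. F face_of P \<and> F \<noteq> P \<and> aff_dim F = int i - 1}"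
  have "(\<Sum>i\<le>d. of_nat (?N i + (k - 1) * above_count (Suc d) d i) * face_term d i) =
    (\<Sum>i\<le>d. of_nat ((Suc d choose i) + (k - 1) * above_count (Suc d) 1 i) * face_term d i)"
    using stacked_polytope_face_counts(2)[OF poly st d] unfolding k_def by (intro sum.cong refl) simp
  then have "(\<Sum>i\<le>d. of_nat (?N i) * face_term d i) + of_nat (k - 1) * upper_ab d d =
     upper_ab d 0 + of_nat (k - 1) * upper_ab d 1"
    by (simp add: upper_ab_def distrib_right sum.distrib sum_distrib_left mult.assoc above_count_def[of _ 0])
  then show ?thesis
    by (simp add: gluing_ab_def upper_ab_top algebra_simps)
qed

section \<open>The boundary complex of a simplicial polytope\<close>

lemma simplicial_polytope_proper_face:
  assumes poly: "simplicial_polytope d P" and F: "F face_of P" "F \<noteq> P"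
  obtains C where "\<not> affine_dependent C" "F = convex hull C"
proof (cases "F = {}")
  case True
  then show ?thesis
    using that[of "{}"] by simp
next
  case False
  have "polyhedron P"
    using poly polytope_imp_polyhedron by (auto simp: simplicial_polytope_def)
  then obtain G where G: "G facet_of P" "F \<subseteq> G"
    using face_of_polyhedron_subset_facet[OF _ F(1) False F(2)] by blast
  obtain n where "n simplex G"
    using poly G(1) by (auto simp: simplicial_polytope_def)
  then obtain C where C: "\<not> affine_dependent C" "G = convex hull C"
    by (auto simp: simplex_def)
  have "F face_of G"
    using face_of_subset[OF F(1) G(2)] facet_of_imp_subset[OF G(1)] by blast
  then obtain c where "c \<subseteq> C" "F = convex hull c"
    using face_of_convex_hull_affine_independent[OF C(1)] C(2) by auto
  then show ?thesis
    using that[of c] affine_dependent_subset C(1) by blast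
qed

text \<open>Proper faces are replaced by their vertex sets, so that
  \<open>ab_index_face_poset\<close> applies to the polytope.\<close>

definition boundary_asc :: "'e::euclidean_space set \<Rightarrow> 'e set set"
  where "boundary_asc P = (\<lambda>F. {v. v extreme_point_of F}) ` {F. F face_of P \<and> F \<noteq> P}"

lemma proper_face_extreme_points:
  assumes poly: "simplicial_polytope d P" and F: "F face_of P" "F \<noteq> P"
  shows "\<not> affine_dependent {v. v extreme_point_of F}"
    and "convex hull {v. v extreme_point_of F} = F"
    and "int (card {v. v extreme_point_of F}) = aff_dim F + 1"
proof -
  obtain C where C: "\<not> affine_dependent C" "F = convex hull C"
    using simplicial_polytope_proper_face[OF assms] by blast
  have "{v. v extreme_point_of F} = C"
    by (simp add: C(2) extreme_point_of_convex_hull_affine_independent[OF C(1)])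
  then show "\<not> affine_dependent {v. v extreme_point_of F}"
    "convex hull {v. v extreme_point_of F} = F"
    "int (card {v. v extreme_point_of F}) = aff_dim F + 1"
    using C aff_dim_affine_independent[OF C(1)] by (simp_all add: aff_dim_convex_hull)
qed

lemma pure_asc_boundary_asc:
  fixes P :: "'e::euclidean_space set"
  assumes poly: "simplicial_polytope (Suc n) P"
  shows "pure_asc n (boundary_asc P)"
proof -
  have P: "polytope P" "aff_dim P = int (Suc n)"
    using poly by (auto simp: simplicial_polytope_def)
  then have ne: "P \<noteq> {}"
    by auto
  have fin: "finite V" if "V \<in> boundary_asc P" for V
    using that proper_face_extreme_points(1)[OF poly] aff_independent_finite by (auto simp: boundary_asc_def)
  have "asc (boundary_asc P)"
    unfolding asc_def
  proof (intro conjI ballI allI impI)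
    show "finite (boundary_asc P)"
      using finite_polytope_faces[OF P(1)] by (auto simp: boundary_asc_def)
    show "boundary_asc P \<noteq> {}"
      using ne empty_face_of[of P] by (auto simp: boundary_asc_def)
    show "finite V" if "V \<in> boundary_asc P" for V
      using fin that .
    fix V G
    assume "V \<in> boundary_asc P" and G: "G \<subseteq> V"
    then obtain F where F: "F face_of P" "F \<noteq> P" "V = {v. v extreme_point_of F}"
      by (auto simp: boundary_asc_def)
    note ext = proper_face_extreme_points[OF poly F(1,2), folded F(3)]
    have "convex hull G face_of F"
      using face_of_convex_hull_affine_independent[OF ext(1)] G ext(2) by auto
    then have "convex hull G face_of P" "convex hull G \<subseteq> F"
      using F(1) face_of_trans face_of_imp_subset by blast+
    moreover have "convex hull G \<noteq> P"
      using \<open>convex hull G \<subseteq> F\<close> F face_of_imp_subset by blast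
    moreover have "\<not> affine_dependent G"
      using ext(1) G affine_dependent_subset by blast
    then have "G = {v. v extreme_point_of convex hull G}"
      by (simp add: extreme_point_of_convex_hull_affine_independent)
    ultimately show "G \<in> boundary_asc P"
      unfolding boundary_asc_def by blast
  qed
  moreover have "card V = Suc n" if V: "V \<in> facets (boundary_asc P)" for V
  proof -
    obtain F where F: "F face_of P" "F \<noteq> P" "V = {v. v extreme_point_of F}"
      using V by (auto simp: boundary_asc_def facets_def)
    obtain G where G: "G facet_of P" "F \<subseteq> G"
    proof (cases "F = {}")
      case True
      then show ?thesis
        using that polytope_facet_exists[OF P(1)] P(2) by auto
    next
      case False
      then show ?thesis
        using that face_of_polyhedron_subset_facet[OF polytope_imp_polyhedron[OF P(1)] F(1) False F(2)] by blast
    qed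
    have G': "G face_of P" "G \<noteq> P" "aff_dim G = int n"
      using G(1) P(2) by (auto simp: facet_of_def)
    have "V \<subseteq> {v. v extreme_point_of G}"
      using extreme_point_of_face[OF F(1)] extreme_point_of_face[OF G'(1)] G(2) F(3) by auto
    moreover have "{v. v extreme_point_of G} \<in> boundary_asc P"
      using G' by (auto simp: boundary_asc_def)
    ultimately have "V = {v. v extreme_point_of G}"
      using V by (auto simp: facets_def)
    then show ?thesis
      using proper_face_extreme_points(3)[OF poly G'(1,2)] G'(3) by simp
  qed
  ultimately show ?thesis
    by (simp add: pure_asc_def)
qed

lemma inj_on_extreme_points:
  assumes "simplicial_polytope d P"
  shows "inj_on (\<lambda>F. {v. v extreme_point_of F}) {F. F face_of P \<and> F \<noteq> P}"
  by (rule inj_on_inverseI[of _ "\<lambda>V. convex hull V"]) (use proper_face_extreme_points(2)[OF assms] in auto)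

lemma card_boundary_asc:
  assumes poly: "simplicial_polytope d P"
  shows "card {V\<in>boundary_asc P. card V = i} = card {F. F face_of P \<and> F \<noteq> P \<and> aff_dim F = int i - 1}"
proof -
  have "{V\<in>boundary_asc P. card V = i} =
    (\<lambda>F. {v. v extreme_point_of F}) ` {F. F face_of P \<and> F \<noteq> P \<and> aff_dim F = int i - 1}"
  proof (intro equalityI subsetI)
    fix V
    assume "V \<in> {V\<in>boundary_asc P. card V = i}"
    then obtain F where F: "F face_of P" "F \<noteq> P" "V = {v. v extreme_point_of F}" "card V = i"
      by (auto simp: boundary_asc_def)
    then have "aff_dim F = int i - 1"
      using proper_face_extreme_points(3)[OF poly F(1,2)] by simp
    then show "V \<in> (\<lambda>F. {v. v extreme_point_of F}) ` {F. F face_of P \<and> F \<noteq> P \<and> aff_dim F = int i - 1}"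
      using F by blast
  next
    fix V
    assume "V \<in> (\<lambda>F. {v. v extreme_point_of F}) ` {F. F face_of P \<and> F \<noteq> P \<and> aff_dim F = int i - 1}"
    then obtain F where F: "F face_of P" "F \<noteq> P" "V = {v. v extreme_point_of F}" "aff_dim F = int i - 1"
      by blast
    then show "V \<in> {V\<in>boundary_asc P. card V = i}"
      using proper_face_extreme_points(3)[OF poly F(1,2)] by (auto simp: boundary_asc_def)
  qed
  moreover have "inj_on (\<lambda>F. {v. v extreme_point_of F}) {F. F face_of P \<and> F \<noteq> P \<and> aff_dim F = int i - 1}"
    by (rule inj_on_subset[OF inj_on_extreme_points[OF poly]]) auto
  ultimately show ?thesis
    by (simp add: card_image)
qed

lemma order_iso_face_lattice:
  fixes P :: "'e::euclidean_space set"
  assumes poly: "simplicial_polytope d P"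
  shows "order_iso (\<lambda>F. if F = P then top.Top else top.Value {v. v extreme_point_of F})
    (face_lattice P) (face_poset (boundary_asc P))"
  unfolding order_iso_def
proof (intro conjI ballI)
  let ?\<phi> = "\<lambda>F. if F = P then top.Top else top.Value {v. v extreme_point_of F}"
  have PP: "P face_of P"
    using poly by (auto simp: simplicial_polytope_def polytope_imp_convex face_of_refl)
  have "?\<phi> ` face_lattice P = face_poset (boundary_asc P)"
    using PP by (auto simp: face_lattice_def face_poset_def boundary_asc_def image_iff)
  moreover have "inj_on ?\<phi> (face_lattice P)"
  proof (rule inj_onI)
    fix F G
    assume "F \<in> face_lattice P" "G \<in> face_lattice P" "?\<phi> F = ?\<phi> G"
    then show "F = G"
      using inj_onD[OF inj_on_extreme_points[OF poly], of F G]
      by (auto simp: face_lattice_def split: if_splits)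
  qed
  ultimately show "bij_betw ?\<phi> (face_lattice P) (face_poset (boundary_asc P))"
    by (simp add: bij_betw_def)
  fix F G
  assume "F \<in> face_lattice P" "G \<in> face_lattice P"
  then have F: "F face_of P" and G: "G face_of P"
    by (auto simp: face_lattice_def)
  show "F \<le> G \<longleftrightarrow> ?\<phi> F \<le> ?\<phi> G"
  proof (cases "G = P")
    case True
    then show ?thesis
      using face_of_imp_subset[OF F] by simp
  next
    case GP: False
    show ?thesis
    proof (cases "F = P")
      case True
      then show ?thesis
        using GP face_of_imp_subset[OF G] by auto
    next
      case False
      have "{v. v extreme_point_of F} \<subseteq> {v. v extreme_point_of G} \<longleftrightarrow> F \<subseteq> G"
      proof
        assume "{v. v extreme_point_of F} \<subseteq> {v. v extreme_point_of G}"
        then have "convex hull {v. v extreme_point_of F} \<subseteq> convex hull {v. v extreme_point_of G}"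
          by (rule hull_mono)
        then show "F \<subseteq> G"
          using proper_face_extreme_points(2)[OF poly F False] proper_face_extreme_points(2)[OF poly G GP] by simp
      next
        assume "F \<subseteq> G"
        then show "{v. v extreme_point_of F} \<subseteq> {v. v extreme_point_of G}"
          using extreme_point_of_face[OF F] extreme_point_of_face[OF G] by auto
      qed
      then show ?thesis
        using False GP by simp
    qed
  qed
qed

lemma ab_index_stacked_polytope:
  fixes P :: "'e::euclidean_space set"
  assumes "stacked_polytope k (Suc n) P"
  shows "1 \<le> k"
    and "ab_index (face_lattice P) = gluing_ab (Suc n) 0 + of_nat (k - 1) * gluing_ab (Suc n) 1"
proof -
  obtain \<T> where poly: "simplicial_polytope (Suc n) P" and "stack_subdivision P \<T>"
    and k: "k = card {T\<in>\<T>. aff_dim T = int (Suc n)}"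
    using assms by (auto simp: stacked_polytope_def)
  then have st: "stacked_complex (Suc n) P \<T>"
    using stack_subdivision_imp_stacked_complex by blast
  show "1 \<le> k"
    unfolding k using stacked_polytope_face_counts(1)[OF poly st _ le0] by simp
  have "ab_index (face_lattice P) = ab_index (face_poset (boundary_asc P))"
    by (rule order_iso_ab_index[OF order_iso_face_lattice[OF poly]])
  also have "\<dots> = (\<Sum>i\<le>Suc n. of_nat (card {F. F face_of P \<and> F \<noteq> P \<and> aff_dim F = int i - 1}) * face_term (Suc n) i)"
    unfolding ab_index_face_poset[OF pure_asc_boundary_asc[OF poly]] card_boundary_asc[OF poly] ..
  also have "\<dots> = gluing_ab (Suc n) 0 + of_nat (k - 1) * gluing_ab (Suc n) 1"
    unfolding k by (rule ab_sum_stacked_polytope[OF poly st]) simp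
  finally show "ab_index (face_lattice P) = gluing_ab (Suc n) 0 + of_nat (k - 1) * gluing_ab (Suc n) 1" .
qed


subsection \<open>Comparison of the cd-indices\<close>

lemma cd_index_eqI: "nc_subst cd_value \<Phi> = ab_index P \<Longrightarrow> cd_index P = \<Phi>"
  unfolding cd_index_def by (rule the_equality) (simp_all flip: nc_subst_cd_value_inj)

text \<open>The cd-polynomial of P is obtained as q - r; uniqueness identifies it with the definite
  description \<open>cd_index P\<close>.\<close>

lemma cd_index_mono:
  assumes Q: "ab_index Q \<in> cd_nonneg" and diff: "ab_index Q - ab_index P \<in> cd_nonneg"
  shows "Poly_Mapping.lookup (cd_index P) w \<le> Poly_Mapping.lookup (cd_index Q) w"
proof -
  obtain q r where q: "nc_subst cd_value q = ab_index Q"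
    and r: "nc_subst cd_value r = ab_index Q - ab_index P" "\<And>w. 0 \<le> Poly_Mapping.lookup r w"
    using cd_nonneg_imp_cd_poly[OF Q] cd_nonneg_imp_cd_poly[OF diff] by blast
  have "nc_subst cd_value (q - r) = ab_index P"
    by (simp add: nc_subst_diff q r)
  then have "cd_index P = q - r"
    by (rule cd_index_eqI)
  then show ?thesis
    using cd_index_eqI[OF q] r(2)[of w] by (simp add: lookup_minus)
qed

lemma order_iso_face_poset:
  assumes "poset_iso K L"
  obtains g where "order_iso g (face_poset K) (face_poset L)"
proof -
  obtain f where f: "bij_betw f K L" "\<And>x y. x \<in> K \<Longrightarrow> y \<in> K \<Longrightarrow> x \<le> y \<longleftrightarrow> f x \<le> f y"
    using assms by (auto simp: poset_iso_def)
  define g where "g x = (case x of top.Top \<Rightarrow> top.Top | top.Value G \<Rightarrow> top.Value (f G))" for x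
  have "g ` face_poset K = face_poset L"
    using bij_betw_imp_surj_on[OF f(1), symmetric] by (simp add: face_poset_def g_def image_image)
  moreover have "inj_on g (face_poset K)"
    using bij_betw_imp_inj_on[OF f(1)]
    by (auto simp: inj_on_def face_poset_def g_def)
  moreover have "x \<le> y \<longleftrightarrow> g x \<le> g y" if "x \<in> face_poset K" "y \<in> face_poset K" for x y
    using that f(2) by (auto simp: face_poset_def g_def)
  ultimately show ?thesis
    using that[of g] by (auto simp: order_iso_def bij_betw_def)
qed

theorem theorem7p24:
  fixes d k :: nat
    and \<Delta> :: "'v set set"
    and P :: "'e::euclidean_space set"
  assumes "1 \<le> d"
    and "shellably_triangulizable k d \<Delta>"
    and "stacked_polytope k d P"
  shows "\<forall>w. Poly_Mapping.lookup (cd_index (face_poset \<Delta>)) w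
           \<le> Poly_Mapping.lookup (cd_index (face_lattice P)) w"
proof -
  obtain n where d: "d = Suc n"
    using assms(1) by (cases d) auto
  obtain B :: "nat set set" where B: "simplicial_ball (Suc n) B" "shellable (Suc n) B"
    "card {F\<in>B. card F = Suc (Suc n)} = k" "poset_iso (ball_boundary (Suc n) B) \<Delta>"
    and "asc \<Delta>"
    using assms(2) by (auto simp: shellably_triangulizable_def simplicial_sphere_def d)
  obtain Fs where Fs: "shelling (Suc n) B Fs"
    using B(2) by (auto simp: shellable_def)
  have "\<Delta> \<noteq> {}"
    using \<open>asc \<Delta>\<close> by (simp add: asc_def)
  then have ne: "ball_boundary (Suc n) B \<noteq> {}"
    using B(4) by (auto simp: poset_iso_def bij_betw_def)
  have "pure_asc (Suc n) B"
    using Fs by simp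
  then have two: "card {F\<in>facets B. Q \<subseteq> F} \<le> 2" if "card Q = Suc n" for Q
    using simplicial_ball_ridge_le_2[OF B(1) _ _ that] by simp
  obtain \<rho> where \<rho>: "\<rho> 0 = 0" "\<And>j. 0 < j \<Longrightarrow> j < k \<Longrightarrow> 1 \<le> \<rho> j \<and> \<rho> j \<le> Suc (Suc n)"
    "ab_index (face_poset (ball_boundary (Suc n) B)) = (\<Sum>j<k. gluing_ab (Suc n) (\<rho> j))"
    using ab_index_ball_boundary[OF Fs two ne] unfolding B(3) by blast
  obtain g where "order_iso g (face_poset (ball_boundary (Suc n) B)) (face_poset \<Delta>)"
    using order_iso_face_poset[OF B(4)] by blast
  then have \<Delta>: "ab_index (face_poset \<Delta>) = (\<Sum>j<k. gluing_ab (Suc n) (\<rho> j))"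
    using order_iso_ab_index \<rho>(3) by metis
  note stacked = ab_index_stacked_polytope[OF assms(3)[unfolded d]]
  obtain l where l: "k = Suc l"
    using stacked(1) by (cases k) auto
  have P: "ab_index (face_lattice P) = gluing_ab (Suc n) 0 + (\<Sum>j<l. gluing_ab (Suc n) 1)"
    using stacked(2) by (simp add: l)
  have "gluing_ab (Suc n) 0 \<in> cd_nonneg" "gluing_ab (Suc n) 1 \<in> cd_nonneg"
    by (rule gluing_ab_cd_nonneg, simp)+
  then have "ab_index (face_lattice P) \<in> cd_nonneg"
    unfolding P by (intro cd_nonneg.add cd_nonneg_sum)
  \<comment> \<open>The first facet has \<rho> 0 = 0 and contributes D_0, which cancels against the
    D_0 of the stacked polytope; the other k - 1 terms are paired.\<close>
  moreover have "ab_index (face_lattice P) - ab_index (face_poset \<Delta>) =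
      (\<Sum>j<l. gluing_ab (Suc n) 1 - gluing_ab (Suc n) (\<rho> (Suc j)))"
    unfolding P \<Delta> l sum.lessThan_Suc_shift \<rho>(1) sum_subtractf by simp
  moreover have "(\<Sum>j<l. gluing_ab (Suc n) 1 - gluing_ab (Suc n) (\<rho> (Suc j))) \<in> cd_nonneg"
    using \<rho>(2) by (intro cd_nonneg_sum gluing_ab_le) (auto simp: l)
  ultimately show ?thesis
    using cd_index_mono by metis
qed

end
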